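(* Let $\mu$ be the Gibbs measure on $\Sigma_A$ of a Hölder continuous potential that is not cohomologous to a constant. For $\varepsilon>0$ define $\psi_\varepsilon^{+},\psi_\varepsilon^{-}:\mathbb N\to\mathbb N$ by $$\psi_\varepsilon^{+}(n)=\left\lfloor\frac{\log n}{h_\mu}+\frac{1+\varepsilon}{h_\mu^{3/2}}\sqrt{2\rho_\mu\log n\,\log\log\log n}\right\rfloor,\qquad \psi_\varepsilon^{-}(n)=\left\lfloor\frac{\log n}{h_\mu}+\frac{1-\varepsilon}{h_\mu^{3/2}}\sqrt{2\rho_\mu\log n\,\log\log\log n}\right\rfloor.$$ Then for every $\varepsilon>0$ we have $\mu(R_{\psi_\varepsilon^{+}})=0$ and $\mu(R_{\psi_\varepsilon^{-}})=1$.
   Context: Let $K\ge 2$ be an integer and $\Sigma=\{1,\dots,K\}^{\mathbb N}$, with $|\mathbf i\wedge\mathbf j|=\inf\{n\ge0:i_{n+1}\ne j_{n+1}\}$ and metric $d(\mathbf i,\mathbf j)=K^{-|\mathbf i\wedge\mathbf j|}$. Let $A$ be a $K\times K$ $\{0,1\}$-matrix with $A^M$ strictly positive for some $M$, $\Sigma_A=\{\mathbf i\in\Sigma:A_{i_l,i_{l+1}}=1\ \forall l\}$, $\sigma$ the left shift. $\Sigma_{A,n}$ is the set of admissible words of length $n$, $[w]$ the cylinder in $\Sigma_A$ of a word $w$. $f:\Sigma_A\to\mathbb R$ is Hölder continuous if $|f(\mathbf i)-f(\mathbf j)|\le b\alpha^{|\mathbf i\wedge\mathbf j|}$ for some $b>0,0<\alpha<1$;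 $P(f)=\lim_n\frac1n\log\sum_{w\in\Sigma_{A,n}}\sup_{\mathbf j\in[w]}e^{\sum_{k=0}^{n-1}f(\sigma^k\mathbf j)}$. The Gibbs measure of $f$ is the unique $\sigma$-invariant ergodic probability $\mu$ on $\Sigma_A$ with $C^{-1}\le\mu([i_1\dots i_n])/\exp(-nP(f)+\sum_{k=0}^{n-1}f(\sigma^k\mathbf i))\le C$ for some $C>1$ and all $\mathbf i,n$. $h_\mu=\lim_n-\frac1n\sum_{w\in\Sigma_{A,n}}\mu([w])\log\mu([w])$, $\rho_\mu=\lim_n\frac1n\int(\sum_{k=0}^{n-1}f\circ\sigma^k-n\int f d\mu)^2d\mu$. Cohomologous to a constant: $f=g\circ\sigma-g+c$ with $g$ continuous, $c$ constant. For $\psi:\mathbb N\to\mathbb N$, $R_\psi=\{\mathbf i\in\Sigma_A:d(\sigma^n\mathbf i,\mathbf i)\le K^{-\psi(n)}\text{ for infinitely many }n\}$. Convention: $\log x=0$ for $x\le1$. *)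

theory Defs
  imports "HOL-Probability.Probability"
begin

text \<open>Sequences i = i_1 i_2 ... are represented as x :: nat => nat with x k = i_(k+1).
  The alphabet is {1..K}; the matrix A is a function nat => nat => nat on {1..K}^2.\<close>

definition zero_one_matrix :: "nat \<Rightarrow> (nat \<Rightarrow> nat \<Rightarrow> nat) \<Rightarrow> bool" where
  "zero_one_matrix K A \<longleftrightarrow> (\<forall>a\<in>{1..K}. \<forall>b\<in>{1..K}. A a b \<in> {0, 1})"

fun matpow :: "nat \<Rightarrow> (nat \<Rightarrow> nat \<Rightarrow> nat) \<Rightarrow> nat \<Rightarrow> nat \<Rightarrow> nat \<Rightarrow> nat" where
  "matpow K A 0 a b = (if a = b then 1 else 0)"
| "matpow K A (Suc m) a b = (\<Sum>c\<in>{1..K}. matpow K A m a c * A c b)"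

definition primitive_matrix :: "nat \<Rightarrow> (nat \<Rightarrow> nat \<Rightarrow> nat) \<Rightarrow> bool" where
  "primitive_matrix K A \<longleftrightarrow> (\<exists>M. \<forall>a\<in>{1..K}. \<forall>b\<in>{1..K}. matpow K A M a b > 0)"

definition SigmaA :: "nat \<Rightarrow> (nat \<Rightarrow> nat \<Rightarrow> nat) \<Rightarrow> (nat \<Rightarrow> nat) set" where
  "SigmaA K A = {x. (\<forall>l. x l \<in> {1..K}) \<and> (\<forall>l. A (x l) (x (Suc l)) = 1)}"

definition shift :: "(nat \<Rightarrow> nat) \<Rightarrow> (nat \<Rightarrow> nat)" where
  "shift x = (\<lambda>n. x (Suc n))"

definition agree_len :: "(nat \<Rightarrow> nat) \<Rightarrow> (nat \<Rightarrow> nat) \<Rightarrow> nat" where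
  "agree_len x y = (LEAST n. x n \<noteq> y n)"

definition dist_sym :: "nat \<Rightarrow> (nat \<Rightarrow> nat) \<Rightarrow> (nat \<Rightarrow> nat) \<Rightarrow> real" where
  "dist_sym K x y = (if x = y then 0 else real K powr (- real (agree_len x y)))"

definition admissible_words :: "nat \<Rightarrow> (nat \<Rightarrow> nat \<Rightarrow> nat) \<Rightarrow> nat \<Rightarrow> nat list set" where
  "admissible_words K A n = {w. length w = n \<and> set w \<subseteq> {1..K} \<and>
       (\<forall>l. Suc l < n \<longrightarrow> A (w ! l) (w ! Suc l) = 1)}"

definition cyl :: "nat \<Rightarrow> (nat \<Rightarrow> nat \<Rightarrow> nat) \<Rightarrow> nat list \<Rightarrow> (nat \<Rightarrow> nat) set" where
  "cyl K A w = {x \<in> SigmaA K A. \<forall>k < length w. x k = w ! k}"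

definition shift_space :: "nat \<Rightarrow> (nat \<Rightarrow> nat \<Rightarrow> nat) \<Rightarrow> (nat \<Rightarrow> nat) measure" where
  "shift_space K A = sigma (SigmaA K A) (range (cyl K A))"

definition birkhoff :: "((nat \<Rightarrow> nat) \<Rightarrow> real) \<Rightarrow> nat \<Rightarrow> (nat \<Rightarrow> nat) \<Rightarrow> real" where
  "birkhoff f n x = (\<Sum>k<n. f ((shift ^^ k) x))"

definition holder :: "nat \<Rightarrow> (nat \<Rightarrow> nat \<Rightarrow> nat) \<Rightarrow> ((nat \<Rightarrow> nat) \<Rightarrow> real) \<Rightarrow> bool" where
  "holder K A f \<longleftrightarrow> (\<exists>b \<alpha>. b > 0 \<and> 0 < \<alpha> \<and> \<alpha> < 1 \<and>
     (\<forall>x\<in>SigmaA K A. \<forall>y\<in>SigmaA K A. x \<noteq> y \<longrightarrow> \<bar>f x - f y\<bar> \<le> b * \<alpha> ^ agree_len x y))"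

definition pressure :: "nat \<Rightarrow> (nat \<Rightarrow> nat \<Rightarrow> nat) \<Rightarrow> ((nat \<Rightarrow> nat) \<Rightarrow> real) \<Rightarrow> real" where
  "pressure K A f = lim (\<lambda>n. (1 / real n) *
     ln (\<Sum>w\<in>admissible_words K A n. (SUP j\<in>cyl K A w. exp (birkhoff f n j))))"

definition shift_invariant :: "(nat \<Rightarrow> nat) measure \<Rightarrow> bool" where
  "shift_invariant M \<longleftrightarrow> (\<forall>B\<in>sets M. shift -` B \<inter> space M \<in> sets M \<and>
       measure M (shift -` B \<inter> space M) = measure M B)"

definition shift_ergodic :: "(nat \<Rightarrow> nat) measure \<Rightarrow> bool" where
  "shift_ergodic M \<longleftrightarrow> (\<forall>B\<in>sets M. shift -` B \<inter> space M = B \<longrightarrow>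
       measure M B = 0 \<or> measure M B = 1)"

definition gibbs_measure ::
  "nat \<Rightarrow> (nat \<Rightarrow> nat \<Rightarrow> nat) \<Rightarrow> ((nat \<Rightarrow> nat) \<Rightarrow> real) \<Rightarrow> (nat \<Rightarrow> nat) measure \<Rightarrow> bool" where
  "gibbs_measure K A f M \<longleftrightarrow> prob_space M \<and> sets M = sets (shift_space K A) \<and>
     shift_invariant M \<and> shift_ergodic M \<and>
     (\<exists>C > 1. \<forall>x\<in>SigmaA K A. \<forall>n.
        1 / C \<le> measure M (cyl K A (map x [0..<n])) / exp (- real n * pressure K A f + birkhoff f n x) \<and>
        measure M (cyl K A (map x [0..<n])) / exp (- real n * pressure K A f + birkhoff f n x) \<le> C)"

definition sym_continuous :: "nat \<Rightarrow> (nat \<Rightarrow> nat \<Rightarrow> nat) \<Rightarrow> ((nat \<Rightarrow> nat) \<Rightarrow> real) \<Rightarrow> bool" where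
  "sym_continuous K A g \<longleftrightarrow> (\<forall>x\<in>SigmaA K A. \<forall>e>0. \<exists>\<delta>>0. \<forall>y\<in>SigmaA K A.
      dist_sym K x y < \<delta> \<longrightarrow> \<bar>g y - g x\<bar> < e)"

definition cohom_const :: "nat \<Rightarrow> (nat \<Rightarrow> nat \<Rightarrow> nat) \<Rightarrow> ((nat \<Rightarrow> nat) \<Rightarrow> real) \<Rightarrow> bool" where
  "cohom_const K A f \<longleftrightarrow> (\<exists>g c. sym_continuous K A g \<and>
      (\<forall>x\<in>SigmaA K A. f x = g (shift x) - g x + c))"

definition entropy_sym :: "nat \<Rightarrow> (nat \<Rightarrow> nat \<Rightarrow> nat) \<Rightarrow> (nat \<Rightarrow> nat) measure \<Rightarrow> real" where
  "entropy_sym K A M = lim (\<lambda>n. - (1 / real n) *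
      (\<Sum>w\<in>admissible_words K A n. measure M (cyl K A w) * ln (measure M (cyl K A w))))"

definition asymp_var :: "((nat \<Rightarrow> nat) \<Rightarrow> real) \<Rightarrow> (nat \<Rightarrow> nat) measure \<Rightarrow> real" where
  "asymp_var f M = lim (\<lambda>n. (1 / real n) *
      (\<integral>x. (birkhoff f n x - real n * (\<integral>y. f y \<partial>M))\<^sup>2 \<partial>M))"

definition logc :: "real \<Rightarrow> real" where
  "logc x = (if x \<le> 1 then 0 else ln x)"

definition recurrence_set :: "nat \<Rightarrow> (nat \<Rightarrow> nat \<Rightarrow> nat) \<Rightarrow> (nat \<Rightarrow> nat) \<Rightarrow> (nat \<Rightarrow> nat) set" where
  "recurrence_set K A \<psi> = {x \<in> SigmaA K A.
      infinite {n. dist_sym K ((shift ^^ n) x) x \<le> real K powr (- real (\<psi> n))}}"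

text \<open>psi with coefficient c (c = 1 + eps or c = 1 - eps)\<close>
definition psi_fun ::
  "nat \<Rightarrow> (nat \<Rightarrow> nat \<Rightarrow> nat) \<Rightarrow> ((nat \<Rightarrow> nat) \<Rightarrow> real) \<Rightarrow> (nat \<Rightarrow> nat) measure \<Rightarrow> real \<Rightarrow> nat \<Rightarrow> nat" where
  "psi_fun K A f M c n = (let h = entropy_sym K A M; \<rho> = asymp_var f M; L = logc (real n) in
      nat \<lfloor>L / h + c / h powr (3/2) * sqrt (2 * \<rho> * L * logc (logc L))\<rfloor>)"

end

theory Submission
  imports Defs "HOL-Real_Asymp.Real_Asymp"
begin

text \<open>Everything rests on two consequences of the Gibbs inequality: cylinders are quasi-independent,
  and the transfer operator of \<open>f - P(f)\<close> has iterates bounded away from 0 and infinity. The latter gives an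
  eigenfunction \<open>h\<close>; dividing by it turns the operator into an averaging operator \<open>Q\<close>, and comparing the
  exponential moments of \<open>g - (Q g) \<circ> shift\<close> with Jensen's inequality shows that \<open>\<mu>\<close> is \<open>Q\<close>-stationary. By a
  Doeblin argument \<open>Q\<close> contracts Hoelder functions, so the centred potential is cohomologous to some \<open>m\<close>
  with \<open>Q m = 0\<close>; perturbing \<open>Q\<close> by \<open>t m\<close> yields
  \<open>E (exp (t S\<^sub>n)) = exp (n (\<rho> t\<^sup>2 / 2 + O(t\<^sup>3)) + O(1))\<close>, and the Chernoff bound and exponential tilting,
  together with quasi-independence, give the law of the iterated logarithm for \<open>-log \<mu>([i\<^sub>1 \<dots> i\<^sub>n])\<close>. The
  recurrence statement follows by Borel-Cantelli: among the times \<open>n \<le> N\<close> the first \<open>k\<close> symbols \<open>w\<close> recur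
  about \<open>N \<mu>([w])\<close> times.\<close>

section \<open>Cylinders and quasi-independence\<close>

text \<open>The Gibbs inequality fixes \<open>\<mu>\<close> only up to bounded factors, so every
  estimate loses a multiplicative constant. This is harmless: the law of the iterated logarithm
  concerns probabilities that are negative powers of \<open>ln n\<close>, with an exponent that may
  be adjusted a little, and a small change of the exponent absorbs any constant. Write
  \<open>h\<close> for the entropy and \<open>F\<close> for \<open>f\<close> minus its mean. Then
  the logarithm of the measure of the initial cylinder of length \<open>m\<close> is
  \<open>- h m + S_m F + O(1)\<close>, and the initial word of length \<open>m\<close> recurs before
  time \<open>n\<close> roughly when \<open>h m - S_m F \<le> ln n\<close>. Since
  \<open>S_m F\<close> comes close to \<open>lil \<rho> m\<close> again and again but does not
  essentially exceed it, the longest matches solve \<open>h m - lil \<rho> m = ln n\<close>.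
  Inserting \<open>m = ln n / h\<close> into the second term gives
  \<open>m = ln n / h + lil \<rho> (ln n) / h powr (3/2)\<close>: one factor \<open>h\<close> comes
  from the division, its square root from the argument of \<open>lil\<close>. The triple logarithm
  is the iterated logarithm at time \<open>ln n\<close>. That \<open>f\<close> is not cohomologous
  to a constant makes \<open>\<rho>\<close> and \<open>h\<close> positive.\<close>

definition agree :: "nat \<Rightarrow> (nat \<Rightarrow> nat) \<Rightarrow> (nat \<Rightarrow> nat) \<Rightarrow> bool" where
  "agree n x y \<longleftrightarrow> (\<forall>k<n. x k = y k)"

lemma agree_refl [simp]: "agree n x x"
  by (simp add: agree_def)

lemma agree_0 [simp]: "agree 0 x y"
  by (simp add: agree_def)

lemma agree_sym: "agree n x y \<Longrightarrow> agree n y x"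
  by (simp add: agree_def)

lemma agree_mono: "agree n x y \<Longrightarrow> m \<le> n \<Longrightarrow> agree m x y"
  by (simp add: agree_def)

lemma shift_pow_apply: "(shift ^^ n) x k = x (n + k)"
  by (induction n arbitrary: k) (auto simp: shift_def)

lemma shift_pow_add: "(shift ^^ m) ((shift ^^ n) x) = (shift ^^ (n + m)) x"
  by (simp add: fun_eq_iff shift_pow_apply add.assoc)

lemma agree_shift: "agree (n + m) x y \<Longrightarrow> agree m ((shift ^^ n) x) ((shift ^^ n) y)"
  by (auto simp: agree_def shift_pow_apply)

lemma agree_add_iff:
  "agree (n + m) x y \<longleftrightarrow> agree n x y \<and> agree m ((shift ^^ n) x) ((shift ^^ n) y)"
proof
  assume "agree n x y \<and> agree m ((shift ^^ n) x) ((shift ^^ n) y)"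
  then have a: "\<And>k. k < n \<Longrightarrow> x k = y k" and b: "\<And>k. k < m \<Longrightarrow> x (n + k) = y (n + k)"
    by (auto simp: agree_def shift_pow_apply)
  have "x k = y k" if "k < n + m" for k
    using a[of k] b[of "k - n"] that by (cases "k < n") auto
  then show "agree (n + m) x y" by (auto simp: agree_def)
qed (auto simp: agree_def shift_pow_apply)

lemma birkhoff_0 [simp]: "birkhoff f 0 x = 0"
  by (simp add: birkhoff_def)

lemma birkhoff_1 [simp]: "birkhoff f (Suc 0) x = f x"
  by (simp add: birkhoff_def)

lemma birkhoff_add: "birkhoff f (m + n) x = birkhoff f m x + birkhoff f n ((shift ^^ m) x)"
proof -
  have "birkhoff f (m + n) x = (\<Sum>k<m. f ((shift ^^ k) x)) + (\<Sum>k\<in>{m..<m+n}. f ((shift ^^ k) x))"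
    unfolding birkhoff_def lessThan_atLeast0 by (rule sum.atLeastLessThan_concat[symmetric]) auto
  also have "(\<Sum>k\<in>{m..<m+n}. f ((shift ^^ k) x)) = (\<Sum>k<n. f ((shift ^^ (m + k)) x))"
    using sum.shift_bounds_nat_ivl[of "\<lambda>k. f ((shift ^^ k) x)" 0 m n]
    by (simp add: lessThan_atLeast0 add.commute)
  finally show ?thesis by (simp add: birkhoff_def shift_pow_add)
qed

lemma birkhoff_coboundary:
  "birkhoff (\<lambda>x. g (shift x) - g x) n x = g ((shift ^^ n) x) - g x"
  by (induction n) (auto simp: birkhoff_def)

lemma birkhoff_plus: "birkhoff (\<lambda>x. f x + g x) n x = birkhoff f n x + birkhoff g n x"
  by (simp add: birkhoff_def sum.distrib)

lemma birkhoff_minus: "birkhoff (\<lambda>x. - f x) n x = - birkhoff f n x"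
  by (simp add: birkhoff_def sum_negf)

lemma birkhoff_scale: "birkhoff (\<lambda>x. c * f x) n x = c * birkhoff f n x"
  by (simp add: birkhoff_def sum_distrib_left)

lemma birkhoff_const: "birkhoff (\<lambda>x. c) n x = real n * c"
  by (simp add: birkhoff_def)

text \<open>A uniform specification property: one gap length \<open>G\<close> serves all
  \<open>n\<close> and all pairs of points. For a primitive matrix, \<open>G\<close> is one less
  than the exponent that makes its power positive.\<close>

locale specification_subshift =
  fixes K :: nat and A :: "nat \<Rightarrow> nat \<Rightarrow> nat" and G :: nat
  assumes gluing: "z \<in> SigmaA K A \<Longrightarrow> y \<in> SigmaA K A \<Longrightarrow>
    \<exists>v\<in>SigmaA K A. agree n v z \<and> (shift ^^ (n + G)) v = y"
begin

abbreviation X where "X \<equiv> SigmaA K A"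

text \<open>Cylinders are named by a point instead of a word. A cylinder through a point of
  \<open>X\<close> is then never empty, and Birkhoff sums can be evaluated at the point that names
  it.\<close>

definition Cy :: "nat \<Rightarrow> (nat \<Rightarrow> nat) \<Rightarrow> (nat \<Rightarrow> nat) set" where
  "Cy n x = {y \<in> X. agree n y x}"

definition cyls :: "nat \<Rightarrow> (nat \<Rightarrow> nat) set set" where
  "cyls n = Cy n ` X"

definition rep :: "(nat \<Rightarrow> nat) set \<Rightarrow> (nat \<Rightarrow> nat)" where
  "rep U = (SOME x. x \<in> U)"

text \<open>Measurability with respect to the finite partition into \<open>n\<close>-cylinders.
  Boolean values describe events, real values describe simple functions; quasi-independence is
  stated for both.\<close>

definition det :: "nat \<Rightarrow> ((nat \<Rightarrow> nat) \<Rightarrow> 'b) \<Rightarrow> bool" where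
  "det n p \<longleftrightarrow> (\<forall>x\<in>X. \<forall>y\<in>X. agree n x y \<longrightarrow> p x = p y)"

lemma shift_pow_in: "x \<in> X \<Longrightarrow> (shift ^^ n) x \<in> X"
  by (auto simp: SigmaA_def shift_pow_apply)

lemma shift_in: "x \<in> X \<Longrightarrow> shift x \<in> X"
  using shift_pow_in[of x 1] by simp

lemma Cy_eq_cyl: "Cy n x = cyl K A (map x [0..<n])"
  by (auto simp: Cy_def cyl_def agree_def)

lemma Cy_self: "x \<in> X \<Longrightarrow> x \<in> Cy n x"
  by (simp add: Cy_def)

lemma Cy_subset: "Cy n x \<subseteq> X"
  by (auto simp: Cy_def)

lemma Cy_cong: "agree n x y \<Longrightarrow> Cy n x = Cy n y"
  by (auto simp: Cy_def agree_def)

lemma finite_cyls: "finite (cyls n)"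
proof -
  have "cyls n \<subseteq> cyl K A ` {w. set w \<subseteq> {1..K} \<and> length w = n}"
  proof
    fix U assume "U \<in> cyls n"
    then obtain x where "x \<in> X" "U = cyl K A (map x [0..<n])"
      by (auto simp: cyls_def Cy_eq_cyl)
    moreover have "set (map x [0..<n]) \<subseteq> {1..K}" using \<open>x \<in> X\<close> by (auto simp: SigmaA_def)
    ultimately show "U \<in> cyl K A ` {w. set w \<subseteq> {1..K} \<and> length w = n}"
      by (intro image_eqI[of _ _ "map x [0..<n]"]) auto
  qed
  then show ?thesis
    by (rule finite_subset) (intro finite_imageI finite_lists_length_eq, simp)
qed

lemma rep_in: "U \<in> cyls n \<Longrightarrow> rep U \<in> U"
  unfolding rep_def cyls_def by (metis Cy_self imageE someI)

lemma rep_in_X: "U \<in> cyls n \<Longrightarrow> rep U \<in> X"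
  using rep_in Cy_subset by (fastforce simp: cyls_def)

lemma cyls_eq: "U \<in> cyls n \<Longrightarrow> x \<in> U \<Longrightarrow> U = Cy n x"
  by (auto simp: cyls_def Cy_def agree_def)

lemma cyls_rep: "U \<in> cyls n \<Longrightarrow> U = Cy n (rep U)"
  using cyls_eq rep_in by blast

lemma sum_cyls:
  assumes "x \<in> X"
  shows "(\<Sum>U\<in>cyls n. indicator U x * g U) = (g (Cy n x) :: real)"
proof -
  have "(\<Sum>U\<in>cyls n. indicator U x * g U) = (\<Sum>U\<in>{Cy n x}. indicator U x * g U)"
  proof (rule sum.mono_neutral_right[OF finite_cyls])
    show "{Cy n x} \<subseteq> cyls n" using assms by (simp add: cyls_def)
    show "\<forall>U\<in>cyls n - {Cy n x}. indicator U x * g U = 0"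
    proof
      fix U assume U: "U \<in> cyls n - {Cy n x}"
      then have "x \<notin> U" using cyls_eq[of U n x] by blast
      then show "indicator U x * g U = 0" by simp
    qed
  qed
  then show ?thesis using Cy_self[OF assms] by simp
qed

lemma detD: "det n p \<Longrightarrow> x \<in> X \<Longrightarrow> y \<in> X \<Longrightarrow> agree n x y \<Longrightarrow> p x = p y"
  unfolding det_def by blast

lemma det_mono: "det n p \<Longrightarrow> n \<le> m \<Longrightarrow> det m p"
  unfolding det_def by (meson agree_mono)

lemma det_shift: "det n p \<Longrightarrow> det (k + n) (\<lambda>x. p ((shift ^^ k) x))"
  unfolding det_def by (meson shift_pow_in agree_shift)

lemma det_comp2: "det n p \<Longrightarrow> det n q \<Longrightarrow> det n (\<lambda>x. h (p x) (q x))"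
  unfolding det_def by (intro ballI impI arg_cong2[where f = h]) blast+

lemma det_comp: "det n p \<Longrightarrow> det n (\<lambda>x. h (p x))"
  unfolding det_def by (intro ballI impI arg_cong[where f = h]) blast

lemma det_rep: "det n p \<Longrightarrow> x \<in> X \<Longrightarrow> p (rep (Cy n x)) = p x"
proof -
  assume a: "det n p" "x \<in> X"
  have "Cy n x \<in> cyls n" using a by (auto simp: cyls_def)
  then show ?thesis using rep_in[of "Cy n x" n] a by (intro detD[OF a(1)]) (auto simp: Cy_def)
qed

lemma det_Cy_fun: "det n (\<lambda>x. g (Cy n x))"
  unfolding det_def using Cy_cong by metis

lemma det_mem_Cy: "det n (\<lambda>x. x \<in> Cy n y)"
  by (auto simp: det_def Cy_def agree_def)

lemma det_indicator:
  assumes "det n P"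
  shows "det n (\<lambda>x. indicator {x \<in> X. P x} x :: real)"
  unfolding det_def
proof (intro ballI impI)
  fix x y assume "x \<in> X" "y \<in> X" "agree n x y"
  then show "indicator {x \<in> X. P x} x = (indicator {x \<in> X. P x} y :: real)"
    using detD[OF assms, of x y] by (simp add: indicator_def)
qed

lemma det_expand:
  assumes "det n p" "x \<in> X"
  shows "p x = (\<Sum>U\<in>cyls n. indicator U x * (p (rep U) :: real))"
  using sum_cyls[OF assms(2), where n = n and g = "\<lambda>U. p (rep U)"] det_rep[OF assms] by simp

end

text \<open>\<open>\<phi>\<close> stands for \<open>f - P(f)\<close>, so that the pressure vanishes
  from the Gibbs bounds. The variation bound is phrased by \<open>agree\<close>, which makes no
  exception for equal points.\<close>

locale gibbs_subshift = specification_subshift K A G + prob_space \<mu>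
  for K :: nat and A :: "nat \<Rightarrow> nat \<Rightarrow> nat" and G :: nat and \<mu> :: "(nat \<Rightarrow> nat) measure" +
  fixes \<phi> :: "(nat \<Rightarrow> nat) \<Rightarrow> real" and \<alpha> \<Phi> b C :: real
  assumes sets_\<mu>: "sets \<mu> = sets (shift_space K A)"
    and invariant: "shift_invariant \<mu>"
    and alpha: "0 < \<alpha>" "\<alpha> < 1"
    and phi_var: "x \<in> X \<Longrightarrow> y \<in> X \<Longrightarrow> agree n x y \<Longrightarrow> \<bar>\<phi> x - \<phi> y\<bar> \<le> b * \<alpha> ^ n"
    and phi_bound: "x \<in> X \<Longrightarrow> \<bar>\<phi> x\<bar> \<le> \<Phi>"
    and C_ge_1: "C \<ge> 1"
    and gibbs_lower: "x \<in> X \<Longrightarrow> exp (birkhoff \<phi> n x) / C \<le> measure \<mu> (Cy n x)"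
    and gibbs_upper: "x \<in> X \<Longrightarrow> measure \<mu> (Cy n x) \<le> C * exp (birkhoff \<phi> n x)"
begin

lemma space_\<mu>: "space \<mu> = X"
proof -
  have "space \<mu> = space (shift_space K A)" by (rule sets_eq_imp_space_eq[OF sets_\<mu>])
  also have "\<dots> = X" unfolding shift_space_def
    by (rule space_measure_of) (auto simp: cyl_def)
  finally show ?thesis .
qed

lemma X_nonempty: "X \<noteq> {}"
  using not_empty space_\<mu> by simp

lemma Cy_sets [measurable]: "Cy n x \<in> sets \<mu>"
proof -
  have "cyl K A w \<in> sets (shift_space K A)" for w
    unfolding shift_space_def by (subst sets_measure_of) (auto simp: cyl_def)
  then show ?thesis by (simp add: sets_\<mu> Cy_eq_cyl)
qed

lemma cyls_sets: "U \<in> cyls n \<Longrightarrow> U \<in> sets \<mu>"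
  by (auto simp: cyls_def)

lemma Phi_nonneg: "\<Phi> \<ge> 0"
  using X_nonempty phi_bound by fastforce

lemma b_nonneg: "b \<ge> 0"
  using X_nonempty phi_var[of _ _ 0] by fastforce

lemma C_pos: "C > 0"
  using C_ge_1 by simp

lemma measure_Cy_pos: "x \<in> X \<Longrightarrow> measure \<mu> (Cy n x) > 0"
  using gibbs_lower[of x n] C_pos by (meson divide_pos_pos exp_gt_zero less_le_trans)

lemma det_set_measurable:
  assumes "det n (\<lambda>x. x \<in> B)" "B \<subseteq> X"
  shows "B \<in> sets \<mu>"
proof -
  have "B = \<Union>{U \<in> cyls n. U \<subseteq> B}"
  proof
    show "B \<subseteq> \<Union>{U \<in> cyls n. U \<subseteq> B}"
    proof
      fix x assume "x \<in> B"
      then have "x \<in> X" using assms by auto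
      moreover have "Cy n x \<subseteq> B"
      proof
        fix y assume "y \<in> Cy n x"
        then have "y \<in> X" "agree n y x" by (auto simp: Cy_def)
        then show "y \<in> B" using detD[OF assms(1) _ \<open>x \<in> X\<close>] \<open>x \<in> B\<close> by blast
      qed
      ultimately show "x \<in> \<Union>{U \<in> cyls n. U \<subseteq> B}"
        using Cy_self by (auto simp: cyls_def)
    qed
  qed auto
  also have "\<dots> \<in> sets \<mu>"
    using finite_cyls by (intro sets.finite_Union) (auto intro: cyls_sets)
  finally show ?thesis .
qed

lemma det_Collect_measurable:
  "det n P \<Longrightarrow> {x \<in> X. P x} \<in> sets \<mu>"
  by (rule det_set_measurable[of n]) (unfold det_def, blast+)

lemma det_measurable:
  fixes p :: "_ \<Rightarrow> real"
  assumes "det n p"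
  shows "p \<in> borel_measurable \<mu>"
proof (rule measurableI)
  fix S :: "real set"
  have "p -` S \<inter> space \<mu> = {x \<in> X. p x \<in> S}" by (auto simp: space_\<mu>)
  then show "p -` S \<inter> space \<mu> \<in> sets \<mu>"
    using det_Collect_measurable[OF det_comp[OF assms, of "\<lambda>r. r \<in> S"]] by simp
qed simp

lemma det_bounded:
  fixes p :: "_ \<Rightarrow> real"
  assumes "det n p"
  obtains R where "\<And>x. x \<in> X \<Longrightarrow> \<bar>p x\<bar> \<le> R"
proof
  fix x assume "x \<in> X"
  then have "\<bar>p x\<bar> = \<bar>p (rep (Cy n x))\<bar>" using det_rep[OF assms] by simp
  also have "\<dots> \<le> Max ((\<lambda>U. \<bar>p (rep U)\<bar>) ` cyls n)"
    using \<open>x \<in> X\<close> finite_cyls by (intro Max_ge) (auto simp: cyls_def)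
  finally show "\<bar>p x\<bar> \<le> Max ((\<lambda>U. \<bar>p (rep U)\<bar>) ` cyls n)" .
qed

lemma integrable_bounded:
  fixes p :: "_ \<Rightarrow> real"
  assumes "p \<in> borel_measurable \<mu>" "\<And>x. x \<in> X \<Longrightarrow> \<bar>p x\<bar> \<le> R"
  shows "integrable \<mu> p"
  using assms by (intro integrable_const_bound[of _ R]) (auto simp: space_\<mu>)

lemma det_integrable:
  fixes p :: "_ \<Rightarrow> real"
  assumes "det n p"
  shows "integrable \<mu> p"
  using det_bounded[OF assms] det_measurable[OF assms] integrable_bounded by metis

lemma integral_mono_X:
  fixes p q :: "_ \<Rightarrow> real"
  assumes "integrable \<mu> p" "integrable \<mu> q" "\<And>x. x \<in> X \<Longrightarrow> p x \<le> q x"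
  shows "(\<integral>x. p x \<partial>\<mu>) \<le> (\<integral>x. q x \<partial>\<mu>)"
  using assms by (intro integral_mono) (auto simp: space_\<mu>)

lemma integral_cong_X:
  fixes p q :: "_ \<Rightarrow> real"
  assumes "\<And>x. x \<in> X \<Longrightarrow> p x = q x"
  shows "(\<integral>x. p x \<partial>\<mu>) = (\<integral>x. q x \<partial>\<mu>)"
  using assms by (intro Bochner_Integration.integral_cong) (auto simp: space_\<mu>)

lemma integral_det:
  assumes "det n p"
  shows "(\<integral>x. p x \<partial>\<mu>) = (\<Sum>U\<in>cyls n. measure \<mu> U * p (rep U))"
proof -
  have "(\<integral>x. p x \<partial>\<mu>) = (\<integral>x. (\<Sum>U\<in>cyls n. indicator U x * p (rep U)) \<partial>\<mu>)"
    using det_expand[OF assms] by (rule integral_cong_X)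
  also have "\<dots> = (\<Sum>U\<in>cyls n. (\<integral>x. indicator U x * p (rep U) \<partial>\<mu>))"
    by (intro Bochner_Integration.integral_sum integrable_mult_left)
       (auto simp: cyls_sets emeasure_eq_measure)
  also have "\<dots> = (\<Sum>U\<in>cyls n. measure \<mu> U * p (rep U))"
    using sets.sets_into_space by (intro sum.cong) (auto simp: cyls_sets Int_absorb1 Int_absorb2)
  finally show ?thesis .
qed

lemma shift_measurable [measurable]: "shift \<in> \<mu> \<rightarrow>\<^sub>M \<mu>"
  using invariant shift_in by (intro measurableI) (auto simp: shift_invariant_def space_\<mu>)

lemma shift_pow_measurable [measurable]: "(shift ^^ n) \<in> \<mu> \<rightarrow>\<^sub>M \<mu>"
proof (induction n)
  case (Suc n)
  show ?case using measurable_comp[OF Suc shift_measurable] by (simp add: comp_def)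
qed (simp add: id_def)

lemma distr_shift: "distr \<mu> \<mu> shift = \<mu>"
proof (rule measure_eqI)
  fix B assume "B \<in> sets (distr \<mu> \<mu> shift)"
  then have B: "B \<in> sets \<mu>" by simp
  then show "emeasure (distr \<mu> \<mu> shift) B = emeasure \<mu> B"
    using invariant by (simp add: emeasure_distr emeasure_eq_measure shift_invariant_def)
qed simp

lemma integral_shift:
  fixes p :: "_ \<Rightarrow> real"
  assumes "p \<in> borel_measurable \<mu>"
  shows "(\<integral>x. p ((shift ^^ n) x) \<partial>\<mu>) = (\<integral>x. p x \<partial>\<mu>)"
proof (induction n)
  case (Suc n)
  have "(\<integral>x. p ((shift ^^ Suc n) x) \<partial>\<mu>) = (\<integral>x. p ((shift ^^ n) (shift x)) \<partial>\<mu>)"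
    by (simp add: funpow_swap1)
  also have "\<dots> = (\<integral>x. p ((shift ^^ n) x) \<partial>distr \<mu> \<mu> shift)"
    using assms by (subst integral_distr) (auto intro!: measurable_compose[OF shift_pow_measurable])
  finally show ?case using Suc by (simp add: distr_shift)
qed simp

lemma Cy_inter_shift:
  "z \<in> Cy n x \<Longrightarrow> (shift ^^ n) z \<in> Cy m y \<Longrightarrow>
    {v \<in> Cy n x. (shift ^^ n) v \<in> Cy m y} = Cy (n + m) z"
  by (auto simp: Cy_def agree_add_iff shift_pow_in) (auto simp: agree_def)

text \<open>A nonempty intersection is itself the cylinder of length \<open>n + m\<close> of any of
  its points \<open>z\<close>. Birkhoff sums add along \<open>z\<close>, so three uses of the Gibbs
  bound cost \<open>C^3\<close>.\<close>

lemma quasi_bernoulli_upper_Cy: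
  assumes "x \<in> X" "y \<in> X"
  shows "measure \<mu> {v \<in> Cy n x. (shift ^^ n) v \<in> Cy m y} \<le> C^3 * measure \<mu> (Cy n x) * measure \<mu> (Cy m y)"
proof (cases "{v \<in> Cy n x. (shift ^^ n) v \<in> Cy m y} = {}")
  case True
  then show ?thesis using C_pos by (simp only: measure_empty) (simp add: zero_le_mult_iff)
next
  case False
  then obtain z where z: "z \<in> Cy n x" "(shift ^^ n) z \<in> Cy m y" by auto
  have zX: "z \<in> X" "agree n z x" using z by (auto simp: Cy_def)
  have e1: "exp (birkhoff \<phi> n z) \<le> C * measure \<mu> (Cy n x)"
    using gibbs_lower[of z n] zX Cy_cong[of n z x] C_pos by (simp add: field_simps)
  have e2: "exp (birkhoff \<phi> m ((shift ^^ n) z)) \<le> C * measure \<mu> (Cy m y)"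
    using gibbs_lower[of "(shift ^^ n) z" m] zX shift_pow_in Cy_cong[of m "(shift ^^ n) z" y] z C_pos
    by (simp add: field_simps Cy_def)
  have "measure \<mu> (Cy (n + m) z) \<le> C * exp (birkhoff \<phi> (n + m) z)"
    by (rule gibbs_upper[OF zX(1)])
  also have "\<dots> = C * (exp (birkhoff \<phi> n z) * exp (birkhoff \<phi> m ((shift ^^ n) z)))"
    by (simp add: birkhoff_add exp_add)
  also have "\<dots> \<le> C * ((C * measure \<mu> (Cy n x)) * (C * measure \<mu> (Cy m y)))"
    using C_pos by (intro mult_left_mono mult_mono e1 e2) auto
  finally show ?thesis using Cy_inter_shift[OF z] by (simp add: power3_eq_cube mult_ac)
qed

text \<open>\<open>C ^ 3\<close> again comes from three uses of the Gibbs bound;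
  \<open>exp (- real G * \<Phi>)\<close> bounds from below the weight of the \<open>G\<close>
  symbols that join two words.\<close>

definition gap :: real where "gap = exp (- real G * \<Phi>) / C ^ 3"

lemma gap_pos: "gap > 0"
  using C_pos by (simp add: gap_def)

lemma gap_le_1: "gap \<le> 1"
proof -
  have "exp (- real G * \<Phi>) \<le> 1" using Phi_nonneg by simp
  moreover have "C ^ 3 \<ge> 1" using C_ge_1 by simp
  ultimately have "exp (- real G * \<Phi>) \<le> C ^ 3" by linarith
  then show ?thesis using C_pos by (simp add: gap_def)
qed

lemma birkhoff_phi_ge: "x \<in> X \<Longrightarrow> birkhoff \<phi> n x \<ge> - real n * \<Phi>"
proof -
  assume x: "x \<in> X"
  have "(\<Sum>k<n. - \<Phi>) \<le> birkhoff \<phi> n x"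
    unfolding birkhoff_def
  proof (rule sum_mono)
    fix k show "- \<Phi> \<le> \<phi> ((shift ^^ k) x)"
      using phi_bound[OF shift_pow_in[OF x, of k]] by linarith
  qed
  then show ?thesis by simp
qed

text \<open>It suffices to keep a single cylinder of the intersection, that of a point glued from
  the two words; its weight is the product of their weights times that of the connecting
  block.\<close>

lemma quasi_bernoulli_lower_Cy:
  assumes "x \<in> X" "y \<in> X"
  shows "gap * measure \<mu> (Cy n x) * measure \<mu> (Cy m y) \<le> measure \<mu> {v \<in> Cy n x. (shift ^^ (n + G)) v \<in> Cy m y}"
proof -
  obtain z where z: "z \<in> X" "agree n z x" "(shift ^^ (n + G)) z = y"
    using gluing[OF assms] by blast
  have e1: "measure \<mu> (Cy n x) \<le> C * exp (birkhoff \<phi> n z)"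
    using gibbs_upper[of z n] z Cy_cong by simp
  have e2: "measure \<mu> (Cy m y) \<le> C * exp (birkhoff \<phi> m y)"
    by (rule gibbs_upper[OF assms(2)])
  have e3: "exp (- real G * \<Phi>) \<le> exp (birkhoff \<phi> G ((shift ^^ n) z))"
    using birkhoff_phi_ge[OF shift_pow_in[OF z(1)]] by simp
  have "gap * measure \<mu> (Cy n x) * measure \<mu> (Cy m y)
      \<le> gap * (C * exp (birkhoff \<phi> n z)) * (C * exp (birkhoff \<phi> m y))"
    using gap_pos C_pos by (intro mult_mono e1 e2) auto
  also have "\<dots> = exp (- real G * \<Phi>) * (exp (birkhoff \<phi> n z) * exp (birkhoff \<phi> m y)) / C"
    using C_pos by (simp add: gap_def power3_eq_cube)
  also have "\<dots> \<le> exp (birkhoff \<phi> G ((shift ^^ n) z)) * (exp (birkhoff \<phi> n z) * exp (birkhoff \<phi> m y)) / C"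
    using C_pos by (intro divide_right_mono mult_right_mono e3) auto
  also have "\<dots> = exp (birkhoff \<phi> (n + G + m) z) / C"
    unfolding birkhoff_add z(3) by (simp add: exp_add mult_ac)
  also have "\<dots> \<le> measure \<mu> (Cy (n + G + m) z)" by (rule gibbs_lower[OF z(1)])
  also have "\<dots> \<le> measure \<mu> {v \<in> Cy n x. (shift ^^ (n + G)) v \<in> Cy m y}"
  proof (rule finite_measure_mono)
    show "Cy (n + G + m) z \<subseteq> {v \<in> Cy n x. (shift ^^ (n + G)) v \<in> Cy m y}"
    proof
      fix v assume v: "v \<in> Cy (n + G + m) z"
      then have "v \<in> X" "agree n v z" "agree m ((shift ^^ (n + G)) v) ((shift ^^ (n + G)) z)"
        by (auto simp: Cy_def agree_add_iff)
      then show "v \<in> {v \<in> Cy n x. (shift ^^ (n + G)) v \<in> Cy m y}"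
        using z shift_pow_in[of v] by (auto simp: Cy_def agree_def)
    qed
    have "det (n + G + m) (\<lambda>v. v \<in> Cy n x \<and> (shift ^^ (n + G)) v \<in> Cy m y)"
      using det_comp2[OF det_mono[OF det_mem_Cy[of n x], of "n + G + m"]
          det_shift[OF det_mem_Cy[of m y], of "n + G"], of "(\<and>)"] by simp
    moreover have "{v \<in> Cy n x. (shift ^^ (n + G)) v \<in> Cy m y} = {v \<in> X. v \<in> Cy n x \<and> (shift ^^ (n + G)) v \<in> Cy m y}"
      using Cy_subset by blast
    ultimately show "{v \<in> Cy n x. (shift ^^ (n + G)) v \<in> Cy m y} \<in> sets \<mu>"
      using det_Collect_measurable by simp
  qed
  finally show ?thesis .
qed

lemma integral_det_prod:
  assumes p: "det n p" and q: "det m q"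
  shows "(\<integral>x. p x * q ((shift ^^ k) x) \<partial>\<mu>) =
    (\<Sum>U\<in>cyls n. \<Sum>V\<in>cyls m. p (rep U) * q (rep V) * measure \<mu> {v \<in> U. (shift ^^ k) v \<in> V})"
proof -
  have ms: "{v \<in> U. (shift ^^ k) v \<in> V} \<in> sets \<mu>" if UV: "U \<in> cyls n" "V \<in> cyls m" for U V
  proof -
    have "{v \<in> U. (shift ^^ k) v \<in> V} = U \<inter> ((shift ^^ k) -` V \<inter> space \<mu>)"
      using sets.sets_into_space[OF cyls_sets[OF UV(1)]] by auto
    then show ?thesis
      using cyls_sets[OF UV(1)] measurable_sets[OF shift_pow_measurable cyls_sets[OF UV(2)], of k] by auto
  qed
  have "(\<integral>x. p x * q ((shift ^^ k) x) \<partial>\<mu>) =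
    (\<integral>x. (\<Sum>U\<in>cyls n. \<Sum>V\<in>cyls m. p (rep U) * q (rep V) * indicator {v \<in> U. (shift ^^ k) v \<in> V} x) \<partial>\<mu>)"
  proof (rule integral_cong_X)
    fix x assume x: "x \<in> X"
    have "p x * q ((shift ^^ k) x) = (\<Sum>U\<in>cyls n. indicator U x * p (rep U)) *
        (\<Sum>V\<in>cyls m. indicator V ((shift ^^ k) x) * q (rep V))"
      using det_expand[OF p x] det_expand[OF q shift_pow_in[OF x]] by simp
    also have "\<dots> = (\<Sum>U\<in>cyls n. \<Sum>V\<in>cyls m. p (rep U) * q (rep V) * indicator {v \<in> U. (shift ^^ k) v \<in> V} x)"
      unfolding sum_product by (intro sum.cong refl) (auto simp: indicator_def)
    finally show "p x * q ((shift ^^ k) x) = \<dots>" .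
  qed
  also have "\<dots> = (\<Sum>U\<in>cyls n. (\<integral>x. (\<Sum>V\<in>cyls m. p (rep U) * q (rep V) * indicator {v \<in> U. (shift ^^ k) v \<in> V} x) \<partial>\<mu>))"
    by (intro Bochner_Integration.integral_sum Bochner_Integration.integrable_sum integrable_mult_right)
       (auto simp: ms emeasure_eq_measure)
  also have "\<dots> = (\<Sum>U\<in>cyls n. \<Sum>V\<in>cyls m. (\<integral>x. p (rep U) * q (rep V) * indicator {v \<in> U. (shift ^^ k) v \<in> V} x \<partial>\<mu>))"
    by (intro sum.cong refl Bochner_Integration.integral_sum integrable_mult_right)
       (auto simp: ms emeasure_eq_measure)
  also have "\<dots> = (\<Sum>U\<in>cyls n. \<Sum>V\<in>cyls m. p (rep U) * q (rep V) * measure \<mu> {v \<in> U. (shift ^^ k) v \<in> V})"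
  proof (intro sum.cong refl)
    fix U V assume UV: "U \<in> cyls n" "V \<in> cyls m"
    then show "(\<integral>x. p (rep U) * q (rep V) * indicator {v \<in> U. (shift ^^ k) v \<in> V} x \<partial>\<mu>)
       = p (rep U) * q (rep V) * measure \<mu> {v \<in> U. (shift ^^ k) v \<in> V}"
      using ms[OF UV] sets.sets_into_space[OF ms[OF UV]] by (simp add: Int_absorb2)
  qed
  finally show ?thesis .
qed

lemma quasi_bernoulli_upper:
  fixes p q :: "_ \<Rightarrow> real"
  assumes p: "det n p" "\<And>x. x \<in> X \<Longrightarrow> p x \<ge> 0" and q: "det m q" "\<And>x. x \<in> X \<Longrightarrow> q x \<ge> 0"
  shows "(\<integral>x. p x * q ((shift ^^ n) x) \<partial>\<mu>) \<le> C^3 * (\<integral>x. p x \<partial>\<mu>) * (\<integral>x. q x \<partial>\<mu>)"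
proof -
  have "(\<integral>x. p x * q ((shift ^^ n) x) \<partial>\<mu>)
      \<le> (\<Sum>U\<in>cyls n. \<Sum>V\<in>cyls m. p (rep U) * q (rep V) * (C^3 * measure \<mu> U * measure \<mu> V))"
    unfolding integral_det_prod[OF p(1) q(1)]
  proof (intro sum_mono mult_left_mono)
    fix U V assume UV: "U \<in> cyls n" "V \<in> cyls m"
    then show "measure \<mu> {v \<in> U. (shift ^^ n) v \<in> V} \<le> C^3 * measure \<mu> U * measure \<mu> V"
      using quasi_bernoulli_upper_Cy by (auto simp: cyls_def)
    show "0 \<le> p (rep U) * q (rep V)"
      using UV rep_in_X p(2) q(2) by auto
  qed
  also have "\<dots> = C^3 * (\<Sum>U\<in>cyls n. measure \<mu> U * p (rep U)) * (\<Sum>V\<in>cyls m. measure \<mu> V * q (rep V))"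
    by (simp add: sum_distrib_left sum_distrib_right mult_ac)
  finally show ?thesis by (simp add: integral_det[OF p(1)] integral_det[OF q(1)])
qed

lemma quasi_bernoulli_lower:
  fixes p q :: "_ \<Rightarrow> real"
  assumes p: "det n p" "\<And>x. x \<in> X \<Longrightarrow> p x \<ge> 0" and q: "det m q" "\<And>x. x \<in> X \<Longrightarrow> q x \<ge> 0"
  shows "gap * (\<integral>x. p x \<partial>\<mu>) * (\<integral>x. q x \<partial>\<mu>) \<le> (\<integral>x. p x * q ((shift ^^ (n + G)) x) \<partial>\<mu>)"
proof -
  have "gap * (\<integral>x. p x \<partial>\<mu>) * (\<integral>x. q x \<partial>\<mu>) =
     gap * (\<Sum>U\<in>cyls n. measure \<mu> U * p (rep U)) * (\<Sum>V\<in>cyls m. measure \<mu> V * q (rep V))"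
    by (simp add: integral_det[OF p(1)] integral_det[OF q(1)])
  also have "\<dots> = (\<Sum>U\<in>cyls n. \<Sum>V\<in>cyls m. p (rep U) * q (rep V) * (gap * measure \<mu> U * measure \<mu> V))"
    by (simp add: sum_distrib_left sum_distrib_right mult_ac)
  also have "\<dots> \<le> (\<integral>x. p x * q ((shift ^^ (n + G)) x) \<partial>\<mu>)"
    unfolding integral_det_prod[OF p(1) q(1)]
  proof (intro sum_mono mult_left_mono)
    fix U V assume UV: "U \<in> cyls n" "V \<in> cyls m"
    then show "gap * measure \<mu> U * measure \<mu> V \<le> measure \<mu> {v \<in> U. (shift ^^ (n + G)) v \<in> V}"
      using quasi_bernoulli_lower_Cy by (auto simp: cyls_def)
    show "0 \<le> p (rep U) * q (rep V)"
      using UV rep_in_X p(2) q(2) by auto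
  qed
  finally show ?thesis .
qed

lemma integral_indicator_X: "B \<in> sets \<mu> \<Longrightarrow> (\<integral>x. indicator B x \<partial>\<mu>) = measure \<mu> B"
  using sets.sets_into_space[of B \<mu>] by (simp add: Int_absorb2)

lemma prob_quasi_upper:
  assumes p: "det n P" and q: "det m Q"
  shows "measure \<mu> {x \<in> X. P x \<and> Q ((shift ^^ n) x)} \<le> C^3 * measure \<mu> {x \<in> X. P x} * measure \<mu> {x \<in> X. Q x}"
proof -
  let ?p = "\<lambda>x. indicator {x \<in> X. P x} x :: real"
  let ?q = "\<lambda>x. indicator {x \<in> X. Q x} x :: real"
  have d: "det n ?p" "det m ?q"
    using p q by (auto intro: det_indicator)
  have PQ: "{x \<in> X. P x \<and> Q ((shift ^^ n) x)} \<in> sets \<mu>"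
    using det_comp2[OF det_mono[OF p, of "n + m"] det_shift[OF q, of n], of "(\<and>)"]
    by (intro det_Collect_measurable[of "n + m"]) simp
  have "measure \<mu> {x \<in> X. P x \<and> Q ((shift ^^ n) x)} = (\<integral>x. ?p x * ?q ((shift ^^ n) x) \<partial>\<mu>)"
    unfolding integral_indicator_X[OF PQ, symmetric]
    by (rule integral_cong_X) (auto simp: indicator_def shift_pow_in)
  also have "\<dots> \<le> C^3 * (\<integral>x. ?p x \<partial>\<mu>) * (\<integral>x. ?q x \<partial>\<mu>)"
    by (rule quasi_bernoulli_upper[OF d(1) _ d(2)]) auto
  finally show ?thesis
    by (simp only: integral_indicator_X[OF det_Collect_measurable[OF p]]
        integral_indicator_X[OF det_Collect_measurable[OF q]])
qed

lemma prob_quasi_lower: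
  assumes p: "det n P" and q: "det m Q"
  shows "gap * measure \<mu> {x \<in> X. P x} * measure \<mu> {x \<in> X. Q x}
    \<le> measure \<mu> {x \<in> X. P x \<and> Q ((shift ^^ (n + G)) x)}"
proof -
  let ?p = "\<lambda>x. indicator {x \<in> X. P x} x :: real"
  let ?q = "\<lambda>x. indicator {x \<in> X. Q x} x :: real"
  have d: "det n ?p" "det m ?q"
    using p q by (auto intro: det_indicator)
  have PQ: "{x \<in> X. P x \<and> Q ((shift ^^ (n + G)) x)} \<in> sets \<mu>"
    using det_comp2[OF det_mono[OF p, of "n + G + m"] det_shift[OF q, of "n + G"], of "(\<and>)"]
    by (intro det_Collect_measurable[of "n + G + m"]) simp
  have "gap * (\<integral>x. ?p x \<partial>\<mu>) * (\<integral>x. ?q x \<partial>\<mu>) \<le> (\<integral>x. ?p x * ?q ((shift ^^ (n + G)) x) \<partial>\<mu>)"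
    by (rule quasi_bernoulli_lower[OF d(1) _ d(2)]) auto
  also have "\<dots> = measure \<mu> {x \<in> X. P x \<and> Q ((shift ^^ (n + G)) x)}"
    unfolding integral_indicator_X[OF PQ, symmetric]
    by (rule integral_cong_X) (auto simp: indicator_def shift_pow_in)
  finally show ?thesis
    by (simp only: integral_indicator_X[OF det_Collect_measurable[OF p]]
        integral_indicator_X[OF det_Collect_measurable[OF q]])
qed

text \<open>Replaces independence wherever an event must happen at one of many times. The failure so
  far depends only on the coordinates before \<open>p J - G\<close>, so lower quasi-independence
  bounds from below its intersection with a success at \<open>p J\<close>; subtracting this
  intersection produces the next factor.\<close>

lemma prob_avoid:
  assumes U: "det n0 U" and V: "\<And>j. det (l j) (V j)"
    and p0: "n0 + G \<le> p 0" and p: "\<And>j. p j + l j + G \<le> p (Suc j)"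
  shows "measure \<mu> {x \<in> X. U x \<and> (\<forall>j<J. \<not> V j ((shift ^^ p j) x))}
    \<le> measure \<mu> {x \<in> X. U x} * (\<Prod>j<J. 1 - gap * measure \<mu> {x \<in> X. V j x})"
proof -
  define N where "N J x \<longleftrightarrow> U x \<and> (\<forall>j<J. \<not> V j ((shift ^^ p j) x))" for J x
  have inc: "p j + l j + G \<le> p J" if "j < J" for j J
    using that
  proof (induction J)
    case (Suc J)
    then show ?case using p[of J] by (cases "j = J") auto
  qed simp
  have n0: "n0 + G \<le> p J" for J using p0 inc[of 0 J] by (cases J) auto
  have detN: "det (p J - G) (N J)" for J
    unfolding det_def
  proof (intro ballI impI)
    fix x y assume xy: "x \<in> X" "y \<in> X" "agree (p J - G) x y"
    have "U x = U y" using n0[of J] xy by (intro detD[OF U]) (auto simp: agree_def)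
    moreover have "V j ((shift ^^ p j) x) = V j ((shift ^^ p j) y)" if "j < J" for j
      using inc[OF that] xy
      by (intro detD[OF V] agree_shift shift_pow_in) (auto simp: agree_def)
    ultimately show "N J x = N J y" by (auto simp: N_def)
  qed
  have "measure \<mu> {x \<in> X. N J x} \<le> measure \<mu> {x \<in> X. U x} * (\<Prod>j<J. 1 - gap * measure \<mu> {x \<in> X. V j x})"
  proof (induction J)
    case 0
    then show ?case by (simp add: N_def)
  next
    case (Suc J)
    let ?B = "{x \<in> X. N J x \<and> V J ((shift ^^ p J) x)}"
    have pJ: "p J - G + G = p J" using n0[of J] by simp
    have eq: "{x \<in> X. N (Suc J) x} = {x \<in> X. N J x} - ?B"
      by (auto simp: N_def less_Suc_eq)
    have meas: "?B \<in> sets \<mu>"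
      using det_comp2[OF det_mono[OF detN, of J "p J + l J"] det_shift[OF V, of "p J" J], of "(\<and>)"]
      by (intro det_Collect_measurable[of "p J + l J"]) simp
    have "measure \<mu> {x \<in> X. N (Suc J) x} = measure \<mu> {x \<in> X. N J x} - measure \<mu> ?B"
      unfolding eq using meas det_Collect_measurable[OF detN] by (intro finite_measure_Diff) auto
    also have "\<dots> \<le> measure \<mu> {x \<in> X. N J x} - gap * measure \<mu> {x \<in> X. N J x} * measure \<mu> {x \<in> X. V J x}"
      using prob_quasi_lower[OF detN[of J] V[of J]] by (simp add: pJ)
    also have "\<dots> = measure \<mu> {x \<in> X. N J x} * (1 - gap * measure \<mu> {x \<in> X. V J x})"
      by (simp add: algebra_simps)
    also have "\<dots> \<le> (measure \<mu> {x \<in> X. U x} * (\<Prod>j<J. 1 - gap * measure \<mu> {x \<in> X. V j x})) * (1 - gap * measure \<mu> {x \<in> X. V J x})"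
      using Suc gap_le_1 gap_pos prob_le_1[of "{x \<in> X. V J x}"]
      by (intro mult_right_mono) (auto intro!: mult_le_one)
    finally show ?case by (simp add: mult_ac)
  qed
  then show ?thesis by (simp add: N_def)
qed

end

section \<open>Transfer operators\<close>

text \<open>The inverse branch of \<open>shift ^^ n\<close> along the first \<open>n\<close> symbols
  of \<open>z\<close>, applied to \<open>y\<close>.\<close>

definition splice :: "nat \<Rightarrow> (nat \<Rightarrow> nat) \<Rightarrow> (nat \<Rightarrow> nat) \<Rightarrow> (nat \<Rightarrow> nat)" where
  "splice n z y = (\<lambda>k. if k < n then z k else y (k - n))"

lemma shift_splice: "(shift ^^ n) (splice n z y) = y"
  by (auto simp: fun_eq_iff shift_pow_apply splice_def)

lemma agree_splice: "agree n (splice n z y) z"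
  by (auto simp: agree_def splice_def)

lemma splice_shift: "splice n z ((shift ^^ n) z) = z"
  by (auto simp: fun_eq_iff shift_pow_apply splice_def)

lemma splice_splice: "splice n (splice n z y) x = splice n z x"
  by (auto simp: fun_eq_iff splice_def)

lemma exp_minus_one_le: "exp u - 1 \<le> u * exp (u :: real)"
proof -
  have "1 - u \<le> exp (- u)" using exp_ge_add_one_self[of "- u"] by simp
  then have "(1 - u) * exp u \<le> exp (- u) * exp u" by (intro mult_right_mono) auto
  then show ?thesis by (simp add: algebra_simps flip: exp_add)
qed

section \<open>Preimages, splicing and iterates of the transfer operator\<close>

context specification_subshift
begin

definition pre :: "nat \<Rightarrow> (nat \<Rightarrow> nat) \<Rightarrow> (nat \<Rightarrow> nat) set" where
  "pre n x = {z \<in> X. (shift ^^ n) z = x}"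

text \<open>The Ruelle operator of \<open>\<psi>\<close>. The sum is finite by
  \<open>finite_pre\<close>, and by \<open>tr_pow\<close> the iterates carry the exponentials of
  Birkhoff sums as weights.\<close>

definition tr :: "((nat \<Rightarrow> nat) \<Rightarrow> real) \<Rightarrow> ((nat \<Rightarrow> nat) \<Rightarrow> real) \<Rightarrow> (nat \<Rightarrow> nat) \<Rightarrow> real" where
  "tr \<psi> g x = (\<Sum>z\<in>pre 1 x. exp (\<psi> z) * g z)"

lemma pre_in: "z \<in> pre n x \<Longrightarrow> z \<in> X"
  by (simp add: pre_def)

lemma pre_shift: "z \<in> pre n x \<Longrightarrow> (shift ^^ n) z = x"
  by (simp add: pre_def)

lemma inj_Cy_pre: "inj_on (Cy n) (pre n x)"
proof (rule inj_onI)
  fix z w assume zw: "z \<in> pre n x" "w \<in> pre n x" "Cy n z = Cy n w"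
  then have "z \<in> Cy n w" using Cy_self[of z n] pre_in by blast
  then have "splice n z x = splice n w x"
    by (auto simp: Cy_def agree_def splice_def fun_eq_iff)
  then show "z = w" using zw splice_shift pre_shift by metis
qed

lemma finite_pre: "finite (pre n x)"
proof (rule inj_on_finite[OF inj_Cy_pre _ finite_cyls])
  show "Cy n ` pre n x \<subseteq> cyls n" by (auto simp: cyls_def dest: pre_in)
qed

lemma pre_Suc: "x \<in> X \<Longrightarrow> pre (Suc n) x = (\<Union>y\<in>pre 1 x. pre n y)"
  by (auto simp: pre_def shift_pow_in)

lemma tr_pow:
  "x \<in> X \<Longrightarrow> (tr \<psi> ^^ n) g x = (\<Sum>z\<in>pre n x. exp (birkhoff \<psi> n z) * g z)"
proof (induction n arbitrary: x)
  case 0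
  then have "pre 0 x = {x}" by (auto simp: pre_def)
  then show ?case by simp
next
  case (Suc n)
  have "(tr \<psi> ^^ Suc n) g x = (\<Sum>y\<in>pre 1 x. exp (\<psi> y) * (\<Sum>z\<in>pre n y. exp (birkhoff \<psi> n z) * g z))"
    unfolding funpow.simps comp_apply tr_def[of \<psi> "(tr \<psi> ^^ n) g"] using Suc.IH pre_in
    by (intro sum.cong) auto
  also have "\<dots> = (\<Sum>y\<in>pre 1 x. \<Sum>z\<in>pre n y. exp (birkhoff \<psi> (Suc n) z) * g z)"
  proof (intro sum.cong refl)
    fix y assume "y \<in> pre 1 x"
    have "exp (\<psi> y) * (exp (birkhoff \<psi> n z) * g z) = exp (birkhoff \<psi> (Suc n) z) * g z" if "z \<in> pre n y" for z
      using birkhoff_add[of \<psi> n 1 z] pre_shift[OF that] by (simp add: exp_add)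
    then show "exp (\<psi> y) * (\<Sum>z\<in>pre n y. exp (birkhoff \<psi> n z) * g z) = (\<Sum>z\<in>pre n y. exp (birkhoff \<psi> (Suc n) z) * g z)"
      unfolding sum_distrib_left by (intro sum.cong) auto
  qed
  also have "\<dots> = (\<Sum>z\<in>pre (Suc n) x. exp (birkhoff \<psi> (Suc n) z) * g z)"
    unfolding pre_Suc[OF Suc.prems]
    by (rule sum.UNION_disjoint[symmetric]) (auto simp: finite_pre, auto simp: pre_def)
  finally show ?case .
qed

text \<open>Admissibility links only neighbouring symbols, so a common first symbol allows
  \<open>x\<close> to be exchanged for \<open>y\<close> behind the same word. Through
  \<open>sum_pre_splice\<close> this pairs the preimages of the two points, which is how iterates at
  nearby points are compared.\<close>

lemma splice_in_pre:
  assumes "z \<in> pre n x" "y \<in> X" "agree 1 x y"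
  shows "splice n z y \<in> pre n y"
proof -
  have zX: "z \<in> X" and zx: "(shift ^^ n) z = x" using assms by (auto simp: pre_def)
  have zn: "z n = y 0"
  proof -
    have "z n = (shift ^^ n) z 0" by (simp add: shift_pow_apply)
    then show ?thesis using assms(3) zx by (simp add: agree_def)
  qed
  have "splice n z y \<in> X"
    unfolding SigmaA_def
  proof (intro CollectI conjI allI)
    fix l
    show "splice n z y l \<in> {1..K}" using zX assms(2) by (auto simp: splice_def SigmaA_def)
    consider "Suc l < n" | "Suc l = n" | "n \<le> l" by linarith
    then show "A (splice n z y l) (splice n z y (Suc l)) = 1"
    proof cases
      case 1 then show ?thesis using zX by (auto simp: splice_def SigmaA_def)
    next
      case 2
      then have "splice n z y l = z l" "splice n z y (Suc l) = z (Suc l)" using zn by (auto simp: splice_def)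
      then show ?thesis using zX by (auto simp: SigmaA_def)
    next
      case 3
      then have "splice n z y l = y (l - n)" "splice n z y (Suc l) = y (Suc (l - n))"
        by (auto simp: splice_def Suc_diff_le)
      then show ?thesis using assms(2) by (auto simp: SigmaA_def)
    qed
  qed
  then show ?thesis by (simp add: pre_def shift_splice)
qed

lemma agree_splice_pre:
  assumes "z \<in> pre n x" "agree N x y"
  shows "agree (n + N) (splice n z y) z"
  using assms agree_splice by (auto simp: agree_add_iff shift_splice pre_shift intro: agree_sym)

lemma sum_pre_splice:
  assumes "x \<in> X" "y \<in> X" "agree 1 x y"
  shows "(\<Sum>z\<in>pre n x. F z) = (\<Sum>z\<in>pre n y. F (splice n z x))"
proof (rule sum.reindex_bij_betw[symmetric], rule bij_betwI[where g = "\<lambda>z. splice n z y"])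
  show "(\<lambda>z. splice n z x) \<in> pre n y \<rightarrow> pre n x" "(\<lambda>z. splice n z y) \<in> pre n x \<rightarrow> pre n y"
    using splice_in_pre assms agree_sym by blast+
  show "splice n (splice n z x) y = z" if "z \<in> pre n y" for z
    using splice_shift[of n z] pre_shift[OF that] by (simp add: splice_splice)
  show "splice n (splice n z y) x = z" if "z \<in> pre n x" for z
    using splice_shift[of n z] pre_shift[OF that] by (simp add: splice_splice)
qed

lemma tr_mono:
  "(\<And>z. z \<in> X \<Longrightarrow> g z \<le> g' z) \<Longrightarrow> tr \<psi> g x \<le> tr \<psi> g' x"
  unfolding tr_def by (intro sum_mono mult_left_mono) (auto dest: pre_in)

lemma tr_cong:
  "(\<And>z. z \<in> X \<Longrightarrow> g z = g' z) \<Longrightarrow> tr \<psi> g x = tr \<psi> g' x"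
  unfolding tr_def by (intro sum.cong) (auto dest: pre_in)

lemma tr_pow_mono:
  "x \<in> X \<Longrightarrow> (\<And>z. z \<in> X \<Longrightarrow> g z \<le> g' z) \<Longrightarrow> (tr \<psi> ^^ n) g x \<le> (tr \<psi> ^^ n) g' x"
  unfolding tr_pow by (intro sum_mono mult_left_mono) (auto dest: pre_in)

lemma tr_pow_cong:
  "x \<in> X \<Longrightarrow> (\<And>z. z \<in> X \<Longrightarrow> g z = g' z) \<Longrightarrow> (tr \<psi> ^^ n) g x = (tr \<psi> ^^ n) g' x"
  unfolding tr_pow by (intro sum.cong) (auto dest: pre_in)

lemma tr_add: "tr \<psi> (\<lambda>z. g z + g' z) x = tr \<psi> g x + tr \<psi> g' x"
  by (simp add: tr_def sum.distrib algebra_simps)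

lemma tr_diff: "tr \<psi> (\<lambda>z. g z - g' z) x = tr \<psi> g x - tr \<psi> g' x"
  by (simp add: tr_def sum_subtractf algebra_simps)

lemma tr_scale: "tr \<psi> (\<lambda>z. c * g z) x = c * tr \<psi> g x"
  by (simp add: tr_def sum_distrib_left mult_ac)

lemma tr_shift: "tr \<psi> (\<lambda>z. p (shift z) * g z) x = p x * tr \<psi> g x"
  unfolding tr_def sum_distrib_left by (intro sum.cong) (auto simp: pre_def)

lemma tr_pow_diff: "x \<in> X \<Longrightarrow> (tr \<psi> ^^ n) (\<lambda>z. g z - g' z) x = (tr \<psi> ^^ n) g x - (tr \<psi> ^^ n) g' x"
  by (simp add: tr_pow sum_subtractf algebra_simps)

lemma tr_pow_scale: "x \<in> X \<Longrightarrow> (tr \<psi> ^^ n) (\<lambda>z. c * g z) x = c * (tr \<psi> ^^ n) g x"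
  by (simp add: tr_pow sum_distrib_left mult_ac)

lemma tr_pow_sum: "x \<in> X \<Longrightarrow> (tr \<psi> ^^ n) (\<lambda>z. \<Sum>i\<in>I. g i z) x = (\<Sum>i\<in>I. (tr \<psi> ^^ n) (g i) x)"
  by (simp add: tr_pow sum_distrib_left) (rule sum.swap)

lemma tr_Suc: "(tr \<psi> ^^ Suc n) g x = tr \<psi> ((tr \<psi> ^^ n) g) x"
  by simp

lemma tr_pow_pow: "(tr \<psi> ^^ m) ((tr \<psi> ^^ n) g) = (tr \<psi> ^^ (m + n)) g"
  by (simp add: funpow_add)

lemma tr_weight: "tr \<psi> (\<lambda>z. exp (g z) * p z) x = tr (\<lambda>z. \<psi> z + g z) p x"
  by (simp add: tr_def exp_add mult_ac)

text \<open>Exponential moments of Birkhoff sums become iterates of a tilted operator. An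
  approximate eigenfunction of that operator then controls them by \<open>tr_pow_eigen_upper\<close>
  and \<open>tr_pow_eigen_lower\<close>.\<close>

lemma tr_pow_weight:
  "x \<in> X \<Longrightarrow> (tr \<psi> ^^ n) (\<lambda>z. exp (birkhoff g n z) * p z) x = (tr (\<lambda>z. \<psi> z + g z) ^^ n) p x"
  by (simp add: tr_pow birkhoff_plus exp_add mult_ac)

lemma tr_pow_eigen_upper:
  assumes "\<And>x. x \<in> X \<Longrightarrow> tr \<psi> g x \<le> \<kappa> * g x" "\<kappa> \<ge> 0" "x \<in> X"
  shows "(tr \<psi> ^^ n) g x \<le> \<kappa> ^ n * g x"
  using \<open>x \<in> X\<close>
proof (induction n arbitrary: x)
  case (Suc n)
  have "(tr \<psi> ^^ Suc n) g x \<le> tr \<psi> (\<lambda>z. \<kappa> ^ n * g z) x"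
    unfolding tr_Suc by (intro tr_mono Suc.IH)
  also have "\<dots> \<le> \<kappa> ^ n * (\<kappa> * g x)"
    unfolding tr_scale using assms Suc by (intro mult_left_mono) auto
  finally show ?case by (simp add: mult_ac)
qed simp

lemma tr_pow_eigen_lower:
  assumes "\<And>x. x \<in> X \<Longrightarrow> \<kappa> * g x \<le> tr \<psi> g x" "\<kappa> \<ge> 0" "x \<in> X"
  shows "\<kappa> ^ n * g x \<le> (tr \<psi> ^^ n) g x"
  using \<open>x \<in> X\<close>
proof (induction n arbitrary: x)
  case (Suc n)
  have "\<kappa> ^ n * (\<kappa> * g x) \<le> tr \<psi> (\<lambda>z. \<kappa> ^ n * g z) x"
    unfolding tr_scale using assms Suc by (intro mult_left_mono) auto
  also have "\<dots> \<le> (tr \<psi> ^^ Suc n) g x"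
    unfolding tr_Suc by (intro tr_mono Suc.IH)
  finally show ?case by (simp add: mult_ac)
qed simp

end

section \<open>Hoelder functions and bounded distortion\<close>

context gibbs_subshift
begin

text \<open>Level \<open>n = 0\<close> is included, so the same constant bounds the oscillation as
  well and boundedness follows from a single value.\<close>

definition hol :: "real \<Rightarrow> ((nat \<Rightarrow> nat) \<Rightarrow> real) \<Rightarrow> bool" where
  "hol B g \<longleftrightarrow> (\<forall>x\<in>X. \<forall>y\<in>X. \<forall>n. agree n x y \<longrightarrow> \<bar>g x - g y\<bar> \<le> B * \<alpha> ^ n)"

definition Hol :: "((nat \<Rightarrow> nat) \<Rightarrow> real) \<Rightarrow> bool" where
  "Hol g \<longleftrightarrow> (\<exists>B. hol B g)"

lemma holI: "(\<And>x y n. x \<in> X \<Longrightarrow> y \<in> X \<Longrightarrow> agree n x y \<Longrightarrow> \<bar>g x - g y\<bar> \<le> B * \<alpha> ^ n) \<Longrightarrow> hol B g"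
  by (simp add: hol_def)

lemma holD: "hol B g \<Longrightarrow> x \<in> X \<Longrightarrow> y \<in> X \<Longrightarrow> agree n x y \<Longrightarrow> \<bar>g x - g y\<bar> \<le> B * \<alpha> ^ n"
  by (simp add: hol_def)

lemma hol_osc: "hol B g \<Longrightarrow> x \<in> X \<Longrightarrow> y \<in> X \<Longrightarrow> \<bar>g x - g y\<bar> \<le> B"
  using holD[of B g x y 0] by simp

lemma hol_nonneg: "hol B g \<Longrightarrow> B \<ge> 0"
  using X_nonempty hol_osc[of B g] by fastforce

lemma hol_bounded:
  assumes "hol B g"
  obtains R where "R > 0" "\<And>x. x \<in> X \<Longrightarrow> \<bar>g x\<bar> \<le> R"
proof -
  obtain x0 where "x0 \<in> X" using X_nonempty by auto
  then have "\<bar>g x\<bar> \<le> \<bar>g x0\<bar> + B + 1" if "x \<in> X" for x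
    using hol_osc[OF assms that] by fastforce
  moreover have "\<bar>g x0\<bar> + B + 1 > 0" using hol_nonneg[OF assms] by linarith
  ultimately show ?thesis using that by blast
qed

lemma Hol_bounded:
  assumes "Hol g"
  obtains R where "R > 0" "\<And>x. x \<in> X \<Longrightarrow> \<bar>g x\<bar> \<le> R"
  using assms hol_bounded unfolding Hol_def by metis

lemma HolI: "hol B g \<Longrightarrow> Hol g"
  by (auto simp: Hol_def)

lemma Hol_cong: "(\<And>x. x \<in> X \<Longrightarrow> g x = g' x) \<Longrightarrow> Hol g \<Longrightarrow> Hol g'"
  unfolding Hol_def hol_def by simp

lemma Hol_const [simp]: "Hol (\<lambda>x. c)"
  using alpha by (auto simp: Hol_def hol_def intro!: exI[of _ 0])

lemma Hol_phi: "Hol \<phi>"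
  by (rule HolI[OF holI]) (rule phi_var)

lemma Hol_add:
  assumes "Hol g" "Hol g'" shows "Hol (\<lambda>x. g x + g' x)"
proof -
  obtain B B' where B: "hol B g" "hol B' g'" using assms by (auto simp: Hol_def)
  have "hol (B + B') (\<lambda>x. g x + g' x)"
  proof (rule holI)
    fix x y n assume "x \<in> X" "y \<in> X" "agree n x y"
    then show "\<bar>g x + g' x - (g y + g' y)\<bar> \<le> (B + B') * \<alpha> ^ n"
      using holD[OF B(1), of x y n] holD[OF B(2), of x y n] by (simp add: algebra_simps)
  qed
  then show ?thesis by (rule HolI)
qed

lemma Hol_mult:
  assumes "Hol g" "Hol g'" shows "Hol (\<lambda>x. g x * g' x)"
proof -
  obtain B B' where B: "hol B g" "hol B' g'" using assms by (auto simp: Hol_def)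
  obtain R where R: "R > 0" "\<And>x. x \<in> X \<Longrightarrow> \<bar>g x\<bar> \<le> R" by (rule Hol_bounded[OF assms(1)]) (rule that)
  obtain R' where R': "R' > 0" "\<And>x. x \<in> X \<Longrightarrow> \<bar>g' x\<bar> \<le> R'" by (rule Hol_bounded[OF assms(2)]) (rule that)
  have "hol (B * R' + R * B') (\<lambda>x. g x * g' x)"
  proof (rule holI)
    fix x y n assume xy: "x \<in> X" "y \<in> X" "agree n x y"
    have "\<bar>g x * g' x - g y * g' y\<bar> = \<bar>(g x - g y) * g' x + g y * (g' x - g' y)\<bar>"
      by (simp add: algebra_simps)
    also have "\<dots> \<le> \<bar>g x - g y\<bar> * \<bar>g' x\<bar> + \<bar>g y\<bar> * \<bar>g' x - g' y\<bar>"
      using abs_triangle_ineq[of "(g x - g y) * g' x" "g y * (g' x - g' y)"] by (simp only: abs_mult)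
    also have "\<dots> \<le> (B * \<alpha> ^ n) * R' + R * (B' * \<alpha> ^ n)"
      using xy holD[OF B(1), of x y n] holD[OF B(2), of x y n] R(2)[of y] R'(2)[of x] R(1) R'(1) 
      by (intro add_mono mult_mono) auto
    finally show "\<bar>g x * g' x - g y * g' y\<bar> \<le> (B * R' + R * B') * \<alpha> ^ n"
      by (simp add: algebra_simps)
  qed
  then show ?thesis by (rule HolI)
qed

lemma Hol_scale: "Hol g \<Longrightarrow> Hol (\<lambda>x. c * g x)"
  by (intro Hol_mult Hol_const)

lemma Hol_minus: "Hol g \<Longrightarrow> Hol (\<lambda>x. - g x)"
  using Hol_scale[of g "-1"] by simp

lemma Hol_diff: "Hol g \<Longrightarrow> Hol g' \<Longrightarrow> Hol (\<lambda>x. g x - g' x)"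
  using Hol_add[OF _ Hol_minus[of g'], of g] by simp

lemma Hol_shift:
  assumes "Hol g" shows "Hol (\<lambda>x. g (shift x))"
proof -
  obtain B where B: "hol B g" using assms by (auto simp: Hol_def)
  have "hol (B / \<alpha>) (\<lambda>x. g (shift x))"
  proof (rule holI)
    fix x y n assume xy: "x \<in> X" "y \<in> X" "agree n x y"
    have "agree (n - 1) (shift x) (shift y)" using xy(3) by (auto simp: agree_def shift_def)
    then have "\<bar>g (shift x) - g (shift y)\<bar> \<le> B * \<alpha> ^ (n - 1)"
      using holD[OF B] xy shift_in by blast
    also have "\<dots> \<le> B / \<alpha> * \<alpha> ^ n"
      using alpha hol_nonneg[OF B] by (cases n) (auto simp: field_simps mult_left_le)
    finally show "\<bar>g (shift x) - g (shift y)\<bar> \<le> B / \<alpha> * \<alpha> ^ n" .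
  qed
  then show ?thesis by (rule HolI)
qed

lemma Hol_shift_pow: "Hol g \<Longrightarrow> Hol (\<lambda>x. g ((shift ^^ n) x))"
proof (induction n)
  case (Suc n)
  show ?case using Hol_shift[OF Suc.IH[OF Suc.prems]] by (simp add: funpow_swap1)
qed simp

lemma Hol_birkhoff: "Hol g \<Longrightarrow> Hol (birkhoff g n)"
proof (induction n)
  case (Suc n)
  have "birkhoff g (Suc n) = (\<lambda>x. birkhoff g n x + g ((shift ^^ n) x))"
    using birkhoff_add[of g n 1] by auto
  then show ?case using Hol_add[OF Suc.IH Hol_shift_pow[OF Suc.prems, of n]] Suc.prems by simp
next
  case 0
  then show ?case by (simp add: Hol_cong[OF _ Hol_const[of 0]])
qed

lemma Hol_exp:
  assumes "Hol g" shows "Hol (\<lambda>x. exp (g x))"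
proof -
  obtain B where B: "hol B g" using assms by (auto simp: Hol_def)
  obtain R where R: "R > 0" "\<And>x. x \<in> X \<Longrightarrow> \<bar>g x\<bar> \<le> R" by (rule Hol_bounded[OF assms]) (rule that)
  have *: "exp u - exp v \<le> exp R * \<bar>u - v\<bar>" if "\<bar>u\<bar> \<le> R" for u v :: real
  proof -
    have "exp u * (1 + (v - u)) \<le> exp u * exp (v - u)"
      by (intro mult_left_mono exp_ge_add_one_self) auto
    then have "exp u - exp v \<le> exp u * (u - v)" by (simp add: algebra_simps flip: exp_add)
    also have "\<dots> \<le> exp u * \<bar>u - v\<bar>" by (intro mult_left_mono) auto
    also have "\<dots> \<le> exp R * \<bar>u - v\<bar>" using that by (intro mult_right_mono) auto
    finally show ?thesis .
  qed
  have "hol (exp R * B) (\<lambda>x. exp (g x))"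
  proof (rule holI)
    fix x y n assume xy: "x \<in> X" "y \<in> X" "agree n x y"
    have "\<bar>exp (g x) - exp (g y)\<bar> \<le> exp R * \<bar>g x - g y\<bar>"
      using *[of "g x" "g y"] *[of "g y" "g x"] R(2) xy by (auto simp: abs_le_iff abs_minus_commute)
    also have "\<dots> \<le> exp R * (B * \<alpha> ^ n)" using holD[OF B xy] by (intro mult_left_mono) auto
    finally show "\<bar>exp (g x) - exp (g y)\<bar> \<le> exp R * B * \<alpha> ^ n" by simp
  qed
  then show ?thesis by (rule HolI)
qed

lemma hol_measurable:
  assumes "hol B g" shows "g \<in> borel_measurable \<mu>"
proof (rule borel_measurable_LIMSEQ_real)
  show "(\<lambda>x. g (rep (Cy n x))) \<in> borel_measurable \<mu>" for n
    by (rule det_measurable[OF det_Cy_fun])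
  fix x assume "x \<in> space \<mu>"
  then have x: "x \<in> X" by (simp add: space_\<mu>)
  have "norm (g (rep (Cy n x)) - g x) \<le> B * \<alpha> ^ n" for n
  proof -
    have U: "Cy n x \<in> cyls n" using x by (simp add: cyls_def)
    then have "rep (Cy n x) \<in> Cy n x" by (rule rep_in)
    then show ?thesis using holD[OF assms _ x] by (auto simp: Cy_def)
  qed
  moreover have "(\<lambda>n. B * \<alpha> ^ n) \<longlonglongrightarrow> 0"
    using alpha by (intro tendsto_mult_right_zero LIMSEQ_power_zero) auto
  ultimately have "(\<lambda>n. g (rep (Cy n x)) - g x) \<longlonglongrightarrow> 0"
    by (rule Lim_null_comparison[OF always_eventually[OF allI]])
  then show "(\<lambda>n. g (rep (Cy n x))) \<longlonglongrightarrow> g x" by (rule LIM_zero_cancel)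
qed

lemma Hol_measurable: "Hol g \<Longrightarrow> g \<in> borel_measurable \<mu>"
  by (auto simp: Hol_def intro: hol_measurable)

lemma Hol_integrable: "Hol g \<Longrightarrow> integrable \<mu> g"
  by (metis Hol_bounded Hol_measurable integrable_bounded)

text \<open>Bounded distortion: the \<open>k\<close>-th summands are taken at points that still
  share \<open>N + n - k\<close> symbols, and the geometric series over \<open>k\<close> is bounded
  independently of \<open>n\<close>.\<close>

lemma birkhoff_variation:
  assumes "hol B g" "x \<in> X" "y \<in> X" "agree (n + N) x y"
  shows "\<bar>birkhoff g n x - birkhoff g n y\<bar> \<le> B / (1 - \<alpha>) * \<alpha> ^ N"
proof -
  have B: "B \<ge> 0" using hol_nonneg[OF assms(1)] .
  have "\<bar>birkhoff g n x - birkhoff g n y\<bar> \<le> (\<Sum>k<n. \<bar>g ((shift ^^ k) x) - g ((shift ^^ k) y)\<bar>)"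
    unfolding birkhoff_def by (simp add: sum_subtractf[symmetric])
  also have "\<dots> \<le> (\<Sum>k<n. B * \<alpha> ^ (N + (n - Suc k)))"
  proof (rule sum_mono)
    fix k assume "k \<in> {..<n}"
    then have "agree (k + (N + (n - Suc k))) x y" using assms(4) by (auto simp: agree_def)
    then show "\<bar>g ((shift ^^ k) x) - g ((shift ^^ k) y)\<bar> \<le> B * \<alpha> ^ (N + (n - Suc k))"
      using assms by (intro holD[OF assms(1)] shift_pow_in agree_shift) auto
  qed
  also have "\<dots> = B * \<alpha> ^ N * (\<Sum>k<n. \<alpha> ^ (n - Suc k))"
    unfolding power_add by (simp add: sum_distrib_left mult_ac del: Nat.add_diff_assoc)
  also have "(\<Sum>k<n. \<alpha> ^ (n - Suc k)) = (\<Sum>k<n. \<alpha> ^ k)"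
    by (rule sum.nat_diff_reindex)
  also have "\<dots> \<le> 1 / (1 - \<alpha>)"
    using alpha by (simp add: sum_gp_strict divide_right_mono)
  finally show ?thesis using B alpha by (simp add: mult_left_mono)
qed

definition D\<phi> :: real where "D\<phi> = b / (1 - \<alpha>)"

lemma Dphi_nonneg: "D\<phi> \<ge> 0"
  using b_nonneg alpha by (simp add: D\<phi>_def)

lemma birkhoff_phi_variation:
  "x \<in> X \<Longrightarrow> y \<in> X \<Longrightarrow> agree (n + N) x y \<Longrightarrow> \<bar>birkhoff \<phi> n x - birkhoff \<phi> n y\<bar> \<le> D\<phi> * \<alpha> ^ N"
  unfolding D\<phi>_def by (rule birkhoff_variation[OF holI]) (auto intro: phi_var)

section \<open>Iterates of the constant 1, the eigenfunction and normalisation\<close>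

lemma sum_measure_cyls: "(\<Sum>U\<in>cyls n. measure \<mu> U) = 1"
  using integral_det[of n "\<lambda>x. 1"] prob_space by (simp add: det_def)

text \<open>Distinct preimages lie in distinct \<open>n\<close>-cylinders, each of weight at most
  \<open>C\<close> times its measure, and these measures sum to at most 1.\<close>

lemma tr_one_upper:
  assumes "x \<in> X" shows "(tr \<phi> ^^ n) (\<lambda>_. 1) x \<le> C"
proof -
  have "(tr \<phi> ^^ n) (\<lambda>_. 1) x \<le> (\<Sum>z\<in>pre n x. C * measure \<mu> (Cy n z))"
    unfolding tr_pow[OF assms]
  proof (rule sum_mono)
    fix z assume "z \<in> pre n x"
    then show "exp (birkhoff \<phi> n z) * 1 \<le> C * measure \<mu> (Cy n z)"
      using gibbs_lower[OF pre_in, of z n x n] C_pos by (simp add: field_simps)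
  qed
  also have "\<dots> = C * (\<Sum>U\<in>Cy n ` pre n x. measure \<mu> U)"
    by (simp add: sum.reindex[OF inj_Cy_pre] sum_distrib_left)
  also have "\<dots> \<le> C * (\<Sum>U\<in>cyls n. measure \<mu> U)"
    using C_pos finite_cyls by (intro mult_left_mono sum_mono2) (auto simp: cyls_def dest: pre_in)
  finally show ?thesis by (simp add: sum_measure_cyls)
qed

text \<open>Gluing places a preimage of every \<open>x\<close> into every cylinder, with a weight
  comparable to the measure of the cylinder. The bound is uniform in \<open>x\<close>; it yields the
  positivity of the eigenfunction and, later, the contraction of oscillations.\<close>

lemma doeblin:
  assumes "x \<in> X" "u \<in> X"
  shows "gap * measure \<mu> (Cy n u) \<le> (tr \<phi> ^^ (n + G)) (indicator (Cy n u)) x"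
proof -
  obtain v where v: "v \<in> X" "agree n v u" "(shift ^^ (n + G)) v = x"
    using gluing[OF assms(2,1)] by blast
  have vp: "v \<in> pre (n + G) x" using v by (simp add: pre_def)
  have vU: "v \<in> Cy n u" using v by (simp add: Cy_def)
  have C2: "1 / C ^ 3 \<le> 1 / C" using C_ge_1 by (intro divide_left_mono) (auto simp: self_le_power)
  have "gap * measure \<mu> (Cy n u) \<le> exp (- real G * \<Phi>) * (1 / C) * (C * exp (birkhoff \<phi> n v))"
    using gibbs_upper[OF v(1), of n] Cy_cong[OF v(2)] C2 C_pos
    unfolding gap_def divide_inverse by (intro mult_mono mult_left_mono) (auto simp: divide_inverse)
  also have "\<dots> = exp (birkhoff \<phi> n v) * exp (- real G * \<Phi>)" using C_pos by simp
  also have "\<dots> \<le> exp (birkhoff \<phi> n v) * exp (birkhoff \<phi> G ((shift ^^ n) v))"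
    using birkhoff_phi_ge[OF shift_pow_in[OF v(1)], of G n] by (intro mult_left_mono) auto
  also have "\<dots> = exp (birkhoff \<phi> (n + G) v) * indicator (Cy n u) v"
    using vU by (simp add: birkhoff_add exp_add)
  also have "\<dots> \<le> (tr \<phi> ^^ (n + G)) (indicator (Cy n u)) x"
    unfolding tr_pow[OF assms(1)]
    by (rule member_le_sum[OF vp]) (auto simp: finite_pre)
  finally show ?thesis .
qed

lemma tr_det:
  assumes "x \<in> X" "det n p"
  shows "(tr \<phi> ^^ m) p x = (\<Sum>U\<in>cyls n. (tr \<phi> ^^ m) (indicator U) x * p (rep U))"
proof -
  have "(tr \<phi> ^^ m) p x = (tr \<phi> ^^ m) (\<lambda>z. \<Sum>U\<in>cyls n. p (rep U) * indicator U z) x"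
    using det_expand[OF assms(2)] by (intro tr_pow_cong assms(1)) (simp add: mult.commute)
  also have "\<dots> = (\<Sum>U\<in>cyls n. p (rep U) * (tr \<phi> ^^ m) (indicator U) x)"
    by (simp only: tr_pow_sum[OF assms(1)] tr_pow_scale[OF assms(1)])
  finally show ?thesis by (simp only: mult.commute)
qed

lemma tr_one_lower:
  assumes "x \<in> X" shows "gap \<le> (tr \<phi> ^^ (n + G)) (\<lambda>_. 1) x"
proof -
  have "(tr \<phi> ^^ (n + G)) (\<lambda>_. 1) x = (\<Sum>U\<in>cyls n. (tr \<phi> ^^ (n + G)) (indicator U) x)"
    using tr_det[OF assms, of n "\<lambda>_. 1" "n + G"] by (simp add: det_def)
  also have "\<dots> \<ge> (\<Sum>U\<in>cyls n. gap * measure \<mu> U)"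
    using doeblin[OF assms] by (intro sum_mono) (auto simp: cyls_def)
  finally show ?thesis by (simp add: sum_distrib_left[symmetric] sum_measure_cyls)
qed

text \<open>Multiplicative regularity survives sums with positive weights, and also suprema and
  limits. Level 0 is left out because the preimages of points with different first symbols cannot be
  paired.\<close>

definition log_hol :: "real \<Rightarrow> ((nat \<Rightarrow> nat) \<Rightarrow> real) \<Rightarrow> bool" where
  "log_hol B g \<longleftrightarrow> (\<forall>x\<in>X. \<forall>y\<in>X. \<forall>n\<ge>1. agree n x y \<longrightarrow> g x \<le> exp (B * \<alpha> ^ n) * g y)"

lemma log_holD: "log_hol B g \<Longrightarrow> x \<in> X \<Longrightarrow> y \<in> X \<Longrightarrow> n \<ge> 1 \<Longrightarrow> agree n x y \<Longrightarrow> g x \<le> exp (B * \<alpha> ^ n) * g y"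
  by (auto simp: log_hol_def)

text \<open>The constant does not grow with \<open>n\<close>: the weights contribute
  \<open>D\<phi>\<close> by bounded distortion, and \<open>g\<close> is evaluated at points that
  agree even longer than \<open>x\<close> and \<open>y\<close>.\<close>

lemma log_hol_tr_pow:
  assumes g: "log_hol B g" "\<And>x. x \<in> X \<Longrightarrow> g x \<ge> 0" and B: "B \<ge> 0"
  shows "log_hol (D\<phi> + B) ((tr \<phi> ^^ n) g)"
  unfolding log_hol_def
proof (intro ballI allI impI)
  fix x y N assume xy: "x \<in> X" "y \<in> X" and N: "1 \<le> N" "agree N x y"
  have N1: "agree 1 x y" using N agree_mono by blast
  have "(tr \<phi> ^^ n) g x = (\<Sum>z\<in>pre n y. exp (birkhoff \<phi> n (splice n z x)) * g (splice n z x))"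
    unfolding tr_pow[OF xy(1)] by (rule sum_pre_splice[OF xy N1])
  also have "\<dots> \<le> (\<Sum>z\<in>pre n y. exp ((D\<phi> + B) * \<alpha> ^ N) * (exp (birkhoff \<phi> n z) * g z))"
  proof (rule sum_mono)
    fix z assume z: "z \<in> pre n y"
    let ?z = "splice n z x"
    have zX: "?z \<in> X" "z \<in> X" using pre_in splice_in_pre[OF z xy(1) agree_sym[OF N1]] z by auto
    have ag: "agree (n + N) ?z z" by (rule agree_splice_pre[OF z agree_sym[OF N(2)]])
    have "exp (birkhoff \<phi> n ?z) \<le> exp (D\<phi> * \<alpha> ^ N + birkhoff \<phi> n z)"
      using birkhoff_phi_variation[OF zX ag] by simp
    moreover have "g ?z \<le> exp (B * \<alpha> ^ N) * g z"
    proof -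
      have "g ?z \<le> exp (B * \<alpha> ^ (n + N)) * g z" using log_holD[OF g(1) zX _ ag] N by simp
      also have "\<dots> \<le> exp (B * \<alpha> ^ N) * g z"
        using B alpha g(2)[OF zX(2)] by (intro mult_right_mono) (auto intro!: mult_left_mono power_decreasing)
      finally show ?thesis .
    qed
    ultimately have "exp (birkhoff \<phi> n ?z) * g ?z \<le> exp (D\<phi> * \<alpha> ^ N + birkhoff \<phi> n z) * (exp (B * \<alpha> ^ N) * g z)"
      using g(2)[OF zX(1)] by (intro mult_mono) auto
    then show "exp (birkhoff \<phi> n ?z) * g ?z \<le> exp ((D\<phi> + B) * \<alpha> ^ N) * (exp (birkhoff \<phi> n z) * g z)"
      unfolding distrib_right[of D\<phi> B] exp_add by (simp only: mult_ac)
  qed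
  also have "\<dots> = exp ((D\<phi> + B) * \<alpha> ^ N) * (tr \<phi> ^^ n) g y"
    by (simp add: tr_pow[OF xy(2)] sum_distrib_left)
  finally show "(tr \<phi> ^^ n) g x \<le> exp ((D\<phi> + B) * \<alpha> ^ N) * (tr \<phi> ^^ n) g y" .
qed

lemma log_hol_LIMSEQ:
  assumes "\<And>k. log_hol B (s k)" "\<And>x. x \<in> X \<Longrightarrow> (\<lambda>k. s k x) \<longlonglongrightarrow> g x"
  shows "log_hol B g"
  unfolding log_hol_def
proof (intro ballI allI impI)
  fix x y n assume xy: "x \<in> X" "y \<in> X" "n \<ge> 1" "agree n x y"
  show "g x \<le> exp (B * \<alpha> ^ n) * g y"
    using log_holD[OF assms(1) xy] xy by (intro LIMSEQ_le[OF assms(2) tendsto_mult_left[OF assms(2)]]) auto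
qed

lemma tr_LIMSEQ:
  assumes "\<And>x. x \<in> X \<Longrightarrow> (\<lambda>k. s k x) \<longlonglongrightarrow> g x"
  shows "(\<lambda>k. tr \<psi> (s k) x) \<longlonglongrightarrow> tr \<psi> g x"
  unfolding tr_def using assms pre_in by (intro tendsto_sum tendsto_mult_left) auto

text \<open>The upper limit of the iterates of the constant function 1 is a sub-eigenfunction; iterating
  it upwards gives an eigenfunction, without any compactness argument.\<close>

lemma eigenfunction_exists:
  obtains h where "\<And>x. x \<in> X \<Longrightarrow> tr \<phi> h x = h x" "\<And>x. x \<in> X \<Longrightarrow> gap \<le> h x"
    "\<And>x. x \<in> X \<Longrightarrow> h x \<le> C\<^sup>2" "log_hol (2 * D\<phi>) h"
proof -
  let ?L = "\<lambda>n. (tr \<phi> ^^ n) (\<lambda>_. 1)"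
  define a where "a k x = (SUP n\<in>{G + k..}. ?L n x)" for k x
  have bdd: "bdd_above ((\<lambda>n. ?L n x) ` {G + k..})" if "x \<in> X" for x k
    using tr_one_upper[OF that] by (intro bdd_aboveI2)
  have L_le_a: "?L n x \<le> a k x" if "x \<in> X" "n \<ge> G + k" for x n k
    unfolding a_def using that bdd by (intro cSUP_upper) auto
  have a_upper: "a k x \<le> C" if "x \<in> X" for x k
    unfolding a_def using tr_one_upper[OF that] by (intro cSUP_least) auto
  have a_lower: "gap \<le> a k x" if "x \<in> X" for x k
    using tr_one_lower[OF that, of k] L_le_a[OF that, of k "k + G"] by simp
  have a_dec: "decseq (\<lambda>k. a k x)" if "x \<in> X" for x
    unfolding a_def using that bdd by (intro decseq_SucI cSUP_subset_mono) auto
  have "\<exists>s. \<forall>x\<in>X. (\<lambda>k. a k x) \<longlonglongrightarrow> s x"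
  proof (intro bchoice ballI)
    fix x assume "x \<in> X"
    then show "\<exists>l. (\<lambda>k. a k x) \<longlonglongrightarrow> l"
      using decseq_convergent[OF a_dec, of x gap] a_lower by metis
  qed
  then obtain s where s: "\<And>x. x \<in> X \<Longrightarrow> (\<lambda>k. a k x) \<longlonglongrightarrow> s x" by blast
  have L_hol: "log_hol D\<phi> (?L n)" for n
    using log_hol_tr_pow[of 0 "\<lambda>_. 1" n] by (simp add: log_hol_def)
  have a_hol: "log_hol D\<phi> (a k)" for k
    unfolding log_hol_def
  proof (intro ballI allI impI)
    fix x y N assume xy: "x \<in> X" "y \<in> X" "N \<ge> 1" "agree N x y"
    show "a k x \<le> exp (D\<phi> * \<alpha> ^ N) * a k y"
      unfolding a_def[of k x]
    proof (rule cSUP_least)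
      fix n assume n: "n \<in> {G + k..}"
      have "?L n x \<le> exp (D\<phi> * \<alpha> ^ N) * ?L n y" by (rule log_holD[OF L_hol xy])
      also have "\<dots> \<le> exp (D\<phi> * \<alpha> ^ N) * a k y"
        using L_le_a[OF xy(2)] n by (intro mult_left_mono) auto
      finally show "?L n x \<le> exp (D\<phi> * \<alpha> ^ N) * a k y" .
    qed simp
  qed
  have s_hol: "log_hol D\<phi> s" by (rule log_hol_LIMSEQ[OF a_hol s])
  have s_lower: "gap \<le> s x" if "x \<in> X" for x
    using LIMSEQ_le_const[OF s[OF that]] a_lower[OF that] by blast
  have s_upper: "s x \<le> C" if "x \<in> X" for x
    using LIMSEQ_le_const2[OF s[OF that]] a_upper[OF that] by blast
  \<comment> \<open>By positivity the image of a tail supremum dominates the next tail supremum. In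
    the limit \<open>s\<close> lies below its image, and therefore increases under
    iteration.\<close>
  have a_step: "a (Suc k) x \<le> tr \<phi> (a k) x" if "x \<in> X" for k x
    unfolding a_def[of "Suc k"]
  proof (rule cSUP_least)
    fix n assume n: "n \<in> {G + Suc k..}"
    then obtain n' where n': "n = Suc n'" "n' \<ge> G + k" by (cases n) auto
    show "?L n x \<le> tr \<phi> (a k) x"
      unfolding n'(1) tr_Suc using L_le_a n'(2) by (intro tr_mono) auto
  qed simp
  have s_step: "s x \<le> tr \<phi> s x" if "x \<in> X" for x
    using a_step[OF that] by (intro LIMSEQ_le[OF LIMSEQ_Suc[OF s[OF that]] tr_LIMSEQ[OF s]]) auto
  let ?e = "\<lambda>n. (tr \<phi> ^^ n) s"
  have e_inc: "incseq (\<lambda>n. ?e n x)" if "x \<in> X" for x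
  proof (rule incseq_SucI)
    fix n
    have "?e n x \<le> (tr \<phi> ^^ n) (tr \<phi> s) x" by (rule tr_pow_mono[OF that s_step])
    also have "\<dots> = ?e (Suc n) x" using tr_pow_pow[where \<psi> = \<phi> and m = n and n = 1 and g = s] by simp
    finally show "?e n x \<le> ?e (Suc n) x" .
  qed
  \<comment> \<open>One factor \<open>C\<close> bounds \<open>s\<close>, the other bounds the
    iterates of the constant 1.\<close>
  have e_upper: "?e n x \<le> C\<^sup>2" if "x \<in> X" for n x
  proof -
    have "?e n x \<le> (tr \<phi> ^^ n) (\<lambda>z. C * 1) x" using s_upper by (intro tr_pow_mono[OF that]) auto
    also have "\<dots> = C * ?L n x" by (rule tr_pow_scale[OF that])
    also have "\<dots> \<le> C * C" using tr_one_upper[OF that] C_pos by (intro mult_left_mono) auto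
    finally show ?thesis by (simp add: power2_eq_square)
  qed
  have "\<exists>h. \<forall>x\<in>X. (\<lambda>n. ?e n x) \<longlonglongrightarrow> h x"
  proof (intro bchoice ballI)
    fix x assume x: "x \<in> X"
    show "\<exists>l. (\<lambda>n. ?e n x) \<longlonglongrightarrow> l"
      using incseq_convergent[OF e_inc[OF x], of "C\<^sup>2"] e_upper[OF x] by metis
  qed
  then obtain h where h: "\<And>x. x \<in> X \<Longrightarrow> (\<lambda>n. ?e n x) \<longlonglongrightarrow> h x" by blast
  have h_eq: "tr \<phi> h x = h x" if "x \<in> X" for x
  proof (rule LIMSEQ_unique)
    show "(\<lambda>n. tr \<phi> (?e n) x) \<longlonglongrightarrow> tr \<phi> h x" by (rule tr_LIMSEQ[OF h])
    show "(\<lambda>n. tr \<phi> (?e n) x) \<longlonglongrightarrow> h x" using LIMSEQ_Suc[OF h[OF that]] by simp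
  qed
  have h_lower: "gap \<le> h x" if "x \<in> X" for x
    using incseq_le[OF e_inc[OF that] h[OF that], of 0] s_lower[OF that] by simp
  have h_upper: "h x \<le> C\<^sup>2" if "x \<in> X" for x
    using LIMSEQ_le_const2[OF h[OF that]] e_upper[OF that] by blast
  \<comment> \<open>\<open>s\<close> contributes one \<open>D\<phi>\<close>, the iteration
    another.\<close>
  have "log_hol (2 * D\<phi>) h"
  proof (rule log_hol_LIMSEQ[OF _ h])
    have "0 \<le> s x" if "x \<in> X" for x using s_lower[OF that] gap_pos by linarith
    then show "log_hol (2 * D\<phi>) (?e n)" for n
      using log_hol_tr_pow[OF s_hol _ Dphi_nonneg, of n] by simp
  qed
  with h_eq h_lower h_upper show ?thesis using that by blast
qed

text \<open>The logarithm of \<open>log_hol\<close> covers the levels \<open>n \<ge> 1\<close>; the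
  bounds \<open>l\<close> and \<open>u\<close> supply the missing level 0.\<close>

lemma Hol_ln:
  assumes "log_hol B h" "\<And>x. x \<in> X \<Longrightarrow> l \<le> h x" "\<And>x. x \<in> X \<Longrightarrow> h x \<le> u" "l > 0"
  shows "Hol (\<lambda>x. ln (h x))"
proof -
  have pos: "h x > 0" if "x \<in> X" for x using assms(2)[OF that] assms(4) by linarith
  have one: "ln (h x) - ln (h y) \<le> B * \<alpha> ^ n" if "x \<in> X" "y \<in> X" "n \<ge> 1" "agree n x y" for x y n
  proof -
    have "ln (h x) \<le> ln (exp (B * \<alpha> ^ n) * h y)"
      using log_holD[OF assms(1) that] pos that by (subst ln_le_cancel_iff) auto
    also have "\<dots> = B * \<alpha> ^ n + ln (h y)" using pos[OF that(2)] by (simp add: ln_mult)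
    finally show ?thesis by simp
  qed
  have two: "ln (h x) - ln (h y) \<le> ln u - ln l" if "x \<in> X" "y \<in> X" for x y
  proof -
    have "ln (h x) \<le> ln u" using assms(3)[OF that(1)] pos[OF that(1)] by (subst ln_le_cancel_iff) auto
    moreover have "ln l \<le> ln (h y)" using assms(2)[OF that(2)] assms(4) pos[OF that(2)] by (subst ln_le_cancel_iff) auto
    ultimately show ?thesis by linarith
  qed
  have "hol (\<bar>B\<bar> + \<bar>ln u - ln l\<bar>) (\<lambda>x. ln (h x))"
  proof (rule holI)
    fix x y n assume xy: "x \<in> X" "y \<in> X" "agree n x y"
    show "\<bar>ln (h x) - ln (h y)\<bar> \<le> (\<bar>B\<bar> + \<bar>ln u - ln l\<bar>) * \<alpha> ^ n"
    proof (cases "n = 0")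
      case True
      then show ?thesis using two[of x y] two[of y x] xy by simp
    next
      case False
      then have "\<bar>ln (h x) - ln (h y)\<bar> \<le> B * \<alpha> ^ n"
        using one[of x y n] one[of y x n] xy agree_sym[OF xy(3)] by (simp add: abs_le_iff)
      also have "\<dots> \<le> (\<bar>B\<bar> + \<bar>ln u - ln l\<bar>) * \<alpha> ^ n" using alpha by (intro mult_right_mono) auto
      finally show ?thesis .
    qed
  qed
  then show ?thesis by (rule HolI)
qed

text \<open>Dividing by the eigenfunction adds a coboundary to the potential. Birkhoff sums change
  by a bounded amount, so the same \<open>\<mu>\<close> remains Gibbs with a larger constant, and
  the eigenvalue equation turns into weights that sum to 1.\<close>

lemma normalized_potential_exists:
  obtains \<psi> \<Phi>' b' C' where "gibbs_subshift K A G \<mu> \<psi> \<alpha> \<Phi>' b' C'"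
    "\<And>x. x \<in> X \<Longrightarrow> tr \<psi> (\<lambda>_. 1) x = 1"
proof -
  obtain h where h: "\<And>x. x \<in> X \<Longrightarrow> tr \<phi> h x = h x" "\<And>x. x \<in> X \<Longrightarrow> gap \<le> h x"
    "\<And>x. x \<in> X \<Longrightarrow> h x \<le> C\<^sup>2" "log_hol (2 * D\<phi>) h" using eigenfunction_exists by blast
  have pos: "h x > 0" if "x \<in> X" for x using h(2)[OF that] gap_pos by linarith
  define \<psi> where "\<psi> x = \<phi> x + (ln (h x) - ln (h (shift x)))" for x
  have Hl: "Hol (\<lambda>x. ln (h x))" by (rule Hol_ln[OF h(4,2,3) gap_pos])
  have "Hol \<psi>"
    unfolding \<psi>_def by (intro Hol_add Hol_diff Hol_phi Hl Hol_shift[OF Hl])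
  then obtain b' where b': "hol b' \<psi>" by (auto simp: Hol_def)
  obtain \<Phi>' where \<Phi>': "\<And>x. x \<in> X \<Longrightarrow> \<bar>\<psi> x\<bar> \<le> \<Phi>'" using hol_bounded[OF b'] by metis
  \<comment> \<open>Bounds the ratio of two values of \<open>h\<close>, which all lie between
    \<open>gap\<close> and \<open>C\<^sup>2\<close>.\<close>
  define R where "R = C\<^sup>2 / gap"
  have C2: "C\<^sup>2 \<ge> 1" using C_ge_1 by simp
  have R1: "R \<ge> 1" using gap_pos gap_le_1 C2 unfolding R_def by (simp add: le_divide_eq)
  have S: "exp (birkhoff \<psi> n x) = exp (birkhoff \<phi> n x) * (h x / h ((shift ^^ n) x))" if "x \<in> X" for n x
  proof -
    have "birkhoff \<psi> n x = birkhoff \<phi> n x + birkhoff (\<lambda>x. (- ln (h (shift x))) - (- ln (h x))) n x"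
      unfolding \<psi>_def birkhoff_plus[symmetric] by (simp add: algebra_simps)
    also have "\<dots> = birkhoff \<phi> n x + (ln (h x) - ln (h ((shift ^^ n) x)))"
      using birkhoff_coboundary[of "\<lambda>x. - ln (h x)" n x] by simp
    finally show ?thesis using pos[OF that] pos[OF shift_pow_in[OF that]] by (simp add: exp_add exp_diff)
  qed
  have ratio: "h x / h y \<le> R" "1 / R \<le> h x / h y" if "x \<in> X" "y \<in> X" for x y
  proof -
    have *: "h x / h y \<le> R" if "x \<in> X" "y \<in> X" for x y
      unfolding R_def using that h(2,3) gap_pos pos by (intro frac_le) (auto intro: less_imp_le)
    show "h x / h y \<le> R" by (rule *[OF that])
    have "1 / R \<le> 1 / (h y / h x)"
      using *[OF that(2,1)] pos[OF that(1)] pos[OF that(2)] R1 by (intro divide_left_mono) auto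
    then show "1 / R \<le> h x / h y" by simp
  qed
  have "gibbs_subshift K A G \<mu> \<psi> \<alpha> \<Phi>' b' (C * R)"
  proof (unfold_locales)
    show "sets \<mu> = sets (shift_space K A)" by (rule sets_\<mu>)
    show "shift_invariant \<mu>" by (rule invariant)
    show "0 < \<alpha>" "\<alpha> < 1" by (rule alpha)+
    show "\<bar>\<psi> x - \<psi> y\<bar> \<le> b' * \<alpha> ^ n" if "x \<in> X" "y \<in> X" "agree n x y" for x y n
      by (rule holD[OF b' that])
    show "\<bar>\<psi> x\<bar> \<le> \<Phi>'" if "x \<in> X" for x by (rule \<Phi>'[OF that])
    show "1 \<le> C * R" using C_ge_1 R1 mult_mono[of 1 C 1 R] by simp
    fix x n assume x: "x \<in> X"
    have "exp (birkhoff \<psi> n x) / (C * R) \<le> exp (birkhoff \<phi> n x) * R / (C * R)"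
      unfolding S[OF x] using ratio(1)[OF x shift_pow_in[OF x]] C_pos R1
      by (intro divide_right_mono mult_left_mono) auto
    also have "\<dots> = exp (birkhoff \<phi> n x) / C" using R1 by simp
    also have "\<dots> \<le> measure \<mu> (Cy n x)" by (rule gibbs_lower[OF x])
    finally show "exp (birkhoff \<psi> n x) / (C * R) \<le> measure \<mu> (Cy n x)" .
    have "measure \<mu> (Cy n x) \<le> C * exp (birkhoff \<phi> n x)" by (rule gibbs_upper[OF x])
    also have "\<dots> = C * R * (exp (birkhoff \<phi> n x) * (1 / R))" using R1 by simp
    also have "\<dots> \<le> C * R * exp (birkhoff \<psi> n x)"
      unfolding S[OF x] using ratio(2)[OF x shift_pow_in[OF x]] C_pos R1
      by (intro mult_left_mono) auto
    finally show "measure \<mu> (Cy n x) \<le> C * R * exp (birkhoff \<psi> n x)" .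
  qed
  moreover have "tr \<psi> (\<lambda>_. 1) x = 1" if x: "x \<in> X" for x
  proof -
    have "tr \<psi> (\<lambda>_. 1) x = (\<Sum>z\<in>pre 1 x. exp (\<phi> z) * h z / h x)"
      unfolding tr_def
    proof (rule sum.cong[OF refl])
      fix z assume "z \<in> pre 1 x"
      then have "z \<in> X" "shift z = x" by (auto simp: pre_def)
      then show "exp (\<psi> z) * 1 = exp (\<phi> z) * h z / h x"
        using pos x by (simp add: \<psi>_def exp_add exp_diff)
    qed
    also have "\<dots> = tr \<phi> h x / h x" by (simp add: tr_def sum_divide_distrib)
    finally show ?thesis using h(1)[OF x] pos[OF x] by simp
  qed
  ultimately show ?thesis using that by blast
qed

end

section \<open>Normalised potentials and exponential moments\<close>

lemma exp_le_quadratic: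
  fixes s :: real assumes "\<bar>s\<bar> \<le> 1" shows "exp s \<le> 1 + s + s\<^sup>2 / 2 + 2 * \<bar>s\<bar> ^ 3"
    and "exp s \<ge> 1 + s + s\<^sup>2 / 2 - 2 * \<bar>s\<bar> ^ 3"
proof -
  have "\<bar>exp s - (\<Sum>i\<le>2. s ^ i / fact i)\<bar> \<le> exp \<bar>s\<bar> * \<bar>s\<bar> ^ Suc 2 / fact 2"
    using Taylor_exp_field[of s 2] by simp
  also have "(\<Sum>i\<le>2. s ^ i / fact i) = 1 + s + s\<^sup>2 / 2"
    by (simp add: numeral_2_eq_2)
  also have "exp \<bar>s\<bar> * \<bar>s\<bar> ^ Suc 2 / fact 2 \<le> 4 * \<bar>s\<bar> ^ 3 / 2"
  proof -
    have "exp \<bar>s\<bar> \<le> exp 1" using assms by simp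
    also have "\<dots> \<le> 4" using exp_le by linarith
    finally have "exp \<bar>s\<bar> * \<bar>s\<bar> ^ 3 \<le> 4 * \<bar>s\<bar> ^ 3" by (intro mult_right_mono) auto
    then show ?thesis by (simp add: numeral_3_eq_3 numeral_2_eq_2)
  qed
  finally show "exp s \<le> 1 + s + s\<^sup>2 / 2 + 2 * \<bar>s\<bar> ^ 3" "exp s \<ge> 1 + s + s\<^sup>2 / 2 - 2 * \<bar>s\<bar> ^ 3"
    by (simp_all add: abs_le_iff)
qed

lemma abs_exp_minus_one_le: "\<bar>exp s - 1\<bar> \<le> \<bar>s\<bar> * exp \<bar>s :: real\<bar>"
proof (cases "s \<ge> 0")
  case True then show ?thesis using exp_minus_one_le[of s] by simp
next
  case False
  have "1 + s \<le> exp s" by (rule exp_ge_add_one_self)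
  moreover have "\<bar>s\<bar> * 1 \<le> \<bar>s\<bar> * exp \<bar>s\<bar>" by (intro mult_left_mono) auto
  moreover have "exp s \<le> 1" using False by simp
  ultimately have "\<bar>exp s - 1\<bar> \<le> \<bar>s\<bar>" using False by linarith
  then show ?thesis using \<open>\<bar>s\<bar> * 1 \<le> \<bar>s\<bar> * exp \<bar>s\<bar>\<close> by linarith
qed

text \<open>Applied to logarithms of estimates with multiplicative constants: only the growth rate
  in \<open>n\<close> survives.\<close>

lemma linear_bound_imp_le:
  fixes a b c :: real
  assumes "\<And>n. real n * a \<le> c + real n * b"
  shows "a \<le> b"
proof (rule ccontr)
  assume "\<not> a \<le> b"
  then have ab: "a - b > 0" by simp
  obtain n :: nat where "real n * (a - b) > c" using reals_Archimedean3[OF ab] by blast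
  then show False using assms[of n] by (simp add: algebra_simps)
qed

section \<open>Seminorms, and integrals bounded by iterates of the operator\<close>

context gibbs_subshift
begin

text \<open>The Hoelder seminorm without level 0, kept apart from \<open>osc\<close> because
  iteration contracts the two by different mechanisms: closeness of preimages here, mixing of
  weights there.\<close>

definition lip :: "real \<Rightarrow> ((nat \<Rightarrow> nat) \<Rightarrow> real) \<Rightarrow> bool" where
  "lip l g \<longleftrightarrow> (\<forall>x\<in>X. \<forall>y\<in>X. \<forall>n\<ge>1. agree n x y \<longrightarrow> \<bar>g x - g y\<bar> \<le> l * \<alpha> ^ n)"

definition osc :: "real \<Rightarrow> ((nat \<Rightarrow> nat) \<Rightarrow> real) \<Rightarrow> bool" where
  "osc r g \<longleftrightarrow> (\<forall>x\<in>X. \<forall>y\<in>X. \<bar>g x - g y\<bar> \<le> r)"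

lemma lipD: "lip l g \<Longrightarrow> x \<in> X \<Longrightarrow> y \<in> X \<Longrightarrow> n \<ge> 1 \<Longrightarrow> agree n x y \<Longrightarrow> \<bar>g x - g y\<bar> \<le> l * \<alpha> ^ n"
  by (simp add: lip_def)

lemma oscD: "osc r g \<Longrightarrow> x \<in> X \<Longrightarrow> y \<in> X \<Longrightarrow> \<bar>g x - g y\<bar> \<le> r"
  by (simp add: osc_def)

lemma hol_lip: "hol B g \<Longrightarrow> lip B g"
  by (simp add: lip_def hol_def)

lemma hol_imp_osc: "hol B g \<Longrightarrow> osc B g"
  by (simp add: osc_def hol_osc)

lemma osc_nonneg: "osc r g \<Longrightarrow> r \<ge> 0"
  using X_nonempty by (fastforce simp: osc_def)

lemma hol_of_lip_osc:
  assumes "lip l g" "osc r g" "l \<le> B" "r \<le> B"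
  shows "hol B g"
proof (rule holI)
  fix x y n assume xy: "x \<in> X" "y \<in> X" "agree n x y"
  show "\<bar>g x - g y\<bar> \<le> B * \<alpha> ^ n"
  proof (cases "n = 0")
    case True then show ?thesis using oscD[OF assms(2) xy(1,2)] assms(4) by simp
  next
    case False
    then have "\<bar>g x - g y\<bar> \<le> l * \<alpha> ^ n" using lipD[OF assms(1) xy(1,2) _ xy(3)] by simp
    also have "\<dots> \<le> B * \<alpha> ^ n" using assms(3) alpha by (intro mult_right_mono) auto
    finally show ?thesis .
  qed
qed

text \<open>\<open>\<mu>\<close> is not yet known to be stationary, so an integral cannot simply be
  moved to an iterate. The Gibbs upper bound achieves this up to a constant: choose one point in
  each \<open>n\<close>-cylinder and recognise the weighted sum as part of iterates evaluated at
  finitely many points.\<close>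

lemma integral_le_tr_pow:
  assumes E: "integrable \<mu> E" "\<And>x. x \<in> X \<Longrightarrow> E x \<ge> 0"
    and D: "D \<ge> 0" "\<And>x y. x \<in> X \<Longrightarrow> y \<in> X \<Longrightarrow> agree n x y \<Longrightarrow> E x \<le> D * E y"
    and R: "\<And>x. x \<in> X \<Longrightarrow> (tr \<phi> ^^ n) E x \<le> R"
  shows "(\<integral>x. E x \<partial>\<mu>) \<le> C * D * real (card (cyls 1)) * R"
proof -
  \<comment> \<open>The tail of each representative is replaced by the chosen point of its
    1-cylinder, so that every \<open>v U\<close> is a preimage of one of only
    \<open>card (cyls 1)\<close> points.\<close>
  define v where "v U = splice n (rep U) (rep (Cy 1 ((shift ^^ n) (rep U))))" for U
  have v: "v U \<in> pre n (rep (Cy 1 ((shift ^^ n) (rep U))))" "v U \<in> X" "agree n (v U) (rep U)"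
    "Cy 1 ((shift ^^ n) (rep U)) \<in> cyls 1" if "U \<in> cyls n" for U
  proof -
    have u: "rep U \<in> X" by (rule rep_in_X[OF that])
    show c: "Cy 1 ((shift ^^ n) (rep U)) \<in> cyls 1" using shift_pow_in[OF u] by (simp add: cyls_def)
    have "agree 1 ((shift ^^ n) (rep U)) (rep (Cy 1 ((shift ^^ n) (rep U))))"
      using rep_in[OF c] by (auto simp: Cy_def intro: agree_sym)
    then show a: "v U \<in> pre n (rep (Cy 1 ((shift ^^ n) (rep U))))"
      unfolding v_def using u rep_in_X[OF c] by (intro splice_in_pre) (auto simp: pre_def)
    show "v U \<in> X" using a by (rule pre_in)
    show "agree n (v U) (rep U)" unfolding v_def by (rule agree_splice)
  qed
  have vU: "v U \<in> U" if "U \<in> cyls n" for U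
    using v(2,3)[OF that] cyls_rep[OF that] by (auto simp: Cy_def)
  have inj: "inj_on v (cyls n)"
    using vU cyls_eq by (intro inj_onI) metis
  let ?f = "\<lambda>z. exp (birkhoff \<phi> n z) * E z"
  have fpos: "?f z \<ge> 0" if "z \<in> X" for z using E(2)[OF that] by simp
  have "(\<integral>x. E x \<partial>\<mu>) \<le> (\<integral>x. D * E (v (Cy n x)) \<partial>\<mu>)"
  proof (rule integral_mono_X[OF E(1) det_integrable[OF det_Cy_fun]])
    fix x assume x: "x \<in> X"
    then have U: "Cy n x \<in> cyls n" by (simp add: cyls_def)
    show "E x \<le> D * E (v (Cy n x))"
      using vU[OF U] by (intro D(2) x v(2) U) (auto simp: Cy_def intro: agree_sym)
  qed
  also have "\<dots> = (\<Sum>U\<in>cyls n. measure \<mu> U * (D * E (v (Cy n (rep U)))))"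
    by (rule integral_det[OF det_Cy_fun])
  also have "\<dots> \<le> (\<Sum>U\<in>cyls n. C * D * ?f (v U))"
  proof (rule sum_mono)
    fix U assume U: "U \<in> cyls n"
    have "measure \<mu> U \<le> C * exp (birkhoff \<phi> n (v U))"
      using gibbs_upper[OF v(2)[OF U], of n] cyls_eq[OF U vU[OF U]] by simp
    then have "measure \<mu> U * (D * E (v U)) \<le> C * exp (birkhoff \<phi> n (v U)) * (D * E (v U))"
      using D(1) E(2)[OF v(2)[OF U]] by (intro mult_right_mono) auto
    then show "measure \<mu> U * (D * E (v (Cy n (rep U)))) \<le> C * D * ?f (v U)"
      using cyls_rep[OF U] by (simp add: mult_ac)
  qed
  also have "\<dots> = C * D * (\<Sum>z\<in>v ` cyls n. ?f z)"
    by (simp add: sum.reindex[OF inj] sum_distrib_left)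
  also have "\<dots> \<le> C * D * (\<Sum>z\<in>(\<Union>V\<in>cyls 1. pre n (rep V)). ?f z)"
    using C_pos D(1) v(1,4) fpos pre_in
    by (intro mult_left_mono sum_mono2) (auto simp: finite_cyls finite_pre simp del: One_nat_def)
  also have "(\<Sum>z\<in>(\<Union>V\<in>cyls 1. pre n (rep V)). ?f z) = (\<Sum>V\<in>cyls 1. \<Sum>z\<in>pre n (rep V). ?f z)"
  proof (rule sum.UNION_disjoint)
    show "\<forall>i\<in>cyls 1. \<forall>j\<in>cyls 1. i \<noteq> j \<longrightarrow> pre n (rep i) \<inter> pre n (rep j) = {}"
      using cyls_rep pre_shift by (metis disjoint_iff)
  qed (auto simp: finite_cyls finite_pre)
  also have "C * D * \<dots> \<le> C * D * (\<Sum>V\<in>cyls 1. R)"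
    using C_pos D(1) R rep_in_X by (intro mult_left_mono sum_mono) (simp_all add: tr_pow[symmetric])
  finally show ?thesis by (simp add: mult_ac)
qed

lemma exp_birkhoff_distortion:
  assumes "hol B F" "x \<in> X" "y \<in> X" "agree n x y"
  shows "exp (t * birkhoff F n x) \<le> exp (\<bar>t\<bar> * (B / (1 - \<alpha>))) * exp (t * birkhoff F n y)"
proof -
  have "t * birkhoff F n x - t * birkhoff F n y \<le> \<bar>t\<bar> * \<bar>birkhoff F n x - birkhoff F n y\<bar>"
    by (metis abs_ge_self abs_mult right_diff_distrib)
  also have "\<dots> \<le> \<bar>t\<bar> * (B / (1 - \<alpha>))"
    using birkhoff_variation[OF assms(1-3), of n 0] assms(4) by (intro mult_left_mono) auto
  finally show ?thesis by (simp add: exp_add[symmetric])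
qed

text \<open>Jensen's inequality, by integrating the tangent line of \<open>exp\<close> at the
  mean.\<close>

lemma integral_exp_ge:
  assumes "integrable \<mu> (g :: _ \<Rightarrow> real)" "integrable \<mu> (\<lambda>x. exp (g x))"
  shows "exp (\<integral>x. g x \<partial>\<mu>) \<le> (\<integral>x. exp (g x) \<partial>\<mu>)"
proof -
  define I where "I = (\<integral>x. g x \<partial>\<mu>)"
  have "exp I = (\<integral>x. exp I * (1 + (g x - I)) \<partial>\<mu>)"
    using assms(1) prob_space by (simp add: I_def algebra_simps)
  also have "\<dots> \<le> (\<integral>x. exp (g x) \<partial>\<mu>)"
  proof (rule integral_mono_X)
    fix x assume "x \<in> X"
    have "exp I * (1 + (g x - I)) \<le> exp I * exp (g x - I)"
      by (intro mult_left_mono exp_ge_add_one_self) auto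
    then show "exp I * (1 + (g x - I)) \<le> exp (g x)" by (simp add: exp_add[symmetric])
  qed (use assms in auto)
  finally show ?thesis by (simp add: I_def)
qed

lemma integral_birkhoff:
  assumes "Hol g"
  shows "(\<integral>x. birkhoff g n x \<partial>\<mu>) = real n * (\<integral>x. g x \<partial>\<mu>)"
  unfolding birkhoff_def
  using Hol_integrable[OF Hol_shift_pow[OF assms]] integral_shift[OF Hol_measurable[OF assms]]
  by (subst Bochner_Integration.integral_sum) auto

end

text \<open>The weights of the preimages are now probabilities and \<open>tr \<phi>\<close> is the
  averaging operator \<open>Q\<close>. Stationarity of \<open>\<mu>\<close> is not part of the
  assumption; it is derived in \<open>integral_tr\<close>.\<close>

locale normalized_gibbs = gibbs_subshift +
  assumes normalized: "x \<in> X \<Longrightarrow> tr \<phi> (\<lambda>_. 1) x = 1"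
begin

lemma tr_const: "x \<in> X \<Longrightarrow> tr \<phi> (\<lambda>_. c) x = c"
  using tr_scale[of \<phi> c "\<lambda>_. 1" x] normalized by simp

lemma tr_pow_const: "x \<in> X \<Longrightarrow> (tr \<phi> ^^ n) (\<lambda>_. c) x = c"
proof (induction n arbitrary: x)
  case (Suc n)
  have "(tr \<phi> ^^ Suc n) (\<lambda>_. c) x = tr \<phi> (\<lambda>_. c) x"
    unfolding tr_Suc by (intro tr_cong Suc.IH)
  then show ?case using tr_const[OF Suc.prems] by simp
qed simp

lemma sum_pre_weight: "x \<in> X \<Longrightarrow> (\<Sum>z\<in>pre n x. exp (birkhoff \<phi> n z)) = 1"
  using tr_pow_const[of x n 1] tr_pow[where x = x and \<psi> = \<phi> and n = n and g = "\<lambda>_. 1"] by simp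

lemma tr_pow_le: "x \<in> X \<Longrightarrow> (\<And>z. z \<in> X \<Longrightarrow> g z \<le> c) \<Longrightarrow> (tr \<phi> ^^ n) g x \<le> c"
  using tr_pow_mono[where x = x and g = g and g' = "\<lambda>_. c" and \<psi> = \<phi> and n = n] tr_pow_const by simp

lemma tr_pow_ge: "x \<in> X \<Longrightarrow> (\<And>z. z \<in> X \<Longrightarrow> c \<le> g z) \<Longrightarrow> c \<le> (tr \<phi> ^^ n) g x"
  using tr_pow_mono[where x = x and g = "\<lambda>_. c" and g' = g and \<psi> = \<phi> and n = n] tr_pow_const by simp

lemma tr_pow_abs_diff_le:
  assumes "x \<in> X" "\<And>z. z \<in> X \<Longrightarrow> \<bar>g z - g' z\<bar> \<le> c"
  shows "\<bar>(tr \<phi> ^^ n) g x - (tr \<phi> ^^ n) g' x\<bar> \<le> c"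
proof -
  have "(tr \<phi> ^^ n) (\<lambda>z. g z - g' z) x \<le> c"
  proof (rule tr_pow_le[OF assms(1)])
    show "g z - g' z \<le> c" if "z \<in> X" for z using assms(2)[OF that] by linarith
  qed
  moreover have "- c \<le> (tr \<phi> ^^ n) (\<lambda>z. g z - g' z) x"
  proof (rule tr_pow_ge[OF assms(1)])
    show "- c \<le> g z - g' z" if "z \<in> X" for z using assms(2)[OF that] by linarith
  qed
  ultimately show ?thesis by (simp add: tr_pow_diff[OF assms(1)] abs_le_iff)
qed

section \<open>Contraction of Hoelder functions under the averaging operator\<close>

lemma osc_tr_pow_le: "osc r g \<Longrightarrow> osc r ((tr \<phi> ^^ n) g)"
proof -
  assume r: "osc r g"
  have *: "(tr \<phi> ^^ n) g x \<le> (tr \<phi> ^^ n) g y + r" if "x \<in> X" "y \<in> X" for x y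
  proof (rule tr_pow_le[OF that(1)])
    fix z assume z: "z \<in> X"
    have "g z - r \<le> (tr \<phi> ^^ n) g y"
    proof (rule tr_pow_ge[OF that(2)])
      fix w assume "w \<in> X"
      then show "g z - r \<le> g w" using oscD[OF r z, of w] by (auto simp: abs_le_iff)
    qed
    then show "g z \<le> (tr \<phi> ^^ n) g y + r" by simp
  qed
  show ?thesis unfolding osc_def
  proof (intro ballI)
    fix x y assume "x \<in> X" "y \<in> X"
    then show "\<bar>(tr \<phi> ^^ n) g x - (tr \<phi> ^^ n) g y\<bar> \<le> r" using *[of x y] *[of y x] by (simp add: abs_le_iff)
  qed
qed

text \<open>Comes from \<open>abs_exp_minus_one_le\<close>, applied to differences of Birkhoff sums
  of size at most \<open>D\<phi>\<close>.\<close>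

definition B0 :: real where "B0 = D\<phi> * exp D\<phi>"

lemma B0_nonneg: "B0 \<ge> 0"
  using Dphi_nonneg by (simp add: B0_def)

text \<open>A Doeblin-Fortet (Lasota-Yorke) inequality: the variation of \<open>g\<close> shrinks by
  \<open>\<alpha> ^ n\<close> because preimages are closer, while the variation of the weights costs
  only a multiple of the oscillation.\<close>

lemma lip_tr_pow:
  assumes l: "lip l g" and r: "osc r g"
  shows "lip (l * \<alpha> ^ n + B0 * r) ((tr \<phi> ^^ n) g)"
  unfolding lip_def
proof (intro ballI allI impI)
  fix x y N assume xy: "x \<in> X" "y \<in> X" and N: "1 \<le> N" "agree N x y"
  have N1: "agree 1 x y" using N agree_mono by blast
  \<comment> \<open>Subtracting a constant from \<open>g\<close> is free, since the weights sum to 1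
    over either point; it turns the size of \<open>g\<close> into its oscillation.\<close>
  define c where "c = g y"
  let ?p = "\<lambda>z. exp (birkhoff \<phi> n z)"
  let ?s = "\<lambda>z. splice n z x"
  have sum1: "(\<Sum>z\<in>pre n y. ?p (?s z)) = 1"
    using sum_pre_splice[OF xy N1, where n = n and F = ?p] sum_pre_weight[OF xy(1)] by simp
  have Qx: "(tr \<phi> ^^ n) g x = (\<Sum>z\<in>pre n y. ?p (?s z) * g (?s z))"
    unfolding tr_pow[OF xy(1)] by (rule sum_pre_splice[OF xy N1])
  have "(\<Sum>z\<in>pre n y. ?p (?s z) * (g (?s z) - c) - ?p z * (g z - c))
     = ((tr \<phi> ^^ n) g x - c * 1) - ((tr \<phi> ^^ n) g y - c * 1)"
    unfolding Qx tr_pow[OF xy(2)] sum_subtractf right_diff_distrib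
    by (simp add: sum_distrib_right[symmetric] sum1 sum_pre_weight[OF xy(2)])
  then have "\<bar>(tr \<phi> ^^ n) g x - (tr \<phi> ^^ n) g y\<bar>
     = \<bar>\<Sum>z\<in>pre n y. ?p (?s z) * (g (?s z) - c) - ?p z * (g z - c)\<bar>" by simp
  also have "\<dots> \<le> (\<Sum>z\<in>pre n y. \<bar>?p (?s z) * (g (?s z) - c) - ?p z * (g z - c)\<bar>)" by (rule sum_abs)
  also have "\<dots> \<le> (\<Sum>z\<in>pre n y. ?p (?s z) * (l * \<alpha> ^ n * \<alpha> ^ N) + ?p z * (B0 * \<alpha> ^ N * r))"
  proof (rule sum_mono)
    fix z assume z: "z \<in> pre n y"
    have zX: "?s z \<in> X" "z \<in> X" using pre_in splice_in_pre[OF z xy(1) agree_sym[OF N1]] z by auto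
    have ag: "agree (n + N) (?s z) z" by (rule agree_splice_pre[OF z agree_sym[OF N(2)]])
    define \<delta> where "\<delta> = birkhoff \<phi> n (?s z) - birkhoff \<phi> n z"
    have \<delta>: "\<bar>\<delta>\<bar> \<le> D\<phi> * \<alpha> ^ N" unfolding \<delta>_def by (rule birkhoff_phi_variation[OF zX ag])
    also have "\<dots> \<le> D\<phi>" using Dphi_nonneg alpha by (intro mult_right_le_one_le) (auto simp: power_le_one)
    finally have \<delta>2: "\<bar>\<delta>\<bar> \<le> D\<phi>" .
    have "?p (?s z) - ?p z = ?p z * (exp \<delta> - 1)" by (simp add: \<delta>_def exp_diff field_simps)
    then have "\<bar>?p (?s z) - ?p z\<bar> = ?p z * \<bar>exp \<delta> - 1\<bar>" by (simp add: abs_mult)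
    also have "\<dots> \<le> ?p z * (\<bar>\<delta>\<bar> * exp \<bar>\<delta>\<bar>)" by (intro mult_left_mono abs_exp_minus_one_le) auto
    also have "\<dots> \<le> ?p z * (D\<phi> * \<alpha> ^ N * exp D\<phi>)"
      using \<delta> \<delta>2 Dphi_nonneg alpha by (intro mult_left_mono mult_mono) auto
    finally have p: "\<bar>?p (?s z) - ?p z\<bar> \<le> ?p z * (B0 * \<alpha> ^ N)" by (simp add: B0_def mult_ac)
    have g1: "\<bar>g (?s z) - g z\<bar> \<le> l * \<alpha> ^ n * \<alpha> ^ N"
      using lipD[OF l zX _ ag] N by (simp add: power_add mult_ac)
    have g2: "\<bar>g z - c\<bar> \<le> r" unfolding c_def by (rule oscD[OF r zX(2) xy(2)])
    have eq: "?p (?s z) * (g (?s z) - c) - ?p z * (g z - c)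
       = ?p (?s z) * (g (?s z) - g z) + (?p (?s z) - ?p z) * (g z - c)" by (simp add: algebra_simps)
    have "\<bar>?p (?s z) * (g (?s z) - c) - ?p z * (g z - c)\<bar> \<le> ?p (?s z) * \<bar>g (?s z) - g z\<bar> + \<bar>?p (?s z) - ?p z\<bar> * \<bar>g z - c\<bar>"
      unfolding eq using abs_triangle_ineq[of "?p (?s z) * (g (?s z) - g z)" "(?p (?s z) - ?p z) * (g z - c)"]
      by (simp only: abs_mult abs_exp_cancel)
    also have "\<dots> \<le> ?p (?s z) * (l * \<alpha> ^ n * \<alpha> ^ N) + (?p z * (B0 * \<alpha> ^ N)) * r"
      by (rule add_mono[OF mult_left_mono[OF g1] mult_mono[OF p g2]]) (use B0_nonneg alpha in auto)
    finally show "\<bar>?p (?s z) * (g (?s z) - c) - ?p z * (g z - c)\<bar>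
       \<le> ?p (?s z) * (l * \<alpha> ^ n * \<alpha> ^ N) + ?p z * (B0 * \<alpha> ^ N * r)" by (simp add: mult_ac)
  qed
  also have "\<dots> = (l * \<alpha> ^ n + B0 * r) * \<alpha> ^ N"
    unfolding sum.distrib sum_distrib_right[symmetric] sum1 sum_pre_weight[OF xy(2)] by (simp add: algebra_simps)
  finally show "\<bar>(tr \<phi> ^^ n) g x - (tr \<phi> ^^ n) g y\<bar> \<le> (l * \<alpha> ^ n + B0 * r) * \<alpha> ^ N" .
qed

text \<open>Doeblin's argument: the weights of the cylinders of length n under the iterated kernel dominate
  a fixed multiple of \<open>\<mu>\<close>, uniformly in the base point.\<close>

lemma osc_tr_pow:
  assumes l: "lip l g" and r: "osc r g" and n: "n \<ge> 1"
  shows "osc ((1 - gap) * r + 2 * (l * \<alpha> ^ n)) ((tr \<phi> ^^ (n + G)) g)"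
  unfolding osc_def
proof (intro ballI)
  fix x y assume xy: "x \<in> X" "y \<in> X"
  let ?Q = "tr \<phi> ^^ (n + G)"
  \<comment> \<open>Replacing \<open>g\<close> by a function constant on \<open>n\<close>-cylinders
    costs \<open>l * \<alpha> ^ n\<close> at each of the two points.\<close>
  define gh where "gh z = g (rep (Cy n z))" for z
  have gh_det: "det n gh" unfolding gh_def by (rule det_Cy_fun)
  have approx: "\<bar>g z - gh z\<bar> \<le> l * \<alpha> ^ n" if "z \<in> X" for z
  proof -
    have U: "Cy n z \<in> cyls n" using that by (simp add: cyls_def)
    show ?thesis unfolding gh_def using rep_in[OF U] rep_in_X[OF U]
      by (intro lipD[OF l that _ n]) (auto simp: Cy_def intro: agree_sym)
  qed
  have fin: "finite (cyls n)" "cyls n \<noteq> {}" using finite_cyls X_nonempty by (auto simp: cyls_def)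
  define m where "m = Min ((\<lambda>U. gh (rep U)) ` cyls n)"
  have m_in: "m \<in> (\<lambda>U. gh (rep U)) ` cyls n" unfolding m_def using fin by (intro Min_in) auto
  have mb: "m \<le> gh (rep U)" "gh (rep U) \<le> m + r" if U: "U \<in> cyls n" for U
  proof -
    show "m \<le> gh (rep U)" unfolding m_def using fin U by (intro Min_le) auto
    obtain V where V: "V \<in> cyls n" "m = gh (rep V)" using m_in by auto
    have "Cy n (rep U) \<in> cyls n" "Cy n (rep V) \<in> cyls n" using U V rep_in_X by (auto simp: cyls_def)
    then show "gh (rep U) \<le> m + r"
      unfolding V(2) gh_def using oscD[OF r rep_in_X rep_in_X] by (fastforce simp: abs_le_iff)
  qed
  have one: "(\<Sum>U\<in>cyls n. ?Q (indicator U) z) = 1" if "z \<in> X" for z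
    using tr_det[OF that, of n "\<lambda>_. 1" "n + G"] tr_pow_const[OF that] by (simp add: det_def)
  \<comment> \<open>The part \<open>gap * measure \<mu> U\<close> of the weights is the same for
    every \<open>z\<close> and cancels in differences; the remaining nonnegative weights have mass
    \<open>1 - gap\<close>. Subtracting the minimum \<open>m\<close> keeps the second factor between
    0 and \<open>r\<close>.\<close>
  define S where "S z = (\<Sum>U\<in>cyls n. (?Q (indicator U) z - gap * measure \<mu> U) * (gh (rep U) - m))" for z
  have S: "0 \<le> S z" "S z \<le> (1 - gap) * r" if z: "z \<in> X" for z
  proof -
    have k: "?Q (indicator U) z - gap * measure \<mu> U \<ge> 0" if "U \<in> cyls n" for U
      using doeblin[OF z] that by (auto simp: cyls_def)
    show "0 \<le> S z" unfolding S_def using k mb by (intro sum_nonneg mult_nonneg_nonneg) auto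
    have "S z \<le> (\<Sum>U\<in>cyls n. (?Q (indicator U) z - gap * measure \<mu> U) * r)"
      unfolding S_def using k mb by (intro sum_mono mult_left_mono) (auto simp: algebra_simps)
    also have "\<dots> = (1 - gap) * r"
      unfolding sum_distrib_right[symmetric] sum_subtractf one[OF z] sum_distrib_left[symmetric] sum_measure_cyls by simp
    finally show "S z \<le> (1 - gap) * r" .
  qed
  define c where "c = (\<Sum>U\<in>cyls n. gap * measure \<mu> U * (gh (rep U) - m)) + m"
  have Qgh: "?Q gh z = S z + c" if z: "z \<in> X" for z
  proof -
    have "S z = ?Q gh z - m - (\<Sum>U\<in>cyls n. gap * measure \<mu> U * (gh (rep U) - m))"
      unfolding S_def left_diff_distrib sum_subtractf
      by (simp add: right_diff_distrib sum_subtractf tr_det[OF z gh_det] sum_distrib_right[symmetric] one[OF z])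
    then show ?thesis by (simp add: c_def)
  qed
  have "\<bar>?Q gh x - ?Q gh y\<bar> \<le> (1 - gap) * r"
    using S[OF xy(1)] S[OF xy(2)] Qgh xy by (simp add: abs_le_iff)
  moreover have "\<bar>?Q g x - ?Q gh x\<bar> \<le> l * \<alpha> ^ n" "\<bar>?Q g y - ?Q gh y\<bar> \<le> l * \<alpha> ^ n"
    using approx by (intro tr_pow_abs_diff_le xy; simp)+
  ultimately show "\<bar>?Q g x - ?Q g y\<bar> \<le> (1 - gap) * r + 2 * (l * \<alpha> ^ n)" by linarith
qed

lemma Hol_tr: assumes "Hol g" shows "Hol (tr \<phi> g)"
proof -
  obtain B where B: "hol B g" using assms by (auto simp: Hol_def)
  have "lip (B * \<alpha> ^ 1 + B0 * B) ((tr \<phi> ^^ 1) g)" by (rule lip_tr_pow[OF hol_lip[OF B] hol_imp_osc[OF B]])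
  moreover have "osc B ((tr \<phi> ^^ 1) g)" by (rule osc_tr_pow_le[OF hol_imp_osc[OF B]])
  ultimately have "hol (max (B * \<alpha> ^ 1 + B0 * B) B) ((tr \<phi> ^^ 1) g)" by (rule hol_of_lip_osc) auto
  then show ?thesis by (intro HolI) simp
qed

lemma Hol_tr_pow: "Hol g \<Longrightarrow> Hol ((tr \<phi> ^^ n) g)"
  by (induction n) (auto intro: Hol_tr)

text \<open>The bound for the oscillation loses a multiple of \<open>l\<close>, the bound for the
  seminorm a multiple of \<open>r\<close>. In the weighted norm \<open>r + \<epsilon> * l\<close>
  with small \<open>\<epsilon>\<close>, the loss \<open>B0 * r\<close> is absorbed by the gain
  \<open>gap\<close>, and the loss \<open>2 * l * \<alpha> ^ n\<close> by taking \<open>n\<close>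
  large.\<close>

lemma contraction:
  obtains N \<kappa> c where "N \<ge> 1" "0 < \<kappa>" "\<kappa> < 1" "c \<ge> 0"
    "\<And>g B k. hol B g \<Longrightarrow> osc (c * \<kappa> ^ k * B) ((tr \<phi> ^^ (N * k)) g) \<and> lip (c * \<kappa> ^ k * B) ((tr \<phi> ^^ (N * k)) g)"
proof -
  define \<epsilon> where "\<epsilon> = gap / (2 * (B0 + 1))"
  have \<epsilon>: "\<epsilon> > 0" using gap_pos B0_nonneg by (simp add: \<epsilon>_def)
  have \<epsilon>B: "\<epsilon> * B0 \<le> gap / 2"
    using gap_pos B0_nonneg by (simp add: \<epsilon>_def field_simps)
  have "(\<lambda>n. 2 * \<alpha> ^ n / \<epsilon> + \<alpha> ^ n) \<longlonglongrightarrow> 2 * 0 / \<epsilon> + 0"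
    using alpha \<epsilon> by (intro tendsto_intros LIMSEQ_power_zero) auto
  then have "eventually (\<lambda>n. 2 * \<alpha> ^ n / \<epsilon> + \<alpha> ^ n < 1 / 2) sequentially"
    by (rule order_tendstoD) simp
  then have "eventually (\<lambda>n. n \<ge> 1 \<and> 2 * \<alpha> ^ n / \<epsilon> + \<alpha> ^ n < 1 / 2) sequentially"
    by (intro eventually_conj eventually_ge_at_top)
  then obtain n where n: "n \<ge> 1" "2 * \<alpha> ^ n / \<epsilon> + \<alpha> ^ n < 1 / 2"
    using eventually_happens trivial_limit_sequentially by blast
  define N where "N = n + G"
  define \<kappa> where "\<kappa> = max (1 - gap / 2) (1 / 2)"
  have \<kappa>: "0 < \<kappa>" "\<kappa> < 1" using gap_pos by (auto simp: \<kappa>_def)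
  have step: "osc ((1 - gap) * r + 2 * (l * \<alpha> ^ n)) ((tr \<phi> ^^ N) g)
      \<and> lip (l * \<alpha> ^ N + B0 * r) ((tr \<phi> ^^ N) g)
      \<and> ((1 - gap) * r + 2 * (l * \<alpha> ^ n)) + \<epsilon> * (l * \<alpha> ^ N + B0 * r) \<le> \<kappa> * (r + \<epsilon> * l)"
    if "osc r g" "lip l g" "l \<ge> 0" "r \<ge> 0" for r l g
  proof (intro conjI)
    show "osc ((1 - gap) * r + 2 * (l * \<alpha> ^ n)) ((tr \<phi> ^^ N) g)"
      unfolding N_def by (rule osc_tr_pow) fact+
    show "lip (l * \<alpha> ^ N + B0 * r) ((tr \<phi> ^^ N) g)" by (rule lip_tr_pow) fact+
    have "\<alpha> ^ N \<le> \<alpha> ^ n" unfolding N_def using alpha by (intro power_decreasing) auto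
    then have "\<epsilon> * (l * \<alpha> ^ N) \<le> \<epsilon> * (l * \<alpha> ^ n)" using \<epsilon> that by (intro mult_left_mono) auto
    moreover have "2 * (l * \<alpha> ^ n) + \<epsilon> * (l * \<alpha> ^ n) = (2 * \<alpha> ^ n / \<epsilon> + \<alpha> ^ n) * (\<epsilon> * l)"
      using \<epsilon> by (simp add: field_simps)
    moreover have "(2 * \<alpha> ^ n / \<epsilon> + \<alpha> ^ n) * (\<epsilon> * l) \<le> \<kappa> * (\<epsilon> * l)"
      using n \<epsilon> that by (intro mult_right_mono) (auto simp: \<kappa>_def)
    moreover have "(1 - gap) * r + \<epsilon> * B0 * r \<le> \<kappa> * r"
    proof -
      have "(1 - gap) + \<epsilon> * B0 \<le> \<kappa>" using \<epsilon>B by (simp add: \<kappa>_def)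
      then show ?thesis using mult_right_mono[of "(1 - gap) + \<epsilon> * B0" \<kappa> r] that by (simp add: algebra_simps)
    qed
    ultimately show "((1 - gap) * r + 2 * (l * \<alpha> ^ n)) + \<epsilon> * (l * \<alpha> ^ N + B0 * r) \<le> \<kappa> * (r + \<epsilon> * l)"
      by (simp add: algebra_simps)
  qed
  \<comment> \<open>Passing from \<open>B\<close> to the weighted norm costs
    \<open>1 + \<epsilon>\<close>; recovering \<open>r\<close> and \<open>l\<close> from it costs at
    most \<open>1 + 1 / \<epsilon>\<close>.\<close>
  define c where "c = (1 + \<epsilon>) * (1 + 1 / \<epsilon>)"
  have "osc (c * \<kappa> ^ k * B) ((tr \<phi> ^^ (N * k)) g) \<and> lip (c * \<kappa> ^ k * B) ((tr \<phi> ^^ (N * k)) g)"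
    if g: "hol B g" for g B k
  proof -
    have B: "B \<ge> 0" by (rule hol_nonneg[OF g])
    have "\<exists>r l. osc r ((tr \<phi> ^^ (N * k)) g) \<and> lip l ((tr \<phi> ^^ (N * k)) g) \<and> l \<ge> 0 \<and> r \<ge> 0 \<and> r + \<epsilon> * l \<le> \<kappa> ^ k * ((1 + \<epsilon>) * B)"
    proof (induction k)
      case 0
      show ?case using hol_lip[OF g] hol_imp_osc[OF g] B by (intro exI[of _ B]) (auto simp: algebra_simps)
    next
      case (Suc k)
      then obtain r l where rl: "osc r ((tr \<phi> ^^ (N * k)) g)" "lip l ((tr \<phi> ^^ (N * k)) g)" "l \<ge> 0" "r \<ge> 0"
        "r + \<epsilon> * l \<le> \<kappa> ^ k * ((1 + \<epsilon>) * B)" by blast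
      have eq: "(tr \<phi> ^^ N) ((tr \<phi> ^^ (N * k)) g) = (tr \<phi> ^^ (N * Suc k)) g" by (simp add: tr_pow_pow)
      have "\<kappa> * (r + \<epsilon> * l) \<le> \<kappa> * (\<kappa> ^ k * ((1 + \<epsilon>) * B))" using rl \<kappa> by (intro mult_left_mono) auto
      moreover have "l * \<alpha> ^ N + B0 * r \<ge> 0" using rl alpha B0_nonneg by auto
      ultimately show ?case using step[OF rl(1-4), unfolded eq] osc_nonneg
        by (intro exI[of _ "(1 - gap) * r + 2 * (l * \<alpha> ^ n)"] exI[of _ "l * \<alpha> ^ N + B0 * r"]) (auto simp: mult_ac)
    qed
    then obtain r l where rl: "osc r ((tr \<phi> ^^ (N * k)) g)" "lip l ((tr \<phi> ^^ (N * k)) g)" "l \<ge> 0" "r \<ge> 0"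
        "r + \<epsilon> * l \<le> \<kappa> ^ k * ((1 + \<epsilon>) * B)" by blast
    have pos: "\<kappa> ^ k * ((1 + \<epsilon>) * B) \<ge> 0" using \<kappa> \<epsilon> B by auto
    have c_eq: "c * \<kappa> ^ k * B = \<kappa> ^ k * ((1 + \<epsilon>) * B) + \<kappa> ^ k * ((1 + \<epsilon>) * B) / \<epsilon>"
      using \<epsilon> by (simp add: c_def field_simps)
    have el: "\<epsilon> * l \<ge> 0" using rl \<epsilon> by simp
    have "r \<le> c * \<kappa> ^ k * B"
      unfolding c_eq using rl el pos divide_nonneg_pos[OF pos \<epsilon>] by linarith
    moreover have "l \<le> \<kappa> ^ k * ((1 + \<epsilon>) * B) / \<epsilon>" using rl \<epsilon> by (simp add: pos_le_divide_eq mult.commute)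
    then have "l \<le> c * \<kappa> ^ k * B" unfolding c_eq using pos by linarith
    moreover have "lip (c * \<kappa> ^ k * B) ((tr \<phi> ^^ (N * k)) g)" if "l \<le> c * \<kappa> ^ k * B"
      unfolding lip_def
    proof (intro ballI allI impI)
      fix x y N' assume "x \<in> X" "y \<in> X" "N' \<ge> 1" "agree N' x y"
      then have "\<bar>(tr \<phi> ^^ (N * k)) g x - (tr \<phi> ^^ (N * k)) g y\<bar> \<le> l * \<alpha> ^ N'" by (rule lipD[OF rl(2)])
      also have "\<dots> \<le> c * \<kappa> ^ k * B * \<alpha> ^ N'" using that alpha by (intro mult_right_mono) auto
      finally show "\<bar>(tr \<phi> ^^ (N * k)) g x - (tr \<phi> ^^ (N * k)) g y\<bar> \<le> c * \<kappa> ^ k * B * \<alpha> ^ N'" .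
    qed
    moreover have "osc (c * \<kappa> ^ k * B) ((tr \<phi> ^^ (N * k)) g)" if "r \<le> c * \<kappa> ^ k * B"
      using rl(1) that unfolding osc_def by (meson order_trans)
    ultimately show ?thesis by blast
  qed
  moreover have "N \<ge> 1" using n by (simp add: N_def)
  moreover have "c \<ge> 0" using \<epsilon> by (simp add: c_def)
  ultimately show ?thesis using that \<kappa> by blast
qed

text \<open>The remaining \<open>k mod N\<close> iterations cost only the bounded factor
  \<open>1 + B0\<close>, so the geometric rate along multiples of \<open>N\<close> is summable over
  all \<open>k\<close>.\<close>

lemma tr_pow_decay:
  obtains a where "summable a" "\<And>k. a k \<ge> 0" "\<And>g B k. hol B g \<Longrightarrow> hol (a k * B) ((tr \<phi> ^^ k) g)"
proof -
  obtain N \<kappa> c where N: "N \<ge> 1" "0 < \<kappa>" "\<kappa> < 1" "c \<ge> 0"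
    and con: "\<And>g B k. hol B g \<Longrightarrow> osc (c * \<kappa> ^ k * B) ((tr \<phi> ^^ (N * k)) g) \<and> lip (c * \<kappa> ^ k * B) ((tr \<phi> ^^ (N * k)) g)"
    using contraction by blast
  define a where "a k = (1 + B0) * c * \<kappa> ^ (k div N)" for k
  \<comment> \<open>Turns \<open>\<kappa> ^ (k div N)\<close> into a geometric sequence in
    \<open>k\<close>; the rounding in \<open>k div N\<close> loses one factor
    \<open>\<kappa>\<close>.\<close>
  define \<theta> where "\<theta> = root N \<kappa>"
  have \<theta>: "0 < \<theta>" "\<theta> < 1" "\<theta> ^ N = \<kappa>"
    using N by (auto simp: \<theta>_def)
  have "\<kappa> ^ (k div N) \<le> \<theta> ^ k / \<kappa>" for k
  proof -
    have "\<kappa> ^ (k div N) * \<kappa> = \<theta> ^ (N * (k div N) + N)" by (simp add: power_add power_mult \<theta>(3))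
    also have "\<dots> \<le> \<theta> ^ k"
    proof (rule power_decreasing)
      have "k mod N < N" using N by simp
      then show "k \<le> N * (k div N) + N" using mult_div_mod_eq[of N k] by linarith
    qed (use \<theta> in auto)
    finally show ?thesis using N by (simp add: pos_le_divide_eq)
  qed
  then have "a k \<le> (1 + B0) * c / \<kappa> * \<theta> ^ k" for k
    using mult_left_mono[of "\<kappa> ^ (k div N)" "\<theta> ^ k / \<kappa>" "(1 + B0) * c"] N B0_nonneg by (simp add: a_def)
  moreover have a0: "a k \<ge> 0" for k using N B0_nonneg by (simp add: a_def)
  moreover have "summable (\<lambda>k. (1 + B0) * c / \<kappa> * \<theta> ^ k)"
    using \<theta> by (intro summable_mult summable_geometric) auto
  ultimately have "summable a"
    by (intro summable_comparison_test[of a "\<lambda>k. (1 + B0) * c / \<kappa> * \<theta> ^ k"]) auto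
  moreover have "hol (a k * B) ((tr \<phi> ^^ k) g)" if g: "hol B g" for g B k
  proof -
    define r where "r = c * \<kappa> ^ (k div N) * B"
    have B: "B \<ge> 0" by (rule hol_nonneg[OF g])
    have r0: "r \<ge> 0" using N B by (simp add: r_def)
    have ol: "osc r ((tr \<phi> ^^ (N * (k div N))) g)" "lip r ((tr \<phi> ^^ (N * (k div N))) g)"
      using con[OF g, of "k div N"] by (auto simp: r_def)
    have eq: "(tr \<phi> ^^ (k mod N)) ((tr \<phi> ^^ (N * (k div N))) g) = (tr \<phi> ^^ k) g"
      by (simp add: tr_pow_pow)
    have l1: "r * \<alpha> ^ (k mod N) + B0 * r \<le> a k * B"
    proof -
      have "r * \<alpha> ^ (k mod N) \<le> r * 1" using r0 alpha by (intro mult_left_mono) (auto simp: power_le_one)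
      then show ?thesis by (simp add: a_def r_def algebra_simps)
    qed
    have "1 * r \<le> (1 + B0) * r" using r0 B0_nonneg by (intro mult_right_mono) auto
    then have l2: "r \<le> a k * B" by (simp add: a_def r_def mult_ac)
    show ?thesis
      using lip_tr_pow[OF ol(2,1), of "k mod N"] osc_tr_pow_le[OF ol(1), of "k mod N"] l1 l2
      unfolding eq by (rule hol_of_lip_osc)
  qed
  ultimately show ?thesis using that a0 by blast
qed

text \<open>For \<open>F = g - (Q g) \<circ> shift\<close> one has \<open>Q F = 0\<close>, so the exponential moments of the Birkhoff sums of
  \<open>t F\<close> grow at most like \<open>exp (O(t^2) n)\<close>; by Jensen this forces the mean of \<open>F\<close> to vanish.\<close>

lemma martingale_mean_le:
  assumes F: "Hol F" and QF: "\<And>x. x \<in> X \<Longrightarrow> tr \<phi> F x = 0"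
  shows "(\<integral>x. F x \<partial>\<mu>) = 0"
proof -
  obtain B where B: "hol B F" using F by (auto simp: Hol_def)
  obtain R where R: "R > 0" "\<And>x. x \<in> X \<Longrightarrow> \<bar>F x\<bar> \<le> R" by (rule Hol_bounded[OF F]) (rule that)
  define I where "I = (\<integral>x. F x \<partial>\<mu>)"
  \<comment> \<open>The linear term of \<open>exp (t * F)\<close> disappears under the operator, so
    the growth rate of the moments is quadratic in \<open>t\<close>, whereas Jensen makes it at
    least \<open>t * I\<close>. Both signs of \<open>t\<close> are used afterwards.\<close>
  have key: "t * I \<le> 3 * (t * R)\<^sup>2" if t: "\<bar>t\<bar> * R \<le> 1" for t
  proof -
    define c where "c = 3 * (t * R)\<^sup>2"
    define D where "D = exp (\<bar>t\<bar> * (B / (1 - \<alpha>)))"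
    define P where "P = C * D * real (card (cyls 1))"
    have one: "tr (\<lambda>z. \<phi> z + t * F z) (\<lambda>_. 1) x \<le> exp c * 1" if x: "x \<in> X" for x
    proof -
      have "tr (\<lambda>z. \<phi> z + t * F z) (\<lambda>_. 1) x = tr \<phi> (\<lambda>z. exp (t * F z) * 1) x"
        by (rule tr_weight[symmetric])
      also have "\<dots> \<le> tr \<phi> (\<lambda>z. (1 + c) + t * F z) x"
      proof (rule tr_mono)
        fix z assume z: "z \<in> X"
        have s: "\<bar>t * F z\<bar> \<le> \<bar>t * R\<bar>" unfolding abs_mult using R z by (intro mult_left_mono) auto
        then have s1: "\<bar>t * F z\<bar> \<le> 1" using t R by (simp add: abs_mult)
        have "\<bar>t * F z\<bar> ^ 3 \<le> \<bar>t * F z\<bar> ^ 2" using s1 by (intro power_decreasing) auto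
        then have "exp (t * F z) \<le> 1 + t * F z + 3 * (t * F z)\<^sup>2"
          using exp_le_quadratic(1)[OF s1] zero_le_power2[of "t * F z"] unfolding power2_abs by linarith
        moreover have "(t * F z)\<^sup>2 \<le> (t * R)\<^sup>2" using s abs_le_square_iff by blast
        ultimately show "exp (t * F z) * 1 \<le> (1 + c) + t * F z" by (simp add: c_def)
      qed
      also have "\<dots> = 1 + c" using QF[OF x] tr_const[OF x] by (simp add: tr_add tr_scale)
      also have "\<dots> \<le> exp c * 1" using exp_ge_add_one_self[of c] by simp
      finally show ?thesis .
    qed
    have bound: "real n * (t * I) \<le> ln P + real n * c" for n
    proof -
      let ?E = "\<lambda>x. exp (t * birkhoff F n x)"
      have HE: "Hol ?E" by (intro Hol_exp Hol_scale Hol_birkhoff F)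
      have "exp (\<integral>x. t * birkhoff F n x \<partial>\<mu>) \<le> (\<integral>x. ?E x \<partial>\<mu>)"
        by (intro integral_exp_ge Hol_integrable HE Hol_scale Hol_birkhoff F)
      also have "\<dots> \<le> C * D * real (card (cyls 1)) * exp c ^ n"
      proof (rule integral_le_tr_pow[OF Hol_integrable[OF HE], of D n])
        show "?E x \<le> D * ?E y" if "x \<in> X" "y \<in> X" "agree n x y" for x y
          unfolding D_def by (rule exp_birkhoff_distortion[OF B that])
        show "(tr \<phi> ^^ n) ?E x \<le> exp c ^ n" if x: "x \<in> X" for x
        proof -
          have "(tr \<phi> ^^ n) ?E x = (tr \<phi> ^^ n) (\<lambda>z. exp (birkhoff (\<lambda>x. t * F x) n z) * 1) x"
            by (simp add: birkhoff_scale)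
          also have "\<dots> = (tr (\<lambda>z. \<phi> z + t * F z) ^^ n) (\<lambda>_. 1) x" by (rule tr_pow_weight[OF x])
          also have "\<dots> \<le> exp c ^ n * 1" by (rule tr_pow_eigen_upper[OF one _ x]) auto
          finally show ?thesis by simp
        qed
      qed (auto simp: D_def)
      finally have e: "exp (\<integral>x. t * birkhoff F n x \<partial>\<mu>) \<le> P * exp (real n * c)"
        by (simp add: P_def exp_of_nat_mult)
      then have "0 < P * exp (real n * c)" using less_le_trans[OF exp_gt_zero] by blast
      then have P0: "P > 0" by (simp add: zero_less_mult_iff)
      have "(\<integral>x. t * birkhoff F n x \<partial>\<mu>) \<le> ln (P * exp (real n * c))"
        using e P0 by (simp add: ln_ge_iff)
      then show ?thesis using P0 integral_birkhoff[OF F, of n] by (simp add: ln_mult I_def mult_ac)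
    qed
    show ?thesis using linear_bound_imp_le[OF bound] by (simp add: c_def)
  qed
  have small: "\<bar>I\<bar> \<le> 3 * t * R\<^sup>2" if t: "0 < t" "t * R \<le> 1" for t
  proof -
    have "t * I \<le> t * (3 * t * R\<^sup>2)" using key[of t] t by (simp add: power_mult_distrib power2_eq_square mult_ac)
    moreover have "t * (- I) \<le> t * (3 * t * R\<^sup>2)" using key[of "- t"] t by (simp add: power_mult_distrib power2_eq_square mult_ac)
    ultimately show ?thesis using t(1) by (simp only: mult_le_cancel_left_pos abs_le_iff)
  qed
  show ?thesis
  proof (rule ccontr)
    assume "(\<integral>x. F x \<partial>\<mu>) \<noteq> 0"
    then have I: "\<bar>I\<bar> > 0" by (simp add: I_def)
    \<comment> \<open>Small enough for the expansion, and for the quadratic bound to fall below half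
      of \<open>\<bar>I\<bar>\<close>.\<close>
    define t where "t = min (1 / R) (\<bar>I\<bar> / (6 * R\<^sup>2))"
    have t: "0 < t" "t * R \<le> 1" using I R by (auto simp: t_def min_def field_simps)
    have "3 * t * R\<^sup>2 \<le> \<bar>I\<bar> / 2"
      using R mult_right_mono[of t "\<bar>I\<bar> / (6 * R\<^sup>2)" "3 * R\<^sup>2"] by (simp add: t_def)
    then show False using small[OF t] I by linarith
  qed
qed

text \<open>By \<open>tr_shift\<close> the operator annihilates \<open>?F\<close>, so
  \<open>martingale_mean_le\<close> applies to it; shift invariance then removes the shift from the
  second integral.\<close>

lemma integral_tr: assumes g: "Hol g" shows "(\<integral>x. tr \<phi> g x \<partial>\<mu>) = (\<integral>x. g x \<partial>\<mu>)"
proof -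
  let ?F = "\<lambda>x. g x - tr \<phi> g (shift x)"
  have Qg: "Hol (tr \<phi> g)" by (rule Hol_tr[OF g])
  have "(\<integral>x. ?F x \<partial>\<mu>) = 0"
  proof (rule martingale_mean_le)
    show "Hol ?F" by (intro Hol_diff g Hol_shift[OF Qg])
    fix x assume x: "x \<in> X"
    have "tr \<phi> (\<lambda>z. tr \<phi> g (shift z) * 1) x = tr \<phi> g x * tr \<phi> (\<lambda>_. 1) x" by (rule tr_shift)
    then show "tr \<phi> ?F x = 0" using normalized[OF x] by (simp add: tr_diff)
  qed
  moreover have "(\<integral>x. tr \<phi> g (shift x) \<partial>\<mu>) = (\<integral>x. tr \<phi> g x \<partial>\<mu>)"
    using integral_shift[OF Hol_measurable[OF Qg], of 1] by simp
  ultimately show ?thesis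
    using Hol_integrable[OF g] Hol_integrable[OF Hol_shift[OF Qg]] by simp
qed

lemma integral_tr_pow: "Hol g \<Longrightarrow> (\<integral>x. (tr \<phi> ^^ n) g x \<partial>\<mu>) = (\<integral>x. g x \<partial>\<mu>)"
proof (induction n)
  case (Suc n)
  have "(\<integral>x. (tr \<phi> ^^ Suc n) g x \<partial>\<mu>) = (\<integral>x. tr \<phi> ((tr \<phi> ^^ n) g) x \<partial>\<mu>)" by simp
  also have "\<dots> = (\<integral>x. (tr \<phi> ^^ n) g x \<partial>\<mu>)" by (rule integral_tr[OF Hol_tr_pow[OF Suc.prems]])
  finally show ?case using Suc by simp
qed simp

text \<open>The solution is the Neumann series of iterates of \<open>F\<close>. Stationarity keeps
  their means zero, hence their values are bounded by their oscillations, which are summable by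
  \<open>tr_pow_decay\<close>.\<close>

lemma poisson_equation:
  assumes F: "Hol F" and I: "(\<integral>x. F x \<partial>\<mu>) = 0"
  obtains u where "Hol u" "\<And>x. x \<in> X \<Longrightarrow> u x - tr \<phi> u x = F x"
proof -
  obtain B where B: "hol B F" using F by (auto simp: Hol_def)
  obtain a where a: "summable a" "\<And>k. a k \<ge> 0" "\<And>g B k. hol B g \<Longrightarrow> hol (a k * B) ((tr \<phi> ^^ k) g)"
    using tr_pow_decay by blast
  have aB: "summable (\<lambda>k. a k * B)" by (rule summable_mult2[OF a(1)])
  have bnd: "\<bar>(tr \<phi> ^^ k) F x\<bar> \<le> a k * B" if x: "x \<in> X" for x k
  proof -
    let ?g = "(tr \<phi> ^^ k) F"
    have g: "hol (a k * B) ?g" by (rule a(3)[OF B])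
    have int: "integrable \<mu> ?g" by (rule Hol_integrable[OF HolI[OF g]])
    have "\<bar>?g x - (\<integral>y. ?g y \<partial>\<mu>)\<bar> = \<bar>\<integral>y. ?g x - ?g y \<partial>\<mu>\<bar>"
      using int prob_space by simp
    also have "\<dots> \<le> (\<integral>y. \<bar>?g x - ?g y\<bar> \<partial>\<mu>)" by (rule integral_abs_bound)
    also have "\<dots> \<le> (\<integral>y. a k * B \<partial>\<mu>)"
      using int hol_osc[OF g x] by (intro integral_mono_X) auto
    finally show ?thesis using integral_tr_pow[OF F] I prob_space by simp
  qed
  have summ: "summable (\<lambda>k. (tr \<phi> ^^ k) F x)" if "x \<in> X" for x
    using bnd[OF that] by (intro summable_comparison_test[OF _ aB]) auto
  define u where "u x = (\<Sum>k. (tr \<phi> ^^ k) F x)" for x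
  have "hol (\<Sum>k. a k * B) u"
  proof (rule holI)
    fix x y n assume xy: "x \<in> X" "y \<in> X" "agree n x y"
    have le: "\<bar>(tr \<phi> ^^ k) F x - (tr \<phi> ^^ k) F y\<bar> \<le> a k * B * \<alpha> ^ n" for k
      by (rule holD[OF a(3)[OF B] xy])
    have sm: "summable (\<lambda>k. a k * B * \<alpha> ^ n)" by (rule summable_mult2[OF aB])
    have sabs: "summable (\<lambda>k. \<bar>(tr \<phi> ^^ k) F x - (tr \<phi> ^^ k) F y\<bar>)"
      using le by (intro summable_comparison_test[OF _ sm]) auto
    have "\<bar>u x - u y\<bar> = \<bar>\<Sum>k. (tr \<phi> ^^ k) F x - (tr \<phi> ^^ k) F y\<bar>"
      unfolding u_def by (simp add: suminf_diff[OF summ[OF xy(1)] summ[OF xy(2)]])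
    also have "\<dots> \<le> (\<Sum>k. \<bar>(tr \<phi> ^^ k) F x - (tr \<phi> ^^ k) F y\<bar>)" by (rule summable_rabs[OF sabs])
    also have "\<dots> \<le> (\<Sum>k. a k * B * \<alpha> ^ n)" by (rule suminf_le[OF le sabs sm])
    also have "\<dots> = (\<Sum>k. a k * B) * \<alpha> ^ n" by (rule suminf_mult2[OF aB, symmetric])
    finally show "\<bar>u x - u y\<bar> \<le> (\<Sum>k. a k * B) * \<alpha> ^ n" .
  qed
  then have "Hol u" by (rule HolI)
  moreover have "u x - tr \<phi> u x = F x" if x: "x \<in> X" for x
  proof -
    define s where "s n x = (\<Sum>k<n. (tr \<phi> ^^ k) F x)" for n x
    have su: "(\<lambda>n. s n x) \<longlonglongrightarrow> u x" if "x \<in> X" for x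
      unfolding s_def u_def by (rule summable_LIMSEQ[OF summ[OF that]])
    have "tr \<phi> (s n) x = s (Suc n) x - F x" for n
    proof -
      have "tr \<phi> (s n) x = (tr \<phi> ^^ 1) (\<lambda>x. \<Sum>k<n. (tr \<phi> ^^ k) F x) x" by (simp add: s_def[abs_def])
      also have "\<dots> = (\<Sum>k<n. (tr \<phi> ^^ 1) ((tr \<phi> ^^ k) F) x)" by (rule tr_pow_sum[OF x])
      also have "\<dots> = (\<Sum>k<n. (tr \<phi> ^^ Suc k) F x)" by simp
      finally show ?thesis unfolding s_def sum.lessThan_Suc_shift by simp
    qed
    then have "(\<lambda>n. s (Suc n) x - F x) \<longlonglongrightarrow> tr \<phi> u x" using tr_LIMSEQ[where s = s and g = u and \<psi> = \<phi> and x = x, OF su] by simp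
    moreover have "(\<lambda>n. s (Suc n) x - F x) \<longlonglongrightarrow> u x - F x"
      by (intro tendsto_diff LIMSEQ_Suc[OF su[OF x]] tendsto_const)
    ultimately show ?thesis using LIMSEQ_unique by fastforce
  qed
  ultimately show ?thesis using that by blast
qed

section \<open>Exponential moments and variance\<close>

lemma Hol_power2: "Hol g \<Longrightarrow> Hol (\<lambda>x. (g x)\<^sup>2)"
  unfolding power2_eq_square by (rule Hol_mult)

text \<open>The function \<open>1 + t\<^sup>2 w\<close> is an approximate eigenfunction, with eigenvalue \<open>1 + \<rho> t\<^sup>2 / 2 + O(t\<^sup>3)\<close>, of
  the transfer operator tilted by \<open>t m\<close>.\<close>

lemma martingale_exp_moments:
  assumes m: "Hol m" and Qm: "\<And>x. x \<in> X \<Longrightarrow> tr \<phi> m x = 0"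
  defines "\<rho> \<equiv> (\<integral>x. (m x)\<^sup>2 \<partial>\<mu>)"
  obtains t0 c where "t0 > 0" "t0 \<le> 1" "c \<ge> 0"
    "\<And>t n. \<bar>t\<bar> \<le> t0 \<Longrightarrow> (\<integral>x. exp (t * birkhoff m n x) \<partial>\<mu>) \<le> 4 * exp (real n * (\<rho> * t\<^sup>2 / 2 + c * \<bar>t\<bar> ^ 3))"
    "\<And>t n. \<bar>t\<bar> \<le> t0 \<Longrightarrow> exp (real n * (\<rho> * t\<^sup>2 / 2 - c * \<bar>t\<bar> ^ 3)) / 4 \<le> (\<integral>x. exp (t * birkhoff m n x) \<partial>\<mu>)"
proof -
  have m2: "Hol (\<lambda>x. (m x)\<^sup>2)" by (rule Hol_power2[OF m])
  have Qm2: "Hol (tr \<phi> (\<lambda>x. (m x)\<^sup>2))" by (rule Hol_tr[OF m2])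
  have \<rho>0: "\<rho> \<ge> 0" by (simp add: \<rho>_def)
  \<comment> \<open>Mean zero by stationarity. The solution \<open>w\<close> corrects the
    second-order coefficient: the operator maps \<open>m\<^sup>2 / 2 + w\<close> to
    \<open>w + \<rho> / 2\<close>, so the eigenvalue equation holds up to third order with a
    constant eigenvalue.\<close>
  have "Hol (\<lambda>x. (1/2) * (tr \<phi> (\<lambda>x. (m x)\<^sup>2) x - \<rho>))" by (intro Hol_scale Hol_diff Qm2 Hol_const)
  moreover have "(\<integral>x. (1/2) * (tr \<phi> (\<lambda>x. (m x)\<^sup>2) x - \<rho>) \<partial>\<mu>) = 0"
    using integral_tr[OF m2] Hol_integrable[OF Qm2] prob_space by (simp add: \<rho>_def)
  ultimately obtain w where w: "Hol w" "\<And>x. x \<in> X \<Longrightarrow> w x - tr \<phi> w x = (1/2) * (tr \<phi> (\<lambda>x. (m x)\<^sup>2) x - \<rho>)"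
    using poisson_equation by blast
  obtain R where R: "R > 0" "\<And>x. x \<in> X \<Longrightarrow> \<bar>m x\<bar> \<le> R" by (rule Hol_bounded[OF m]) (rule that)
  obtain W where W: "W > 0" "\<And>x. x \<in> X \<Longrightarrow> \<bar>w x\<bar> \<le> W" by (rule Hol_bounded[OF w(1)]) (rule that)
  \<comment> \<open>\<open>c1\<close> bounds the cubic remainder of
    \<open>exp (t * m) * (1 + t\<^sup>2 * w)\<close>. The factor 2 in \<open>c2\<close> comes from
    \<open>g \<ge> 1 / 2\<close>, and the summand 1 in \<open>c\<close> absorbs the square in
    \<open>exp y' \<le> 1 + y' + y'\<^sup>2\<close>.\<close>
  define c1 where "c1 = 2 * R ^ 3 + 3 * R * W"
  define c2 where "c2 = 2 * c1 + \<rho> * W"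
  define c where "c = c2 + 1"
  define d where "d = (\<rho> / 2 + c)\<^sup>2"
  have c1: "c1 \<ge> 0" using R W by (simp add: c1_def)
  have c2: "c2 \<ge> 0" using c1 \<rho>0 W by (simp add: c2_def)
  have cpos: "c \<ge> 1" using c2 by (simp add: c_def)
  have d1: "\<rho> / 2 + c \<ge> 1" "d \<ge> 1" using cpos \<rho>0 by (auto simp: d_def)
  have d_ge: "\<rho> / 2 + c \<le> d" using d1(1) by (simp add: d_def power2_eq_square)
  \<comment> \<open>The three bounds ensure that \<open>t * m\<close> is at most 1 in absolute
    value, \<open>t\<^sup>2 * w\<close> at most \<open>1 / 2\<close>, and
    \<open>d * (t\<^sup>2 * t\<^sup>2)\<close> at most \<open>\<bar>t\<bar> ^ 3\<close>.\<close>
  define t0 where "t0 = min (1 / R) (min (1 / (2 * W)) (1 / d))"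
  have t0: "t0 > 0" using R W d1 by (simp add: t0_def)
  have t0': "t0 \<le> 1 / R" "t0 \<le> 1 / (2 * W)" "t0 \<le> 1 / d" by (auto simp: t0_def)
  have t0_1: "t0 \<le> 1" using t0'(3) d1(2) by (simp add: order_trans[of t0 "1 / d" 1])
  define g where "g t x = 1 + t\<^sup>2 * w x" for t x
  define y where "y t = \<rho> * t\<^sup>2 / 2 + c * \<bar>t\<bar> ^ 3" for t
  define y' where "y' t = \<rho> * t\<^sup>2 / 2 - c * \<bar>t\<bar> ^ 3" for t
  have main: "1 / 2 \<le> g t x \<and> g t x \<le> 2
      \<and> tr (\<lambda>z. \<phi> z + t * m z) (g t) x \<le> exp (y t) * g t x
      \<and> exp (y' t) * g t x \<le> tr (\<lambda>z. \<phi> z + t * m z) (g t) x"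
    if t: "\<bar>t\<bar> \<le> t0" and x: "x \<in> X" for t x
  proof -
    have tt: "\<bar>t\<bar> * R \<le> 1" "\<bar>t\<bar> * (2 * W) \<le> 1" "\<bar>t\<bar> * d \<le> 1" "\<bar>t\<bar> \<le> 1"
      using t t0' R W d1 t0_1 by (simp_all add: pos_le_divide_eq[symmetric] order_trans[OF t])
    have t32: "\<bar>t\<bar> ^ 3 \<le> t\<^sup>2" using power_decreasing[of 2 3 "\<bar>t\<bar>"] tt(4) by simp
    have t21: "t\<^sup>2 \<le> \<bar>t\<bar>" using power_decreasing[of 1 2 "\<bar>t\<bar>"] tt(4) by simp
    have t43: "t\<^sup>2 * t\<^sup>2 \<le> \<bar>t\<bar> ^ 3"
    proof -
      have "t\<^sup>2 * t\<^sup>2 = \<bar>t\<bar> ^ 4" by (simp flip: power_add power_abs)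
      also have "\<dots> \<le> \<bar>t\<bar> ^ 3" using tt(4) by (intro power_decreasing) auto
      finally show ?thesis .
    qed
    have tw: "\<bar>t\<^sup>2 * w z\<bar> \<le> 1 / 2" if "z \<in> X" for z
    proof -
      have "\<bar>t\<^sup>2 * w z\<bar> \<le> \<bar>t\<bar> * W"
        unfolding abs_mult using t21 W that by (intro mult_mono) auto
      then show ?thesis using tt(2) by linarith
    qed
    have g12: "1 / 2 \<le> g t z" "g t z \<le> 2" if "z \<in> X" for z
      using tw[OF that] by (auto simp: g_def abs_le_iff)
    have E: "\<bar>exp (t * m z) * g t z - (1 + t * m z + t\<^sup>2 * ((m z)\<^sup>2 / 2 + w z))\<bar> \<le> c1 * \<bar>t\<bar> ^ 3" if z: "z \<in> X" for z
    proof -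
      let ?s = "t * m z"
      have s: "\<bar>?s\<bar> \<le> \<bar>t\<bar> * R" unfolding abs_mult using R z by (intro mult_left_mono) auto
      then have s1: "\<bar>?s\<bar> \<le> 1" using tt by linarith
      have "\<bar>exp ?s - (1 + ?s + ?s\<^sup>2 / 2)\<bar> \<le> 2 * \<bar>?s\<bar> ^ 3"
        using exp_le_quadratic[OF s1] by (simp add: abs_le_iff)
      also have "\<dots> \<le> 2 * (\<bar>t\<bar> * R) ^ 3" using s by (intro mult_left_mono power_mono) auto
      finally have a: "\<bar>exp ?s - (1 + ?s + ?s\<^sup>2 / 2)\<bar> \<le> 2 * R ^ 3 * \<bar>t\<bar> ^ 3" by (simp add: power_mult_distrib mult_ac)
      have "\<bar>exp ?s - 1\<bar> \<le> \<bar>?s\<bar> * exp \<bar>?s\<bar>" by (rule abs_exp_minus_one_le)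
      also have "\<dots> \<le> (\<bar>t\<bar> * R) * 3"
      proof (rule mult_mono)
        have "exp \<bar>?s\<bar> \<le> exp 1" using s1 by simp
        then show "exp \<bar>?s\<bar> \<le> 3" using exp_le by linarith
      qed (use s R in auto)
      finally have "\<bar>(exp ?s - 1) * (t\<^sup>2 * w z)\<bar> \<le> ((\<bar>t\<bar> * R) * 3) * (t\<^sup>2 * W)"
        unfolding abs_mult using W z R by (intro mult_mono) auto
      also have "\<dots> = 3 * R * W * \<bar>t\<bar> ^ 3"
        by (simp add: power3_eq_cube power2_eq_square)
      finally have b: "\<bar>(exp ?s - 1) * (t\<^sup>2 * w z)\<bar> \<le> 3 * R * W * \<bar>t\<bar> ^ 3" .
      have "exp ?s * g t z - (1 + t * m z + t\<^sup>2 * ((m z)\<^sup>2 / 2 + w z))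
         = (exp ?s - (1 + ?s + ?s\<^sup>2 / 2)) + (exp ?s - 1) * (t\<^sup>2 * w z)"
        by (simp add: g_def algebra_simps power_mult_distrib)
      then show ?thesis using a b unfolding c1_def by (simp add: algebra_simps)
    qed
    let ?T = "tr (\<lambda>z. \<phi> z + t * m z) (g t) x"
    let ?P = "\<lambda>z. 1 + t * m z + t\<^sup>2 * ((m z)\<^sup>2 / 2 + w z)"
    have "?T = (tr \<phi> ^^ 1) (\<lambda>z. exp (t * m z) * g t z) x" by (simp add: tr_weight)
    then have TP: "\<bar>?T - (tr \<phi> ^^ 1) ?P x\<bar> \<le> c1 * \<bar>t\<bar> ^ 3"
      using tr_pow_abs_diff_le[OF x E, where n = 1] by simp
    have "tr \<phi> (\<lambda>z. (m z)\<^sup>2 / 2) x = (1/2) * tr \<phi> (\<lambda>z. (m z)\<^sup>2) x"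
      using tr_scale[of \<phi> "1/2" "\<lambda>z. (m z)\<^sup>2" x] by simp
    then have "(tr \<phi> ^^ 1) ?P x = 1 + t\<^sup>2 * ((1/2) * tr \<phi> (\<lambda>z. (m z)\<^sup>2) x + tr \<phi> w x)"
      by (simp add: tr_add tr_scale tr_const[OF x] Qm[OF x])
    also have "(1/2) * tr \<phi> (\<lambda>z. (m z)\<^sup>2) x + tr \<phi> w x = w x + \<rho> / 2"
      using w(2)[OF x] by (simp add: algebra_simps)
    also have "1 + t\<^sup>2 * (w x + \<rho> / 2) = g t x + \<rho> * t\<^sup>2 / 2"
      by (simp add: g_def algebra_simps)
    finally have T: "\<bar>?T - (g t x + \<rho> * t\<^sup>2 / 2)\<bar> \<le> c1 * \<bar>t\<bar> ^ 3" using TP by simp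
    have r: "\<bar>\<rho> * t\<^sup>2 / 2 * (t\<^sup>2 * w x)\<bar> \<le> \<rho> * W * \<bar>t\<bar> ^ 3 / 2"
    proof -
      have "\<bar>\<rho> * t\<^sup>2 / 2 * (t\<^sup>2 * w x)\<bar> = \<rho> / 2 * ((t\<^sup>2 * t\<^sup>2) * \<bar>w x\<bar>)" using \<rho>0 by (simp add: abs_mult mult_ac)
      also have "\<dots> \<le> \<rho> / 2 * (\<bar>t\<bar> ^ 3 * W)" using \<rho>0 W x t43 by (intro mult_left_mono mult_mono) auto
      finally show ?thesis by (simp add: mult_ac)
    qed
    have gg: "c2 * \<bar>t\<bar> ^ 3 * (1 / 2) \<le> c2 * \<bar>t\<bar> ^ 3 * g t x"
      using c2 g12[OF x] by (intro mult_left_mono) auto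
    have half: "c2 * \<bar>t\<bar> ^ 3 * (1 / 2) = c1 * \<bar>t\<bar> ^ 3 + \<rho> * W * \<bar>t\<bar> ^ 3 / 2"
      by (simp add: c2_def algebra_simps)
    have gx: "\<rho> * t\<^sup>2 / 2 * g t x = \<rho> * t\<^sup>2 / 2 + \<rho> * t\<^sup>2 / 2 * (t\<^sup>2 * w x)"
      by (simp add: g_def algebra_simps)
    have up: "?T \<le> (1 + \<rho> * t\<^sup>2 / 2 + c2 * \<bar>t\<bar> ^ 3) * g t x"
      using T r gg half gx unfolding distrib_right by (simp only: abs_le_iff mult_1) linarith
    have low: "(1 + \<rho> * t\<^sup>2 / 2 - c2 * \<bar>t\<bar> ^ 3) * g t x \<le> ?T"
      using T r gg half gx unfolding distrib_right left_diff_distrib by (simp only: abs_le_iff mult_1) linarith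
    have "1 + \<rho> * t\<^sup>2 / 2 + c2 * \<bar>t\<bar> ^ 3 \<le> 1 + y t" by (simp add: y_def c_def algebra_simps)
    also have "\<dots> \<le> exp (y t)" by (rule exp_ge_add_one_self)
    finally have up': "?T \<le> exp (y t) * g t x"
      using up g12[OF x] mult_right_mono[of "1 + \<rho> * t\<^sup>2 / 2 + c2 * \<bar>t\<bar> ^ 3" "exp (y t)" "g t x"] by linarith
    have "\<bar>y' t\<bar> \<le> (\<rho> / 2 + c) * t\<^sup>2"
    proof -
      have "\<bar>y' t\<bar> \<le> \<rho> * t\<^sup>2 / 2 + c * \<bar>t\<bar> ^ 3"
        unfolding y'_def using \<rho>0 cpos by (intro order_trans[OF abs_triangle_ineq4]) (auto simp: abs_mult)
      also have "\<dots> \<le> \<rho> * t\<^sup>2 / 2 + c * t\<^sup>2" using t32 cpos by (intro add_left_mono mult_left_mono) auto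
      finally show ?thesis by (simp add: algebra_simps)
    qed
    then have ysq: "(y' t)\<^sup>2 \<le> d * (t\<^sup>2 * t\<^sup>2)" and y1: "\<bar>y' t\<bar> \<le> 1"
    proof -
      assume a: "\<bar>y' t\<bar> \<le> (\<rho> / 2 + c) * t\<^sup>2"
      have "(y' t)\<^sup>2 \<le> ((\<rho> / 2 + c) * t\<^sup>2)\<^sup>2" using a by (metis abs_ge_zero power2_abs power_mono)
      then show "(y' t)\<^sup>2 \<le> d * (t\<^sup>2 * t\<^sup>2)" by (simp add: d_def power_mult_distrib power2_eq_square mult_ac)
      have "(\<rho> / 2 + c) * t\<^sup>2 \<le> d * \<bar>t\<bar>" using d_ge d1 t21 by (intro mult_mono) auto
      then show "\<bar>y' t\<bar> \<le> 1" using a tt(3) by (simp add: mult.commute)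
    qed
    have dt: "d * (t\<^sup>2 * t\<^sup>2) \<le> \<bar>t\<bar> ^ 3"
    proof -
      have "d * (t\<^sup>2 * t\<^sup>2) = (\<bar>t\<bar> * d) * \<bar>t\<bar> ^ 3" 
        by (simp add: power3_eq_cube power2_eq_square abs_mult_self_eq mult_ac)
      also have "\<dots> \<le> 1 * \<bar>t\<bar> ^ 3" using tt(3) by (intro mult_right_mono) auto
      finally show ?thesis by simp
    qed
    have "exp (y' t) \<le> 1 + y' t + (y' t)\<^sup>2"
    proof (cases "y' t \<ge> 0")
      case True
      then show ?thesis using exp_bound[of "y' t"] y1 by simp
    next
      case False
      then have "exp (- (- y' t)) \<le> 1 + y' t + (y' t)\<^sup>2"
      proof -
        have u: "0 \<le> - y' t" "- y' t \<le> 1" using False y1 by auto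
        have "1 + (- y' t) \<le> exp (- y' t)" by (rule exp_ge_add_one_self)
        then have "exp (y' t) \<le> 1 / (1 + (- y' t))"
          using u by (simp add: exp_minus field_simps)
        also have "\<dots> \<le> 1 + y' t + (y' t)\<^sup>2"
        proof -
          have "1 \<le> (1 + y' t + (y' t)\<^sup>2) * (1 - y' t)"
          proof -
            have "(1 + y' t + (y' t)\<^sup>2) * (1 - y' t) = 1 - (y' t) ^ 3"
              by (simp add: algebra_simps power2_eq_square power3_eq_cube)
            moreover have "(y' t) ^ 3 \<le> 0" using False by (simp add: power_le_zero_eq)
            ultimately show ?thesis by linarith
          qed
          then show ?thesis using u by (simp add: pos_divide_le_eq)
        qed
        finally show ?thesis by simp
      qed
      then show ?thesis by simp
    qed
    also have "\<dots> \<le> 1 + \<rho> * t\<^sup>2 / 2 - c2 * \<bar>t\<bar> ^ 3"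
      using ysq dt by (simp add: y'_def c_def algebra_simps)
    finally have low': "exp (y' t) * g t x \<le> ?T"
      using low g12[OF x] mult_right_mono[of "exp (y' t)" "1 + \<rho> * t\<^sup>2 / 2 - c2 * \<bar>t\<bar> ^ 3" "g t x"] by linarith
    show ?thesis using g12[OF x] up' low' by blast
  qed
  \<comment> \<open>Stationarity now moves the moment to an iterate without loss; the factor 4 comes
    only from \<open>1 / 2 \<le> g\<close> and \<open>g \<le> 2\<close>.\<close>
  have Eint: "(\<integral>x. exp (t * birkhoff m n x) \<partial>\<mu>) = (\<integral>x. (tr \<phi> ^^ n) (\<lambda>z. exp (t * birkhoff m n z)) x \<partial>\<mu>)" for t n
    by (rule integral_tr_pow[symmetric]) (intro Hol_exp Hol_scale Hol_birkhoff m)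
  have Tn: "(tr \<phi> ^^ n) (\<lambda>z. exp (t * birkhoff m n z)) x = (tr (\<lambda>z. \<phi> z + t * m z) ^^ n) (\<lambda>_. 1) x"
    if "x \<in> X" for t n x
    using tr_pow_weight[OF that, where \<psi> = \<phi> and n = n and g = "\<lambda>z. t * m z" and p = "\<lambda>_. 1"]
    by (simp add: birkhoff_scale)
  have Hint: "integrable \<mu> ((tr \<phi> ^^ n) (\<lambda>z. exp (t * birkhoff m n z)))" for t n
    by (intro Hol_integrable Hol_tr_pow Hol_exp Hol_scale Hol_birkhoff m)
  have upper: "(\<integral>x. exp (t * birkhoff m n x) \<partial>\<mu>) \<le> 4 * exp (real n * y t)" if t: "\<bar>t\<bar> \<le> t0" for t n
  proof -
    have "(tr (\<lambda>z. \<phi> z + t * m z) ^^ n) (\<lambda>_. 1) x \<le> 4 * exp (real n * y t)" if x: "x \<in> X" for x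
    proof -
      have "(tr (\<lambda>z. \<phi> z + t * m z) ^^ n) (\<lambda>_. 1) x \<le> (tr (\<lambda>z. \<phi> z + t * m z) ^^ n) (\<lambda>z. 2 * g t z) x"
        using main[OF t] by (intro tr_pow_mono x) fastforce
      also have "\<dots> = 2 * (tr (\<lambda>z. \<phi> z + t * m z) ^^ n) (g t) x" by (rule tr_pow_scale[OF x])
      also have "\<dots> \<le> 2 * (exp (y t) ^ n * g t x)"
        using main[OF t] by (intro mult_left_mono tr_pow_eigen_upper x) auto
      also have "\<dots> \<le> 2 * (exp (y t) ^ n * 2)" using main[OF t x] by (intro mult_left_mono) auto
      finally show ?thesis by (simp add: exp_of_nat_mult)
    qed
    then have "(\<integral>x. (tr \<phi> ^^ n) (\<lambda>z. exp (t * birkhoff m n z)) x \<partial>\<mu>) \<le> (\<integral>x. 4 * exp (real n * y t) \<partial>\<mu>)"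
      using Tn Hint by (intro integral_mono_X) auto
    then show ?thesis unfolding Eint using prob_space by simp
  qed
  have lower: "exp (real n * y' t) / 4 \<le> (\<integral>x. exp (t * birkhoff m n x) \<partial>\<mu>)" if t: "\<bar>t\<bar> \<le> t0" for t n
  proof -
    have "exp (real n * y' t) / 4 \<le> (tr (\<lambda>z. \<phi> z + t * m z) ^^ n) (\<lambda>_. 1) x" if x: "x \<in> X" for x
    proof -
      have "exp (real n * y' t) / 4 = (1/2) * (exp (y' t) ^ n * (1/2))" by (simp add: exp_of_nat_mult)
      also have "\<dots> \<le> (1/2) * (exp (y' t) ^ n * g t x)" using main[OF t x] by (intro mult_left_mono) auto
      also have "\<dots> \<le> (1/2) * (tr (\<lambda>z. \<phi> z + t * m z) ^^ n) (g t) x"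
        using main[OF t] by (intro mult_left_mono tr_pow_eigen_lower x) auto
      also have "\<dots> = (tr (\<lambda>z. \<phi> z + t * m z) ^^ n) (\<lambda>z. (1/2) * g t z) x" by (rule tr_pow_scale[OF x, symmetric])
      also have "\<dots> \<le> (tr (\<lambda>z. \<phi> z + t * m z) ^^ n) (\<lambda>_. 1) x"
        using main[OF t] by (intro tr_pow_mono x) fastforce
      finally show ?thesis .
    qed
    then have "(\<integral>x. exp (real n * y' t) / 4 \<partial>\<mu>) \<le> (\<integral>x. (tr \<phi> ^^ n) (\<lambda>z. exp (t * birkhoff m n z)) x \<partial>\<mu>)"
      using Tn Hint by (intro integral_mono_X) auto
    then show ?thesis unfolding Eint using prob_space by simp
  qed
  show ?thesis
    using that[OF t0 t0_1 _ upper[unfolded y_def] lower[unfolded y'_def]] cpos by simp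
qed

text \<open>The summands are reverse martingale differences: peeling off the first one leaves a
  function of \<open>shift x\<close>, and the cross term has mean zero by \<open>tr_shift\<close>,
  \<open>Qm\<close> and stationarity.\<close>

lemma martingale_variance:
  assumes m: "Hol m" and Qm: "\<And>x. x \<in> X \<Longrightarrow> tr \<phi> m x = 0"
  shows "(\<integral>x. (birkhoff m n x)\<^sup>2 \<partial>\<mu>) = real n * (\<integral>x. (m x)\<^sup>2 \<partial>\<mu>)"
proof (induction n)
  case (Suc n)
  let ?M = "birkhoff m n"
  have HM: "Hol ?M" by (rule Hol_birkhoff[OF m])
  have HMs: "Hol (\<lambda>x. ?M (shift x))" by (rule Hol_shift[OF HM])
  have cross: "(\<integral>x. ?M (shift x) * m x \<partial>\<mu>) = 0"
  proof -
    have "(\<integral>x. ?M (shift x) * m x \<partial>\<mu>) = (\<integral>x. tr \<phi> (\<lambda>x. ?M (shift x) * m x) x \<partial>\<mu>)"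
      by (rule integral_tr[symmetric]) (intro Hol_mult HMs m)
    also have "\<dots> = (\<integral>x. 0 \<partial>\<mu>)"
      by (rule integral_cong_X) (simp add: tr_shift Qm)
    finally show ?thesis by simp
  qed
  have sq: "(\<integral>x. (?M (shift x))\<^sup>2 \<partial>\<mu>) = (\<integral>x. (?M x)\<^sup>2 \<partial>\<mu>)"
    using integral_shift[OF Hol_measurable[OF Hol_power2[OF HM]], of 1] by simp
  have "(\<integral>x. (birkhoff m (Suc n) x)\<^sup>2 \<partial>\<mu>)
      = (\<integral>x. (m x)\<^sup>2 + (2 * (?M (shift x) * m x) + (?M (shift x))\<^sup>2) \<partial>\<mu>)"
    using birkhoff_add[of m 1 n] by (intro integral_cong_X) (simp add: power2_sum algebra_simps)
  also have "\<dots> = (\<integral>x. (m x)\<^sup>2 \<partial>\<mu>) + (2 * (\<integral>x. ?M (shift x) * m x \<partial>\<mu>) + (\<integral>x. (?M (shift x))\<^sup>2 \<partial>\<mu>))"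
    using Hol_integrable[OF Hol_power2[OF m]] Hol_integrable[OF Hol_mult[OF HMs m]]
      Hol_integrable[OF Hol_power2[OF HMs]] by simp
  finally show ?case using Suc cross sq by (simp add: algebra_simps)
qed simp

text \<open>Gordin's decomposition: with \<open>u\<close> from the Poisson equation and
  \<open>v\<close> its image, \<open>F\<close> is a coboundary plus a function \<open>m\<close>
  annihilated by the operator. The coboundary sums to a bounded amount along orbits, so it changes
  exponential moments by a constant factor and the variance to lower order only.\<close>

lemma observable_asymptotics:
  assumes F: "Hol F" and I: "(\<integral>x. F x \<partial>\<mu>) = 0"
  obtains \<rho> v t0 P c where "\<rho> \<ge> 0" "Hol v"
    "\<rho> = 0 \<Longrightarrow> (\<forall>x\<in>X. F x = v (shift x) - v x)"
    "(\<lambda>n. (1 / real n) * (\<integral>x. (birkhoff F n x)\<^sup>2 \<partial>\<mu>)) \<longlonglongrightarrow> \<rho>"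
    "t0 > 0" "t0 \<le> 1" "P \<ge> 1" "c \<ge> 0"
    "\<And>t n. \<bar>t\<bar> \<le> t0 \<Longrightarrow> (\<integral>x. exp (t * birkhoff F n x) \<partial>\<mu>) \<le> P * exp (real n * (\<rho> * t\<^sup>2 / 2 + c * \<bar>t\<bar> ^ 3))"
    "\<And>t n. \<bar>t\<bar> \<le> t0 \<Longrightarrow> exp (real n * (\<rho> * t\<^sup>2 / 2 - c * \<bar>t\<bar> ^ 3)) / P \<le> (\<integral>x. exp (t * birkhoff F n x) \<partial>\<mu>)"
proof -
  obtain u where u: "Hol u" "\<And>x. x \<in> X \<Longrightarrow> u x - tr \<phi> u x = F x" using poisson_equation[OF F I] by blast
  define v where "v = tr \<phi> u"
  define m where "m x = u x - v (shift x)" for x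
  have v: "Hol v" unfolding v_def by (rule Hol_tr[OF u(1)])
  have m: "Hol m" unfolding m_def by (intro Hol_diff u(1) Hol_shift[OF v])
  have Fm: "F x = m x + (v (shift x) - v x)" if "x \<in> X" for x
    using u(2)[OF that] by (simp add: m_def v_def)
  have Qm: "tr \<phi> m x = 0" if x: "x \<in> X" for x
  proof -
    have "tr \<phi> (\<lambda>z. v (shift z) * 1) x = v x * tr \<phi> (\<lambda>_. 1) x" by (rule tr_shift)
    then show ?thesis using normalized[OF x] by (simp add: m_def[abs_def] tr_diff v_def)
  qed
  define \<rho> where "\<rho> = (\<integral>x. (m x)\<^sup>2 \<partial>\<mu>)"
  have \<rho>0: "\<rho> \<ge> 0" by (simp add: \<rho>_def)
  obtain V where V: "V > 0" "\<And>x. x \<in> X \<Longrightarrow> \<bar>v x\<bar> \<le> V" by (rule Hol_bounded[OF v]) (rule that)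
  have S: "birkhoff F n x = birkhoff m n x + (v ((shift ^^ n) x) - v x)" if "x \<in> X" for n x
  proof -
    have "birkhoff F n x = birkhoff (\<lambda>x. m x + (v (shift x) - v x)) n x"
      using Fm shift_pow_in[OF that] unfolding birkhoff_def by (intro sum.cong) auto
    then show ?thesis by (simp add: birkhoff_plus birkhoff_coboundary)
  qed
  have diff: "\<bar>birkhoff F n x - birkhoff m n x\<bar> \<le> 2 * V" if "x \<in> X" for n x
    using S[OF that, of n] V(2)[OF that] V(2)[OF shift_pow_in[OF that, of n]] by (simp add: abs_le_iff)
  \<comment> \<open>Every cylinder has positive measure and \<open>m\<close> is continuous, so a
    vanishing mean square forces \<open>m\<close> to vanish at each point of \<open>X\<close> and
    not just almost everywhere.\<close>
  have zero: "\<forall>x\<in>X. F x = v (shift x) - v x" if "\<rho> = 0"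
  proof
    fix x assume x: "x \<in> X"
    have "m x = 0"
    proof (rule ccontr)
      assume mx: "m x \<noteq> 0"
      obtain B where B: "hol B (\<lambda>x. (m x)\<^sup>2)" using Hol_power2[OF m] by (auto simp: Hol_def)
      have "(\<lambda>n. B * \<alpha> ^ n) \<longlonglongrightarrow> B * 0"
        using alpha by (intro tendsto_mult_left LIMSEQ_power_zero) auto
      then have "eventually (\<lambda>n. B * \<alpha> ^ n < (m x)\<^sup>2 / 2) sequentially"
        using mx by (intro order_tendstoD) auto
      then obtain n where n: "B * \<alpha> ^ n < (m x)\<^sup>2 / 2"
        using eventually_happens trivial_limit_sequentially by blast
      have "(\<integral>y. (m x)\<^sup>2 / 2 * indicator (Cy n x) y \<partial>\<mu>) \<le> (\<integral>y. (m y)\<^sup>2 \<partial>\<mu>)"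
      proof (rule integral_mono_X)
        show "integrable \<mu> (\<lambda>y. (m x)\<^sup>2 / 2 * indicat_real (Cy n x) y)"
          by (intro integrable_mult_right) (simp add: emeasure_eq_measure)
        show "integrable \<mu> (\<lambda>y. (m y)\<^sup>2)" by (rule Hol_integrable[OF Hol_power2[OF m]])
        fix y assume y: "y \<in> X"
        show "(m x)\<^sup>2 / 2 * indicator (Cy n x) y \<le> (m y)\<^sup>2"
        proof (cases "y \<in> Cy n x")
          case True
          then have "agree n y x" by (simp add: Cy_def)
          then show ?thesis using holD[OF B y x] n True by (fastforce simp: abs_le_iff)
        qed simp
      qed
      then have "(m x)\<^sup>2 / 2 * measure \<mu> (Cy n x) \<le> \<rho>"
        by (simp add: \<rho>_def integral_indicator_X)
      moreover have "(m x)\<^sup>2 / 2 * measure \<mu> (Cy n x) > 0" using mx measure_Cy_pos[OF x, of n] by simp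
      ultimately show False using that by simp
    qed
    then show "F x = v (shift x) - v x" using Fm[OF x] by simp
  qed
  have lim: "(\<lambda>n. (1 / real n) * (\<integral>x. (birkhoff F n x)\<^sup>2 \<partial>\<mu>)) \<longlonglongrightarrow> \<rho>"
  proof -
    \<comment> \<open>A nonnegative variance bounds the mean of
      \<open>\<bar>birkhoff m n x\<bar>\<close> by the square root of the mean square; the cross
      term is therefore of order \<open>sqrt n\<close>.\<close>
    have bnd: "\<bar>(\<integral>x. (birkhoff F n x)\<^sup>2 \<partial>\<mu>) - real n * \<rho>\<bar> \<le> 4 * V * sqrt (real n * \<rho>) + 4 * V\<^sup>2" for n
    proof -
      let ?S = "birkhoff F n" and ?M = "birkhoff m n"
      have HS: "Hol ?S" "Hol ?M" by (intro Hol_birkhoff F m)+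
      have i: "integrable \<mu> (\<lambda>x. (?S x)\<^sup>2)" "integrable \<mu> (\<lambda>x. (?M x)\<^sup>2)" "integrable \<mu> (\<lambda>x. \<bar>?M x\<bar>)" "integrable \<mu> ?M"
        using Hol_integrable[OF Hol_power2[OF HS(1)]] Hol_integrable[OF Hol_power2[OF HS(2)]] Hol_integrable[OF HS(2)] by auto
      have "(\<integral>x. \<bar>?M x\<bar> \<partial>\<mu>)\<^sup>2 \<le> (\<integral>x. \<bar>?M x\<bar>\<^sup>2 \<partial>\<mu>)"
      proof -
        have "0 \<le> (\<integral>x. (\<bar>?M x\<bar> - (\<integral>x. \<bar>?M x\<bar> \<partial>\<mu>))\<^sup>2 \<partial>\<mu>)" by simp
        also have "\<dots> = (\<integral>x. \<bar>?M x\<bar>\<^sup>2 \<partial>\<mu>) - (\<integral>x. \<bar>?M x\<bar> \<partial>\<mu>)\<^sup>2"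
          using i by (intro variance_eq) auto
        finally show ?thesis by simp
      qed
      also have "\<dots> = real n * \<rho>" unfolding \<rho>_def using martingale_variance[OF m Qm] by simp
      finally have abs: "(\<integral>x. \<bar>?M x\<bar> \<partial>\<mu>) \<le> sqrt (real n * \<rho>)" by (rule real_le_rsqrt)
      have pt: "\<bar>(?S x)\<^sup>2 - (?M x)\<^sup>2\<bar> \<le> 4 * V * \<bar>?M x\<bar> + 4 * V\<^sup>2" if x: "x \<in> X" for x
      proof -
        define e where "e = ?S x - ?M x"
        have e: "\<bar>e\<bar> \<le> 2 * V" unfolding e_def by (rule diff[OF x])
        have "(?S x)\<^sup>2 - (?M x)\<^sup>2 = 2 * e * ?M x + e\<^sup>2" by (simp add: e_def power2_eq_square algebra_simps)
        then have "\<bar>(?S x)\<^sup>2 - (?M x)\<^sup>2\<bar> \<le> \<bar>2 * e * ?M x\<bar> + \<bar>e\<^sup>2\<bar>" by (simp only: abs_triangle_ineq)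
        also have "\<dots> = 2 * \<bar>e\<bar> * \<bar>?M x\<bar> + \<bar>e\<bar>\<^sup>2" by (simp add: abs_mult)
        also have "\<dots> \<le> 2 * (2 * V) * \<bar>?M x\<bar> + (2 * V)\<^sup>2"
          using e by (intro add_mono mult_right_mono mult_left_mono power_mono) auto
        finally show ?thesis by (simp add: power_mult_distrib)
      qed
      have "\<bar>(\<integral>x. (?S x)\<^sup>2 \<partial>\<mu>) - real n * \<rho>\<bar> = \<bar>\<integral>x. (?S x)\<^sup>2 - (?M x)\<^sup>2 \<partial>\<mu>\<bar>"
        unfolding \<rho>_def using i martingale_variance[OF m Qm, of n] by simp
      also have "\<dots> \<le> (\<integral>x. \<bar>(?S x)\<^sup>2 - (?M x)\<^sup>2\<bar> \<partial>\<mu>)" by (rule integral_abs_bound)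
      also have "\<dots> \<le> (\<integral>x. 4 * V * \<bar>?M x\<bar> + 4 * V\<^sup>2 \<partial>\<mu>)"
        using i pt by (intro integral_mono_X) auto
      also have "\<dots> = 4 * V * (\<integral>x. \<bar>?M x\<bar> \<partial>\<mu>) + 4 * V\<^sup>2" using i prob_space by simp
      also have "\<dots> \<le> 4 * V * sqrt (real n * \<rho>) + 4 * V\<^sup>2" using abs V by (intro add_mono mult_left_mono) auto
      finally show ?thesis .
    qed
    have "(\<lambda>n. (1 / real n) * (\<integral>x. (birkhoff F n x)\<^sup>2 \<partial>\<mu>) - \<rho>) \<longlonglongrightarrow> 0"
    proof (rule Lim_null_comparison)
      show "eventually (\<lambda>n. norm ((1 / real n) * (\<integral>x. (birkhoff F n x)\<^sup>2 \<partial>\<mu>) - \<rho>)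
         \<le> (4 * V * sqrt (real n * \<rho>) + 4 * V\<^sup>2) / real n) sequentially"
        using eventually_gt_at_top[of 0]
      proof eventually_elim
        case (elim n)
        have "(1 / real n) * (\<integral>x. (birkhoff F n x)\<^sup>2 \<partial>\<mu>) - \<rho> = ((\<integral>x. (birkhoff F n x)\<^sup>2 \<partial>\<mu>) - real n * \<rho>) / real n"
          using elim by (simp add: field_simps)
        then have "norm ((1 / real n) * (\<integral>x. (birkhoff F n x)\<^sup>2 \<partial>\<mu>) - \<rho>) = \<bar>(\<integral>x. (birkhoff F n x)\<^sup>2 \<partial>\<mu>) - real n * \<rho>\<bar> / real n"
          by simp
        also have "\<dots> \<le> (4 * V * sqrt (real n * \<rho>) + 4 * V\<^sup>2) / real n" using bnd[of n] by (intro divide_right_mono) auto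
        finally show ?case .
      qed
      have "(\<lambda>n. (4 * V * (sqrt (real n) * r) + 4 * V\<^sup>2) / real n) \<longlonglongrightarrow> 0" for r by real_asymp
      from this[of "sqrt \<rho>"] show "(\<lambda>n. (4 * V * sqrt (real n * \<rho>) + 4 * V\<^sup>2) / real n) \<longlonglongrightarrow> 0" by (simp add: real_sqrt_mult)
    qed
    then show ?thesis by (rule LIM_zero_cancel)
  qed
  obtain t0 c where tc: "t0 > 0" "t0 \<le> 1" "c \<ge> 0"
    "\<And>t n. \<bar>t\<bar> \<le> t0 \<Longrightarrow> (\<integral>x. exp (t * birkhoff m n x) \<partial>\<mu>) \<le> 4 * exp (real n * (\<rho> * t\<^sup>2 / 2 + c * \<bar>t\<bar> ^ 3))"
    "\<And>t n. \<bar>t\<bar> \<le> t0 \<Longrightarrow> exp (real n * (\<rho> * t\<^sup>2 / 2 - c * \<bar>t\<bar> ^ 3)) / 4 \<le> (\<integral>x. exp (t * birkhoff m n x) \<partial>\<mu>)"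
    using martingale_exp_moments[OF m Qm] unfolding \<rho>_def[symmetric] by blast
  define P where "P = 4 * exp (2 * V)"
  have P1: "P \<ge> 1" using V by (simp add: P_def mult_ge1_I)
  have iF: "integrable \<mu> (\<lambda>x. exp (t * birkhoff F n x))" "integrable \<mu> (\<lambda>x. exp (t * birkhoff m n x))" for t n
    by (intro Hol_integrable Hol_exp Hol_scale Hol_birkhoff F m)+
  have close: "t * birkhoff F n x - t * birkhoff m n x \<le> 2 * V" "t * birkhoff m n x - t * birkhoff F n x \<le> 2 * V"
    if "\<bar>t\<bar> \<le> t0" "x \<in> X" for t n x
  proof -
    have "\<bar>t * (birkhoff F n x - birkhoff m n x)\<bar> \<le> 1 * (2 * V)"
      unfolding abs_mult using diff[OF that(2), of n] that(1) tc(2) by (intro mult_mono) auto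
    then show "t * birkhoff F n x - t * birkhoff m n x \<le> 2 * V" "t * birkhoff m n x - t * birkhoff F n x \<le> 2 * V"
      by (auto simp: algebra_simps abs_le_iff)
  qed
  have up: "(\<integral>x. exp (t * birkhoff F n x) \<partial>\<mu>) \<le> P * exp (real n * (\<rho> * t\<^sup>2 / 2 + c * \<bar>t\<bar> ^ 3))" if t: "\<bar>t\<bar> \<le> t0" for t n
  proof -
    have "(\<integral>x. exp (t * birkhoff F n x) \<partial>\<mu>) \<le> (\<integral>x. exp (2 * V) * exp (t * birkhoff m n x) \<partial>\<mu>)"
    proof (rule integral_mono_X)
      fix x assume x: "x \<in> X"
      show "exp (t * birkhoff F n x) \<le> exp (2 * V) * exp (t * birkhoff m n x)"
        using close(1)[OF t x, of n] by (simp add: exp_add[symmetric])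
    qed (use iF in auto)
    also have "\<dots> = exp (2 * V) * (\<integral>x. exp (t * birkhoff m n x) \<partial>\<mu>)" by simp
    also have "\<dots> \<le> exp (2 * V) * (4 * exp (real n * (\<rho> * t\<^sup>2 / 2 + c * \<bar>t\<bar> ^ 3)))"
      by (intro mult_left_mono tc(4) t) auto
    finally show ?thesis by (simp add: P_def mult_ac)
  qed
  have low: "exp (real n * (\<rho> * t\<^sup>2 / 2 - c * \<bar>t\<bar> ^ 3)) / P \<le> (\<integral>x. exp (t * birkhoff F n x) \<partial>\<mu>)" if t: "\<bar>t\<bar> \<le> t0" for t n
  proof -
    have "exp (real n * (\<rho> * t\<^sup>2 / 2 - c * \<bar>t\<bar> ^ 3)) / P = exp (- (2 * V)) * (exp (real n * (\<rho> * t\<^sup>2 / 2 - c * \<bar>t\<bar> ^ 3)) / 4)"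
      by (simp add: P_def exp_minus field_simps)
    also have "\<dots> \<le> exp (- (2 * V)) * (\<integral>x. exp (t * birkhoff m n x) \<partial>\<mu>)"
      by (intro mult_left_mono tc(5) t) auto
    also have "\<dots> = (\<integral>x. exp (- (2 * V)) * exp (t * birkhoff m n x) \<partial>\<mu>)" by simp
    also have "\<dots> \<le> (\<integral>x. exp (t * birkhoff F n x) \<partial>\<mu>)"
    proof (rule integral_mono_X)
      fix x assume x: "x \<in> X"
      show "exp (- (2 * V)) * exp (t * birkhoff m n x) \<le> exp (t * birkhoff F n x)"
        using close(2)[OF t x, of n] by (simp add: exp_add[symmetric])
    qed (use iF in auto)
    finally show ?thesis .
  qed
  show ?thesis by (rule that[OF \<rho>0 v zero lim tc(1,2) P1 tc(3) up low])
qed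

end

section \<open>The law of the iterated logarithm\<close>

definition lil :: "real \<Rightarrow> real \<Rightarrow> real" where
  "lil \<rho> y = sqrt (2 * \<rho> * y * ln (ln y))"

text \<open>The size of the tilt that belongs to deviations of order \<open>lil\<close>, as
  \<open>lil_eq\<close> makes explicit. At this scale the cubic error in the exponential moments is
  negligible, by \<open>lil_scale_cube_tendsto\<close>.\<close>

definition lil_scale :: "nat \<Rightarrow> real" where
  "lil_scale n = sqrt (2 * ln (ln (real n)) / real n)"

lemma lil_scale_tendsto: "lil_scale \<longlonglongrightarrow> 0"
  unfolding lil_scale_def by real_asymp

lemma lil_scale_cube_tendsto: "(\<lambda>n. real n * lil_scale n ^ 3) \<longlonglongrightarrow> 0"
  unfolding lil_scale_def by real_asymp

lemma ln_ln_at_top: "filterlim (\<lambda>n. ln (ln (real n))) at_top sequentially"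
  by real_asymp

lemma eventually_ln_ln_ge: "eventually (\<lambda>n. a \<le> b * ln (ln (real n))) sequentially" if "b > 0"
proof -
  have "eventually (\<lambda>n. a / b \<le> ln (ln (real n))) sequentially"
    using ln_ln_at_top by (auto simp: filterlim_at_top)
  then show ?thesis
    by eventually_elim (use that in \<open>simp add: pos_divide_le_eq mult.commute\<close>)
qed

lemma lil_eq:
  assumes "ln (ln (real n)) \<ge> 0" "n > 0" "\<rho> > 0"
  shows "lil \<rho> (real n) = sqrt \<rho> * (real n * lil_scale n)"
    and "real n * (lil_scale n)\<^sup>2 = 2 * ln (ln (real n))"
proof -
  show e: "real n * (lil_scale n)\<^sup>2 = 2 * ln (ln (real n))"
    using assms by (simp add: lil_scale_def)
  have s0: "lil_scale n \<ge> 0" using assms by (simp add: lil_scale_def)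
  have "2 * \<rho> * real n * ln (ln (real n)) = \<rho> * (real n * lil_scale n)\<^sup>2"
    using e by (simp add: power_mult_distrib power2_eq_square mult_ac)
  then have "lil \<rho> (real n) = sqrt \<rho> * sqrt ((real n * lil_scale n)\<^sup>2)"
    unfolding lil_def real_sqrt_mult[symmetric] by (rule arg_cong)
  then show "lil \<rho> (real n) = sqrt \<rho> * (real n * lil_scale n)"
    using s0 by simp
qed

text \<open>Compares the normaliser at times that differ by a bounded factor and a bounded shift, as
  happens along geometric sequences of times.\<close>

lemma lil_ratio:
  assumes "q > 0" "\<rho> > 0"
  shows "((\<lambda>y. lil \<rho> (q * y + r) / lil \<rho> y) \<longlongrightarrow> sqrt q) at_top"
proof -
  have "((\<lambda>y. ((q * y + r) * ln (ln (q * y + r))) / (y * ln (ln y))) \<longlongrightarrow> q) at_top"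
    using assms(1) by real_asymp
  then have "((\<lambda>y. sqrt (((q * y + r) * ln (ln (q * y + r))) / (y * ln (ln y)))) \<longlongrightarrow> sqrt q) at_top"
    by (rule tendsto_real_sqrt)
  moreover have "sqrt (((q * y + r) * ln (ln (q * y + r))) / (y * ln (ln y))) = lil \<rho> (q * y + r) / lil \<rho> y" for y
    unfolding lil_def real_sqrt_divide[symmetric] using assms(2) by simp
  ultimately show ?thesis by simp
qed

lemma lil_at_top: "\<rho> > 0 \<Longrightarrow> filterlim (lil \<rho>) at_top at_top"
  unfolding lil_def by real_asymp

lemma lil_eventually_pos: "\<rho> > 0 \<Longrightarrow> eventually (\<lambda>y. lil \<rho> y > 0) at_top"
  using lil_at_top by (auto simp: filterlim_at_top_dense)

lemma lil_mono:
  assumes "\<rho> \<ge> 0" "exp 1 \<le> x" "x \<le> y"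
  shows "lil \<rho> x \<le> lil \<rho> y"
proof -
  have x1: "x \<ge> 1" using assms(2) exp_ge_add_one_self[of 1] by linarith
  have "1 \<le> ln x" using assms(2) x1 by (simp add: ln_ge_iff)
  moreover have "ln x \<le> ln y" using assms x1 by simp
  ultimately have "0 \<le> ln (ln x)" "ln (ln x) \<le> ln (ln y)" by auto
  then show ?thesis
    unfolding lil_def using assms x1 by (intro real_sqrt_le_mono mult_mono) auto
qed

text \<open>From here on the transfer operator is hidden behind the two exponential moment bounds.
  They hold for both signs of \<open>t\<close>, so the locale is stable under
  \<open>F \<mapsto> - F\<close>.\<close>

locale gibbs_observable = gibbs_subshift +
  fixes F :: "(nat \<Rightarrow> nat) \<Rightarrow> real" and B\<^sub>F \<rho> t0 P c :: real
  assumes hol_F: "hol B\<^sub>F F" and mean_F: "(\<integral>x. F x \<partial>\<mu>) = 0"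
    and rho: "\<rho> > 0" and t0: "t0 > 0" "t0 \<le> 1" and P: "P \<ge> 1" and c: "c \<ge> 0"
    and exp_moment_upper: "\<bar>t\<bar> \<le> t0 \<Longrightarrow>
      (\<integral>x. exp (t * birkhoff F n x) \<partial>\<mu>) \<le> P * exp (real n * (\<rho> * t\<^sup>2 / 2 + c * \<bar>t\<bar> ^ 3))"
    and exp_moment_lower: "\<bar>t\<bar> \<le> t0 \<Longrightarrow>
      exp (real n * (\<rho> * t\<^sup>2 / 2 - c * \<bar>t\<bar> ^ 3)) / P \<le> (\<integral>x. exp (t * birkhoff F n x) \<partial>\<mu>)"
begin

definition dF where "dF = B\<^sub>F / (1 - \<alpha>)"

text \<open>A stand-in for the Birkhoff sum that is constant on \<open>n\<close>-cylinders, so that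
  quasi-independence applies; by bounded distortion it stays within \<open>dF\<close>.\<close>

definition Sd where "Sd n x = birkhoff F n (rep (Cy n x))"

lemma dF_nonneg: "dF \<ge> 0"
  using hol_nonneg[OF hol_F] alpha by (simp add: dF_def)

lemma det_Sd: "det n (Sd n)"
  unfolding Sd_def by (rule det_Cy_fun)

lemma Sd_close: "x \<in> X \<Longrightarrow> \<bar>birkhoff F n x - Sd n x\<bar> \<le> dF"
proof -
  assume x: "x \<in> X"
  then have U: "Cy n x \<in> cyls n" by (simp add: cyls_def)
  have "agree (n + 0) x (rep (Cy n x))" using rep_in[OF U] by (auto simp: Cy_def intro: agree_sym)
  then show ?thesis unfolding Sd_def dF_def using birkhoff_variation[OF hol_F x rep_in_X[OF U], of n 0] by simp
qed

lemma Hol_F: "Hol F"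
  by (rule HolI[OF hol_F])

lemma Hol_exp_birkhoff: "Hol (\<lambda>x. exp (t * birkhoff F n x))"
  by (intro Hol_exp Hol_scale Hol_birkhoff Hol_F)

lemma exp_moment_ge_1: "(\<integral>x. exp (t * birkhoff F n x) \<partial>\<mu>) \<ge> 1"
proof -
  have "exp (\<integral>x. t * birkhoff F n x \<partial>\<mu>) \<le> (\<integral>x. exp (t * birkhoff F n x) \<partial>\<mu>)"
    by (intro integral_exp_ge Hol_integrable Hol_exp_birkhoff Hol_scale Hol_birkhoff Hol_F)
  then show ?thesis using integral_birkhoff[OF Hol_F, of n] mean_F by simp
qed

lemma exp_Sd_close:
  assumes "\<bar>t\<bar> \<le> 1" "x \<in> X"
  shows "exp (t * Sd n x) \<le> exp dF * exp (t * birkhoff F n x)"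
    and "exp (t * birkhoff F n x) \<le> exp dF * exp (t * Sd n x)"
proof -
  have "\<bar>t * (birkhoff F n x - Sd n x)\<bar> \<le> 1 * dF"
    unfolding abs_mult using assms Sd_close[OF assms(2)] by (intro mult_mono) auto
  then show "exp (t * Sd n x) \<le> exp dF * exp (t * birkhoff F n x)"
    "exp (t * birkhoff F n x) \<le> exp dF * exp (t * Sd n x)"
    by (auto simp: exp_add[symmetric] algebra_simps abs_le_iff)
qed

lemma det_exp_Sd: "det n (\<lambda>x. exp (t * Sd n x))"
  by (rule det_comp[OF det_Sd])

lemma exp_moment_Sd:
  assumes "\<bar>t\<bar> \<le> 1"
  shows "(\<integral>x. exp (t * Sd n x) \<partial>\<mu>) \<le> exp dF * (\<integral>x. exp (t * birkhoff F n x) \<partial>\<mu>)"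
    and "(\<integral>x. exp (t * birkhoff F n x) \<partial>\<mu>) \<le> exp dF * (\<integral>x. exp (t * Sd n x) \<partial>\<mu>)"
  using integral_mono_X[OF det_integrable[OF det_exp_Sd] integrable_mult_right[OF Hol_integrable[OF Hol_exp_birkhoff]] exp_Sd_close(1)[OF assms]]
    integral_mono_X[OF Hol_integrable[OF Hol_exp_birkhoff] integrable_mult_right[OF det_integrable[OF det_exp_Sd]] exp_Sd_close(2)[OF assms]]
  by simp_all

lemma F_bounded: obtains R where "R > 0" "\<And>x n. x \<in> X \<Longrightarrow> \<bar>birkhoff F n x\<bar> \<le> real n * R"
proof -
  obtain R where R: "R > 0" "\<And>x. x \<in> X \<Longrightarrow> \<bar>F x\<bar> \<le> R" by (rule Hol_bounded[OF Hol_F]) (rule that)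
  have "\<bar>birkhoff F n x\<bar> \<le> real n * R" if x: "x \<in> X" for x n
  proof -
    have "\<bar>birkhoff F n x\<bar> \<le> (\<Sum>k<n. \<bar>F ((shift ^^ k) x)\<bar>)" unfolding birkhoff_def by (rule sum_abs)
    also have "\<dots> \<le> (\<Sum>k<n. R)" by (intro sum_mono R(2) shift_pow_in x)
    finally show ?thesis by simp
  qed
  then show ?thesis using that R(1) by blast
qed

text \<open>A first-passage argument in the style of Ottaviani. After the first passage of
  \<open>a\<close> at time \<open>k\<close>, the remaining block is quasi-independent of the past
  once \<open>G\<close> symbols are skipped, and its exponential moment is at least 1 by Jensen. Up
  to a constant, the moment at time \<open>n\<close> thus dominates \<open>exp (t * a)\<close> times
  the passage probability.\<close>

lemma maximal_inequality:
  obtains Q where "Q \<ge> 1" "\<And>a t n. 0 \<le> t \<Longrightarrow> t \<le> t0 \<Longrightarrow>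
    measure \<mu> {x \<in> X. \<exists>k\<le>n. Sd k x \<ge> a} \<le> Q * exp (real n * (\<rho> * t\<^sup>2 / 2 + c * t ^ 3) - t * a)"
proof -
  obtain R where R: "R > 0" "\<And>x n. x \<in> X \<Longrightarrow> \<bar>birkhoff F n x\<bar> \<le> real n * R" using F_bounded by blast
  \<comment> \<open>\<open>2 * dF\<close> for exchanging two Birkhoff sums with \<open>Sd\<close>,
    one more \<open>dF\<close> for the moment of the last block, and \<open>2 * (real G * R)\<close>
    for moving that block by \<open>G\<close> places.\<close>
  define c0 where "c0 = 3 * dF + 2 * (real G * R)"
  have c0: "c0 \<ge> 0" using dF_nonneg R by (simp add: c0_def)
  define Q where "Q = P * exp c0 / gap"
  have "exp c0 \<ge> 1" using c0 by simp
  then have "P * exp c0 \<ge> 1 * 1" using P by (intro mult_mono) auto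
  then have Q1: "Q \<ge> 1" unfolding Q_def using gap_pos gap_le_1 by (simp add: le_divide_eq)
  have "measure \<mu> {x \<in> X. \<exists>k\<le>n. Sd k x \<ge> a} \<le> Q * exp (real n * (\<rho> * t\<^sup>2 / 2 + c * t ^ 3) - t * a)"
    if t: "0 \<le> t" "t \<le> t0" for a t n
  proof -
    have t1: "t \<le> 1" "\<bar>t\<bar> \<le> 1" using t t0 by auto
    define T where "T k x \<longleftrightarrow> Sd k x \<ge> a \<and> (\<forall>j<k. Sd j x < a)" for k x
    let ?I = "\<lambda>k x. indicator {x \<in> X. T k x} x :: real"
    have detT: "det k (T k)" for k
      unfolding det_def
    proof (intro ballI impI)
      fix x y assume xy: "x \<in> X" "y \<in> X" "agree k x y"
      have "Sd j x = Sd j y" if "j \<le> k" for j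
        using xy that by (intro detD[OF det_Sd]) (auto intro: agree_mono)
      then show "T k x = T k y" by (auto simp: T_def)
    qed
    have detI: "det k (?I k)" for k by (rule det_indicator[OF detT])
    have set_eq: "{x \<in> X. \<exists>k\<le>n. Sd k x \<ge> a} = (\<Union>k\<in>{..n}. {x \<in> X. T k x})"
    proof (intro equalityI subsetI)
      fix x assume "x \<in> {x \<in> X. \<exists>k\<le>n. Sd k x \<ge> a}"
      then obtain k where k: "x \<in> X" "k \<le> n" "Sd k x \<ge> a" by auto
      define l where "l = (LEAST k. Sd k x \<ge> a)"
      have "Sd l x \<ge> a" unfolding l_def by (rule LeastI[of _ k]) (rule k)
      moreover have "l \<le> n" using Least_le[of "\<lambda>k. Sd k x \<ge> a" k] k by (simp add: l_def)
      moreover have "Sd j x < a" if "j < l" for j using not_less_Least[OF that[unfolded l_def]] by simp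
      ultimately show "x \<in> (\<Union>k\<in>{..n}. {x \<in> X. T k x})" using k(1) by (auto simp: T_def)
    qed (auto simp: T_def)
    have piece: "exp (t * a - c0) * gap * measure \<mu> {x \<in> X. T k x} \<le> (\<integral>x. ?I k x * exp (t * birkhoff F n x) \<partial>\<mu>)"
      if k: "k \<le> n" for k
    proof -
      let ?q = "\<lambda>y. exp (t * Sd (n - k) y)"
      have qb: "gap * (\<integral>x. ?I k x \<partial>\<mu>) * (\<integral>x. ?q x \<partial>\<mu>) \<le> (\<integral>x. ?I k x * ?q ((shift ^^ (k + G)) x) \<partial>\<mu>)"
        by (rule quasi_bernoulli_lower[OF detI _ det_exp_Sd]) auto
      have "1 \<le> exp dF * (\<integral>x. ?q x \<partial>\<mu>)"
        using exp_moment_ge_1[of t "n - k"] exp_moment_Sd(2)[OF t1(2), of "n - k"] by linarith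
      then have q1: "exp (- dF) \<le> (\<integral>x. ?q x \<partial>\<mu>)" by (simp add: exp_minus field_simps)
      have pt: "exp (t * a - (c0 - dF)) * (?I k x * ?q ((shift ^^ (k + G)) x)) \<le> ?I k x * exp (t * birkhoff F n x)"
        if x: "x \<in> X" for x
      proof (cases "T k x")
        case True
        let ?y = "(shift ^^ k) x"
        have yX: "?y \<in> X" "(shift ^^ G) ?y \<in> X" "(shift ^^ (n - k)) ?y \<in> X" using shift_pow_in x by auto
        have e1: "birkhoff F n x = birkhoff F k x + birkhoff F (n - k) ?y"
          using birkhoff_add[of F k "n - k" x] k by simp
        have e2: "birkhoff F (n - k) ?y + birkhoff F G ((shift ^^ (n - k)) ?y)
            = birkhoff F G ?y + birkhoff F (n - k) ((shift ^^ G) ?y)"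
          unfolding birkhoff_add[symmetric] by (simp add: add.commute)
        have e3: "(shift ^^ G) ?y = (shift ^^ (k + G)) x" by (rule shift_pow_add)
        have "birkhoff F n x \<ge> (a - dF) + (Sd (n - k) ((shift ^^ (k + G)) x) - dF) - 2 * (real G * R)"
          using e1 e2 R(2)[OF yX(1), of G] R(2)[OF yX(3), of G] Sd_close[OF x, of k]
            Sd_close[OF yX(2), of "n - k"] True unfolding e3 T_def abs_le_iff by linarith
        then have "t * birkhoff F n x \<ge> t * ((a + Sd (n - k) ((shift ^^ (k + G)) x)) - (c0 - dF))"
          using t by (intro mult_left_mono) (auto simp: c0_def)
        moreover have "t * (c0 - dF) \<le> 1 * (c0 - dF)"
          using t1 dF_nonneg R by (intro mult_right_mono) (auto simp: c0_def)
        ultimately have "t * a - (c0 - dF) + t * Sd (n - k) ((shift ^^ (k + G)) x) \<le> t * birkhoff F n x"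
          by (simp add: algebra_simps)
        then show ?thesis using True x by (simp add: exp_add[symmetric])
      qed simp
      have int1: "integrable \<mu> (\<lambda>x. ?I k x * ?q ((shift ^^ (k + G)) x))"
        using det_integrable[OF det_comp2[OF det_mono[OF detI, of k "k + G + (n - k)"] det_shift[OF det_exp_Sd, of "k + G"], of "(*)"]] by simp
      have int2: "integrable \<mu> (\<lambda>x. ?I k x * exp (t * birkhoff F n x))"
        using integrable_real_mult_indicator[OF det_Collect_measurable[OF detT] Hol_integrable[OF Hol_exp_birkhoff]] by (simp add: mult.commute)
      have "exp (t * a - c0) = exp (t * a - (c0 - dF)) * exp (- dF)" by (simp add: exp_add[symmetric])
      then have "exp (t * a - c0) * gap * measure \<mu> {x \<in> X. T k x}
          = exp (t * a - (c0 - dF)) * (gap * measure \<mu> {x \<in> X. T k x} * exp (- dF))"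
        by (simp only: mult_ac)
      also have "\<dots> \<le> exp (t * a - (c0 - dF)) * (gap * measure \<mu> {x \<in> X. T k x} * (\<integral>x. ?q x \<partial>\<mu>))"
        using q1 gap_pos by (intro mult_left_mono) auto
      also have "\<dots> \<le> exp (t * a - (c0 - dF)) * (\<integral>x. ?I k x * ?q ((shift ^^ (k + G)) x) \<partial>\<mu>)"
        using qb unfolding integral_indicator_X[OF det_Collect_measurable[OF detT]] by (intro mult_left_mono) auto
      also have "\<dots> = (\<integral>x. exp (t * a - (c0 - dF)) * (?I k x * ?q ((shift ^^ (k + G)) x)) \<partial>\<mu>)" by simp
      also have "\<dots> \<le> (\<integral>x. ?I k x * exp (t * birkhoff F n x) \<partial>\<mu>)"
        using int1 int2 pt by (intro integral_mono_X integrable_mult_right) auto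
      finally show ?thesis .
    qed
    have intk: "integrable \<mu> (\<lambda>x. ?I k x * exp (t * birkhoff F n x))" for k
      using integrable_real_mult_indicator[OF det_Collect_measurable[OF detT] Hol_integrable[OF Hol_exp_birkhoff]] by (simp add: mult.commute)
    have "measure \<mu> {x \<in> X. \<exists>k\<le>n. Sd k x \<ge> a} \<le> (\<Sum>k\<le>n. measure \<mu> {x \<in> X. T k x})"
      unfolding set_eq using det_Collect_measurable[OF detT] by (intro measure_subadditive_finite) (auto simp: emeasure_eq_measure)
    then have "exp (t * a - c0) * gap * measure \<mu> {x \<in> X. \<exists>k\<le>n. Sd k x \<ge> a}
       \<le> exp (t * a - c0) * gap * (\<Sum>k\<le>n. measure \<mu> {x \<in> X. T k x})"
      using gap_pos by (intro mult_left_mono) auto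
    also have "\<dots> = (\<Sum>k\<le>n. exp (t * a - c0) * gap * measure \<mu> {x \<in> X. T k x})" by (rule sum_distrib_left)
    also have "\<dots> \<le> (\<Sum>k\<le>n. (\<integral>x. ?I k x * exp (t * birkhoff F n x) \<partial>\<mu>))" using piece by (intro sum_mono) auto
    also have "\<dots> = (\<integral>x. (\<Sum>k\<le>n. ?I k x * exp (t * birkhoff F n x)) \<partial>\<mu>)"
      by (rule Bochner_Integration.integral_sum[symmetric]) (rule intk)
    also have "\<dots> \<le> (\<integral>x. exp (t * birkhoff F n x) \<partial>\<mu>)"
    proof (rule integral_mono_X[OF _ Hol_integrable[OF Hol_exp_birkhoff]])
      show "integrable \<mu> (\<lambda>x. \<Sum>k\<le>n. ?I k x * exp (t * birkhoff F n x))"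
        by (rule Bochner_Integration.integrable_sum) (rule intk)
      fix x assume "x \<in> X"
      have "(\<Sum>k\<le>n. ?I k x) = (\<Sum>k\<le>n. if T k x then 1 else 0)"
        using \<open>x \<in> X\<close> by (intro sum.cong) (auto simp: indicator_def)
      also have "\<dots> = (\<Sum>k\<in>{k\<in>{..n}. T k x}. 1)"
        by (rule sum.inter_filter[symmetric]) simp
      also have "\<dots> \<le> 1"
      proof -
        have "k = l" if "T k x" "T l x" for k l
          using that unfolding T_def by (metis linorder_neqE_nat not_less)
        then have "card {k\<in>{..n}. T k x} \<le> 1" by (auto intro!: card_le_Suc0_iff_eq[THEN iffD2])
        then show ?thesis by simp
      qed
      finally have "(\<Sum>k\<le>n. ?I k x) \<le> 1" .
      then show "(\<Sum>k\<le>n. ?I k x * exp (t * birkhoff F n x)) \<le> exp (t * birkhoff F n x)"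
        using mult_right_mono[of "\<Sum>k\<le>n. ?I k x" 1 "exp (t * birkhoff F n x)"] by (simp add: sum_distrib_right)
    qed
    also have "\<dots> \<le> P * exp (real n * (\<rho> * t\<^sup>2 / 2 + c * \<bar>t\<bar> ^ 3))"
      using t by (intro exp_moment_upper) auto
    finally have "exp (t * a - c0) * gap * measure \<mu> {x \<in> X. \<exists>k\<le>n. Sd k x \<ge> a} \<le> P * exp (real n * (\<rho> * t\<^sup>2 / 2 + c * t ^ 3))"
      using t by simp
    then have "exp (- (t * a - c0)) * (exp (t * a - c0) * gap * measure \<mu> {x \<in> X. \<exists>k\<le>n. Sd k x \<ge> a})
        \<le> exp (- (t * a - c0)) * (P * exp (real n * (\<rho> * t\<^sup>2 / 2 + c * t ^ 3)))"
      by (intro mult_left_mono) auto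
    also have "exp (- (t * a - c0)) * (exp (t * a - c0) * gap * measure \<mu> {x \<in> X. \<exists>k\<le>n. Sd k x \<ge> a})
        = gap * measure \<mu> {x \<in> X. \<exists>k\<le>n. Sd k x \<ge> a}"
      unfolding mult.assoc[symmetric] exp_add[symmetric] by simp
    also have "exp (- (t * a - c0)) * (P * exp (real n * (\<rho> * t\<^sup>2 / 2 + c * t ^ 3)))
        = gap * (Q * exp (real n * (\<rho> * t\<^sup>2 / 2 + c * t ^ 3) - t * a))"
    proof -
      have e: "exp (- (t * a - c0)) * exp (real n * (\<rho> * t\<^sup>2 / 2 + c * t ^ 3))
          = exp c0 * exp (real n * (\<rho> * t\<^sup>2 / 2 + c * t ^ 3) - t * a)"
        unfolding exp_add[symmetric] by (rule arg_cong[of _ _ exp]) simp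
      have g: "gap * Q = P * exp c0" using gap_pos by (simp add: Q_def)
      show ?thesis unfolding mult.assoc[symmetric] g unfolding mult.left_commute[of _ P] mult.commute[of _ P]
        unfolding mult.assoc e ..
    qed
    finally show ?thesis using gap_pos by simp
  qed
  then show ?thesis using that Q1 by blast
qed

text \<open>Chernoff's bound. The tilt \<open>\<kappa> / sqrt \<rho> * lil_scale n\<close> minimises
  the quadratic exponent, with value \<open>- \<kappa>\<^sup>2 * ln (ln n)\<close>; the slack
  between \<open>\<theta>\<close> and \<open>\<kappa>\<^sup>2\<close> absorbs the factor
  \<open>Q\<close> and the cubic term.\<close>

lemma tail_upper:
  assumes "\<kappa> > 0" "\<theta> < \<kappa>\<^sup>2"
  shows "eventually (\<lambda>n. measure \<mu> {x \<in> X. \<exists>k\<le>n. Sd k x \<ge> \<kappa> * lil \<rho> (real n)} \<le> exp (- \<theta> * ln (ln (real n)))) sequentially"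
proof -
  obtain Q where Q: "Q \<ge> 1" "\<And>a t n. 0 \<le> t \<Longrightarrow> t \<le> t0 \<Longrightarrow>
    measure \<mu> {x \<in> X. \<exists>k\<le>n. Sd k x \<ge> a} \<le> Q * exp (real n * (\<rho> * t\<^sup>2 / 2 + c * t ^ 3) - t * a)"
    using maximal_inequality by blast
  define \<omega> where "\<omega> = \<kappa> / sqrt \<rho>"
  have l0: "\<omega> > 0" using assms rho by (simp add: \<omega>_def)
  have "(\<lambda>n. \<omega> * lil_scale n) \<longlonglongrightarrow> \<omega> * 0" by (intro tendsto_mult_left lil_scale_tendsto)
  then have ev1: "eventually (\<lambda>n. \<omega> * lil_scale n < t0) sequentially" using t0 by (intro order_tendstoD) auto
  have "(\<lambda>n. c * \<omega> ^ 3 * (real n * lil_scale n ^ 3)) \<longlonglongrightarrow> c * \<omega> ^ 3 * 0" by (intro tendsto_mult_left lil_scale_cube_tendsto)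
  then have ev2: "eventually (\<lambda>n. c * \<omega> ^ 3 * (real n * lil_scale n ^ 3) < 1) sequentially" by (intro order_tendstoD) auto
  have ev3: "eventually (\<lambda>n. ln Q + 1 \<le> (\<kappa>\<^sup>2 - \<theta>) * ln (ln (real n))) sequentially"
    using assms by (intro eventually_ln_ln_ge) auto
  have ev4: "eventually (\<lambda>n. 0 \<le> 1 * ln (ln (real n))) sequentially" by (intro eventually_ln_ln_ge) auto
  show ?thesis
    using ev1 ev2 ev3 ev4 eventually_gt_at_top[of 0]
  proof eventually_elim
    case (elim n)
    define t where "t = \<omega> * lil_scale n"
    define l where "l = ln (ln (real n))"
    have l: "l \<ge> 0" using elim by (simp add: l_def)
    have tt: "0 \<le> t" "t \<le> t0" using elim l0 by (auto simp: t_def lil_scale_def)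
    have eq: "lil \<rho> (real n) = sqrt \<rho> * (real n * lil_scale n)" "real n * (lil_scale n)\<^sup>2 = 2 * l"
      using lil_eq[of n \<rho>] elim rho by (auto simp: l_def)
    have t2: "real n * (\<rho> * t\<^sup>2 / 2) = \<kappa>\<^sup>2 * l"
    proof -
      have "real n * (\<rho> * t\<^sup>2 / 2) = (\<rho> * \<omega>\<^sup>2) / 2 * (real n * (lil_scale n)\<^sup>2)"
        by (simp add: t_def power_mult_distrib)
      then show ?thesis using rho by (simp add: eq(2) \<omega>_def power_divide)
    qed
    have ta: "t * (\<kappa> * lil \<rho> (real n)) = 2 * \<kappa>\<^sup>2 * l"
    proof -
      have "t * (\<kappa> * lil \<rho> (real n)) = (\<omega> * sqrt \<rho>) * \<kappa> * (real n * (lil_scale n)\<^sup>2)"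
        by (simp add: t_def eq(1) power2_eq_square)
      also have "\<omega> * sqrt \<rho> = \<kappa>" using rho by (simp add: \<omega>_def)
      finally show ?thesis unfolding eq(2) by (simp add: power2_eq_square mult_ac)
    qed
    have t3: "real n * (c * t ^ 3) \<le> 1"
    proof -
      have "real n * (c * t ^ 3) = c * \<omega> ^ 3 * (real n * lil_scale n ^ 3)" by (simp add: t_def power_mult_distrib)
      then show ?thesis using elim(2) by linarith
    qed
    have "real n * (\<rho> * t\<^sup>2 / 2 + c * t ^ 3) - t * (\<kappa> * lil \<rho> (real n)) + ln Q \<le> - \<theta> * l"
      using t2 ta t3 elim(3) unfolding l_def[symmetric] by (simp only: distrib_left left_diff_distrib)
    then have "exp (real n * (\<rho> * t\<^sup>2 / 2 + c * t ^ 3) - t * (\<kappa> * lil \<rho> (real n)) + ln Q) \<le> exp (- \<theta> * l)"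
      by simp
    then have "Q * exp (real n * (\<rho> * t\<^sup>2 / 2 + c * t ^ 3) - t * (\<kappa> * lil \<rho> (real n))) \<le> exp (- \<theta> * l)"
      using Q(1) by (simp add: exp_add mult.commute)
    then show ?case using Q(2)[OF tt, of n "\<kappa> * lil \<rho> (real n)"] unfolding l_def by linarith
  qed
qed

text \<open>Exponential tilting without a change of measure. At a tilt slightly beyond the Chernoff
  optimum, the moment is carried by values of \<open>Sd n\<close> between \<open>a\<close> and
  \<open>a'\<close>: the moments at \<open>(1 - \<eta>) * t\<close> and
  \<open>(1 + \<eta>) * t\<close> show that the outside contributes little. The window contributes
  at most \<open>exp (t * a')\<close> times the wanted probability.\<close>

lemma tail_lower:
  assumes "\<kappa> > 0" "\<kappa>\<^sup>2 < \<theta>"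
  shows "eventually (\<lambda>n. exp (- \<theta> * ln (ln (real n))) \<le> measure \<mu> {x \<in> X. Sd n x \<ge> \<kappa> * lil \<rho> (real n)}) sequentially"
proof -
  have "((\<lambda>\<delta>. (1 + 2 * \<delta>) * (1 + \<delta>)\<^sup>2 * \<kappa>\<^sup>2) \<longlongrightarrow> (1 + 2 * 0) * (1 + 0)\<^sup>2 * \<kappa>\<^sup>2) (at_right 0)"
    by (intro tendsto_intros)
  then have "eventually (\<lambda>\<delta>. (1 + 2 * \<delta>) * (1 + \<delta>)\<^sup>2 * \<kappa>\<^sup>2 < \<theta>) (at_right 0)"
    using assms by (intro order_tendstoD) auto
  then have "eventually (\<lambda>\<delta>. \<delta> > 0 \<and> (1 + 2 * \<delta>) * (1 + \<delta>)\<^sup>2 * \<kappa>\<^sup>2 < \<theta>) (at_right 0)"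
    by (intro eventually_conj eventually_at_right_less)
  then obtain \<delta> :: real where \<delta>: "\<delta> > 0" "(1 + 2 * \<delta>) * (1 + \<delta>)\<^sup>2 * \<kappa>\<^sup>2 < \<theta>"
    using eventually_happens trivial_limit_at_right_real by blast
  \<comment> \<open>Equivalently \<open>1 - \<eta> = 1 / (1 + \<delta>)\<close>. Under the tilt used
    below the values centre at \<open>(1 + \<delta>) * a\<close>, and \<open>a\<close> and
    \<open>a'\<close> lie a factor \<open>1 + \<delta>\<close> below and above this centre.\<close>
  define \<eta> where "\<eta> = \<delta> / (1 + \<delta>)"
  have \<eta>: "0 < \<eta>" "\<eta> < 1" "\<eta> \<le> \<delta>" using \<delta> by (auto simp: \<eta>_def field_simps)
  define \<omega> where "\<omega> = (1 + \<delta>) * \<kappa> / sqrt \<rho>"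
  have l0: "\<omega> > 0" using assms rho \<delta> by (simp add: \<omega>_def)
  define Q where "Q = P * exp dF"
  have Q1: "Q \<ge> 1" using P dF_nonneg mult_mono[of 1 P 1 "exp dF"] by (simp add: Q_def)
  have up: "(\<integral>x. exp (t * Sd n x) \<partial>\<mu>) \<le> Q * exp (real n * (\<rho> * t\<^sup>2 / 2 + c * \<bar>t\<bar> ^ 3))" if t: "\<bar>t\<bar> \<le> t0" for t n
  proof -
    have "(\<integral>x. exp (t * Sd n x) \<partial>\<mu>) \<le> exp dF * (\<integral>x. exp (t * birkhoff F n x) \<partial>\<mu>)"
      using t t0 by (intro exp_moment_Sd) auto
    also have "\<dots> \<le> exp dF * (P * exp (real n * (\<rho> * t\<^sup>2 / 2 + c * \<bar>t\<bar> ^ 3)))"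
      by (intro mult_left_mono exp_moment_upper t) auto
    finally show ?thesis by (simp add: Q_def mult_ac)
  qed
  have low: "exp (real n * (\<rho> * t\<^sup>2 / 2 - c * \<bar>t\<bar> ^ 3)) / Q \<le> (\<integral>x. exp (t * Sd n x) \<partial>\<mu>)" if t: "\<bar>t\<bar> \<le> t0" for t n
  proof -
    have "exp (real n * (\<rho> * t\<^sup>2 / 2 - c * \<bar>t\<bar> ^ 3)) / P \<le> exp dF * (\<integral>x. exp (t * Sd n x) \<partial>\<mu>)"
      using exp_moment_lower[OF t, of n] exp_moment_Sd(2)[of t n] t t0 by linarith
    then show ?thesis using P by (simp add: Q_def field_simps)
  qed
  have "(\<lambda>n. 2 * \<omega> * lil_scale n) \<longlonglongrightarrow> 2 * \<omega> * 0" by (intro tendsto_mult_left lil_scale_tendsto)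
  then have ev1: "eventually (\<lambda>n. 2 * \<omega> * lil_scale n < t0) sequentially" using t0 by (intro order_tendstoD) auto
  have "(\<lambda>n. 8 * c * \<omega> ^ 3 * (real n * lil_scale n ^ 3)) \<longlonglongrightarrow> 8 * c * \<omega> ^ 3 * 0"
    by (intro tendsto_mult_left lil_scale_cube_tendsto)
  then have ev2: "eventually (\<lambda>n. 8 * c * \<omega> ^ 3 * (real n * lil_scale n ^ 3) < 1) sequentially" by (intro order_tendstoD) auto
  have ev3: "eventually (\<lambda>n. ln (4 * Q\<^sup>2) + 2 \<le> (\<eta>\<^sup>2 * (\<kappa>\<^sup>2 * (1 + \<delta>)\<^sup>2)) * ln (ln (real n))) sequentially"
    using assms \<delta> \<eta> by (intro eventually_ln_ln_ge mult_pos_pos) auto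
  have ev4: "eventually (\<lambda>n. 0 \<le> 1 * ln (ln (real n))) sequentially" by (intro eventually_ln_ln_ge) auto
  have ev5: "eventually (\<lambda>n. 1 + ln (2 * Q) \<le> (\<theta> - (1 + 2 * \<delta>) * (1 + \<delta>)\<^sup>2 * \<kappa>\<^sup>2) * ln (ln (real n))) sequentially"
    using \<delta> by (intro eventually_ln_ln_ge) auto
  show ?thesis
    using ev1 ev2 ev3 ev4 ev5 eventually_gt_at_top[of 0]
  proof eventually_elim
    case (elim n)
    define t where "t = \<omega> * lil_scale n"
    define l where "l = ln (ln (real n))"
    \<comment> \<open>The second-order exponent at the tilt \<open>t\<close>. Since
      \<open>t * a'\<close> equals \<open>2 * (1 + \<delta>) * E\<close>, the final exponent
      \<open>E - t * a'\<close> is \<open>- (1 + 2 * \<delta>) * E\<close>, which explains the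
      condition on \<open>\<delta>\<close>.\<close>
    define E where "E = \<kappa>\<^sup>2 * (1 + \<delta>)\<^sup>2 * l"
    define a where "a = \<kappa> * lil \<rho> (real n)"
    define a' where "a' = (1 + \<delta>)\<^sup>2 * a"
    have l: "l \<ge> 0" using elim by (simp add: l_def)
    have E0: "E \<ge> 0" using l by (simp add: E_def)
    have s0: "lil_scale n \<ge> 0" using elim by (simp add: lil_scale_def)
    have tt: "0 \<le> t" "2 * t \<le> t0" using elim l0 s0 by (auto simp: t_def)
    have eq: "lil \<rho> (real n) = sqrt \<rho> * (real n * lil_scale n)" "real n * (lil_scale n)\<^sup>2 = 2 * l"
      using lil_eq[of n \<rho>] elim rho by (auto simp: l_def)
    have t2: "real n * (\<rho> * t\<^sup>2 / 2) = E"
    proof -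
      have "real n * (\<rho> * t\<^sup>2 / 2) = (\<rho> * \<omega>\<^sup>2) / 2 * (real n * (lil_scale n)\<^sup>2)"
        by (simp add: t_def power_mult_distrib)
      then show ?thesis using rho by (simp add: eq(2) \<omega>_def E_def power_divide power_mult_distrib)
    qed
    have ta: "(1 + \<delta>) * (t * a) = 2 * E"
    proof -
      have "t * a = (\<omega> * sqrt \<rho>) * \<kappa> * (real n * (lil_scale n)\<^sup>2)"
        by (simp add: t_def a_def eq(1) power2_eq_square)
      then show ?thesis using rho eq(2) by (simp add: \<omega>_def E_def power2_eq_square)
    qed
    have ta2: "\<eta> * (t * a) = 2 * \<eta> * E - 2 * \<eta>\<^sup>2 * E"
    proof -
      have h: "1 / (1 + \<delta>) = 1 - \<eta>" using \<delta> by (simp add: \<eta>_def field_simps)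
      have "t * a = 2 * E * (1 / (1 + \<delta>))" using ta \<delta> by (simp add: field_simps)
      then have "\<eta> * (t * a) = \<eta> * (2 * E * (1 - \<eta>))" unfolding h by simp
      then show ?thesis by (simp add: power2_eq_square algebra_simps)
    qed
    have ta3: "t * a' = 2 * (1 + \<delta>) * E"
      using ta unfolding a'_def power2_eq_square by (metis mult.assoc mult.commute)
    have t3: "real n * (c * (s * t) ^ 3) \<le> 1" if "0 \<le> s" "s \<le> 2" for s
    proof -
      have "real n * (c * (s * t) ^ 3) = s ^ 3 * (c * \<omega> ^ 3 * (real n * lil_scale n ^ 3))"
        by (simp add: t_def power_mult_distrib)
      also have "\<dots> \<le> 2 ^ 3 * (c * \<omega> ^ 3 * (real n * lil_scale n ^ 3))"
        using that c l0 s0 by (intro mult_right_mono power_mono) auto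
      also have "\<dots> = 8 * c * \<omega> ^ 3 * (real n * lil_scale n ^ 3)" by simp
      finally show ?thesis using elim(2) by linarith
    qed
    have Zt: "exp (E - 1) / Q \<le> (\<integral>x. exp (t * Sd n x) \<partial>\<mu>)"
    proof -
      have "exp (E - 1) / Q \<le> exp (real n * (\<rho> * t\<^sup>2 / 2 - c * \<bar>t\<bar> ^ 3)) / Q"
        using t3[of 1] t2 tt Q1 by (intro divide_right_mono) (auto simp: right_diff_distrib)
      then show ?thesis using low[of t n] tt by linarith
    qed
    have Zs: "(\<integral>x. exp ((s * t) * Sd n x) \<partial>\<mu>) \<le> Q * exp (s\<^sup>2 * E + 1)" if s: "0 \<le> s" "s \<le> 2" for s
    proof -
      have "s * t \<le> 2 * t" using s tt by (intro mult_right_mono) auto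
      then have st: "\<bar>s * t\<bar> \<le> t0" using tt s by simp
      have "real n * (\<rho> * (s * t)\<^sup>2 / 2) = s\<^sup>2 * E" using t2 by (simp add: power_mult_distrib mult_ac)
      then have "real n * (\<rho> * (s * t)\<^sup>2 / 2 + c * \<bar>s * t\<bar> ^ 3) \<le> s\<^sup>2 * E + 1"
        using t3[OF s] s tt by (simp add: distrib_left)
      then have "Q * exp (real n * (\<rho> * (s * t)\<^sup>2 / 2 + c * \<bar>s * t\<bar> ^ 3)) \<le> Q * exp (s\<^sup>2 * E + 1)"
        using Q1 by (intro mult_left_mono) auto
      then show ?thesis using up[OF st, of n] by linarith
    qed
    let ?I = "\<lambda>x. indicator {x \<in> X. Sd n x \<ge> a} x :: real"
    have detP: "det n (\<lambda>x. Sd n x \<ge> a)" by (rule det_comp[OF det_Sd])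
    \<comment> \<open>Three regions: below \<open>a\<close> a smaller tilt gives a bound, above
      \<open>a'\<close> a larger one does, and in between the indicator takes over.\<close>
    have pt: "exp (t * Sd n x) \<le> exp (\<eta> * (t * a)) * exp (((1 - \<eta>) * t) * Sd n x)
        + (exp (- \<eta> * (t * a')) * exp (((1 + \<eta>) * t) * Sd n x) + exp (t * a') * ?I x)" if x: "x \<in> X" for x
    proof -
      let ?A = "exp (\<eta> * (t * a)) * exp (((1 - \<eta>) * t) * Sd n x)"
      let ?B = "exp (- \<eta> * (t * a')) * exp (((1 + \<eta>) * t) * Sd n x)"
      let ?D = "exp (t * a') * ?I x"
      have pos: "?A \<ge> 0" "?B \<ge> 0" "?D \<ge> 0" by auto
      consider "Sd n x < a" | "Sd n x > a'" | "a \<le> Sd n x" "Sd n x \<le> a'" by linarith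
      then show ?thesis
      proof cases
        case 1
        have "(\<eta> * t) * Sd n x \<le> (\<eta> * t) * a" using 1 \<eta> tt by (intro mult_left_mono) auto
        then have "exp (t * Sd n x) \<le> ?A" by (simp add: exp_add[symmetric] algebra_simps)
        then show ?thesis using pos by linarith
      next
        case 2
        have "(\<eta> * t) * a' \<le> (\<eta> * t) * Sd n x" using 2 \<eta> tt by (intro mult_left_mono) auto
        then have "exp (t * Sd n x) \<le> ?B" by (simp add: exp_add[symmetric] algebra_simps)
        then show ?thesis using pos by linarith
      next
        case 3
        have "t * Sd n x \<le> t * a'" using 3 tt by (intro mult_left_mono) auto
        then have "exp (t * Sd n x) \<le> ?D" using 3 x by simp
        then show ?thesis using pos by linarith
      qed
    qed
    have iI: "integrable \<mu> ?I" by (rule det_integrable[OF det_indicator[OF detP]])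
    have iE: "integrable \<mu> (\<lambda>x. exp (s * Sd n x))" for s by (rule det_integrable[OF det_exp_Sd])
    have "(\<integral>x. exp (t * Sd n x) \<partial>\<mu>) \<le> (\<integral>x. exp (\<eta> * (t * a)) * exp (((1 - \<eta>) * t) * Sd n x)
        + (exp (- \<eta> * (t * a')) * exp (((1 + \<eta>) * t) * Sd n x) + exp (t * a') * ?I x) \<partial>\<mu>)"
      using pt iI iE by (intro integral_mono_X Bochner_Integration.integrable_add integrable_mult_right) auto
    also have "\<dots> = exp (\<eta> * (t * a)) * (\<integral>x. exp (((1 - \<eta>) * t) * Sd n x) \<partial>\<mu>)
        + (exp (- \<eta> * (t * a')) * (\<integral>x. exp (((1 + \<eta>) * t) * Sd n x) \<partial>\<mu>) + exp (t * a') * (\<integral>x. ?I x \<partial>\<mu>))"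
      using iI iE by simp
    also have "(\<integral>x. ?I x \<partial>\<mu>) = measure \<mu> {x \<in> X. Sd n x \<ge> a}"
      by (rule integral_indicator_X[OF det_Collect_measurable[OF detP]])
    finally have Z: "(\<integral>x. exp (t * Sd n x) \<partial>\<mu>) \<le> exp (\<eta> * (t * a)) * (\<integral>x. exp (((1 - \<eta>) * t) * Sd n x) \<partial>\<mu>)
        + (exp (- \<eta> * (t * a')) * (\<integral>x. exp (((1 + \<eta>) * t) * Sd n x) \<partial>\<mu>) + exp (t * a') * measure \<mu> {x \<in> X. Sd n x \<ge> a})" .
    have one: "exp (\<eta> * (t * a)) * (\<integral>x. exp (((1 - \<eta>) * t) * Sd n x) \<partial>\<mu>) \<le> Q * exp ((1 - \<eta>\<^sup>2) * E + 1)"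
    proof -
      have "exp (\<eta> * (t * a)) * (\<integral>x. exp (((1 - \<eta>) * t) * Sd n x) \<partial>\<mu>) \<le> exp (\<eta> * (t * a)) * (Q * exp ((1 - \<eta>)\<^sup>2 * E + 1))"
        using \<eta> by (intro mult_left_mono Zs) auto
      also have "\<dots> = Q * exp (\<eta> * (t * a) + ((1 - \<eta>)\<^sup>2 * E + 1))" unfolding exp_add by (simp only: mult_ac)
      also have "\<eta> * (t * a) + ((1 - \<eta>)\<^sup>2 * E + 1) = (1 - \<eta>\<^sup>2) * E + 1"
        unfolding ta2 by (simp add: power2_eq_square algebra_simps)
      finally show ?thesis .
    qed
    have two: "exp (- \<eta> * (t * a')) * (\<integral>x. exp (((1 + \<eta>) * t) * Sd n x) \<partial>\<mu>) \<le> Q * exp ((1 - \<eta>\<^sup>2) * E + 1)"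
    proof -
      have "exp (- \<eta> * (t * a')) * (\<integral>x. exp (((1 + \<eta>) * t) * Sd n x) \<partial>\<mu>) \<le> exp (- \<eta> * (t * a')) * (Q * exp ((1 + \<eta>)\<^sup>2 * E + 1))"
        using \<eta> by (intro mult_left_mono Zs) auto
      also have "\<dots> = Q * exp (- \<eta> * (t * a') + ((1 + \<eta>)\<^sup>2 * E + 1))" unfolding exp_add by (simp only: mult_ac)
      also have "\<dots> \<le> Q * exp ((1 - \<eta>\<^sup>2) * E + 1)"
      proof -
        have "\<eta> * \<eta> * E \<le> \<eta> * \<delta> * E" using \<eta> E0 by (intro mult_right_mono mult_left_mono) auto
        then have "- \<eta> * (t * a') + ((1 + \<eta>)\<^sup>2 * E + 1) \<le> (1 - \<eta>\<^sup>2) * E + 1"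
          unfolding ta3 by (simp add: power2_eq_square algebra_simps)
        then show ?thesis using Q1 by (intro mult_left_mono) auto
      qed
      finally show ?thesis .
    qed
    have small: "2 * (Q * exp ((1 - \<eta>\<^sup>2) * E + 1)) \<le> exp (E - 1) / (2 * Q)"
    proof -
      have "ln (4 * Q\<^sup>2) + 2 \<le> \<eta>\<^sup>2 * E" using elim(3) unfolding E_def l_def by (simp add: mult_ac)
      then have "exp (ln (4 * Q\<^sup>2) + ((1 - \<eta>\<^sup>2) * E + 1)) \<le> exp (E - 1)" by (simp add: algebra_simps)
      then have "4 * Q\<^sup>2 * exp ((1 - \<eta>\<^sup>2) * E + 1) \<le> exp (E - 1)"
        using Q1 unfolding exp_add[of "ln (4 * Q\<^sup>2)"] by simp
      then show ?thesis using Q1 by (simp add: field_simps power2_eq_square)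
    qed
    have half: "exp (E - 1) / Q = 2 * (exp (E - 1) / (2 * Q))" by simp
    have "exp (E - 1) / (2 * Q) \<le> exp (t * a') * measure \<mu> {x \<in> X. Sd n x \<ge> a}"
      using Zt Z one two small half by linarith
    then have "exp (- (t * a')) * (exp (E - 1) / (2 * Q)) \<le> exp (- (t * a')) * (exp (t * a') * measure \<mu> {x \<in> X. Sd n x \<ge> a})"
      by (intro mult_left_mono) auto
    then have "exp (- (t * a')) * (exp (E - 1) / (2 * Q)) \<le> measure \<mu> {x \<in> X. Sd n x \<ge> a}"
      unfolding mult.assoc[symmetric, of _ "exp (t * a')"] exp_add[symmetric] by simp
    moreover have "exp (- (t * a')) * (exp (E - 1) / (2 * Q)) = exp (E - 1 - t * a' - ln (2 * Q))"
    proof -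
      have "exp (- ln (2 * Q)) = 1 / (2 * Q)" using Q1 by (simp add: exp_minus inverse_eq_divide)
      then have "exp (- (t * a')) * (exp (E - 1) / (2 * Q)) = exp (- (t * a')) * (exp (E - 1) * exp (- ln (2 * Q)))" by simp
      also have "\<dots> = exp (E - 1 - t * a' - ln (2 * Q))"
        unfolding exp_add[symmetric] by (rule arg_cong[of _ _ exp]) simp
      finally show ?thesis .
    qed
    moreover have "- \<theta> * l \<le> E - 1 - t * a' - ln (2 * Q)"
    proof -
      have "E - t * a' = - ((1 + 2 * \<delta>) * (1 + \<delta>)\<^sup>2 * \<kappa>\<^sup>2 * l)"
        unfolding ta3 by (simp add: E_def algebra_simps)
      then show ?thesis using elim(5) unfolding l_def[symmetric] left_diff_distrib by linarith
    qed
    ultimately have "exp (- \<theta> * l) \<le> measure \<mu> {x \<in> X. Sd n x \<ge> a}"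
      by (smt (verit, best) exp_le_cancel_iff)
    then show ?case unfolding l_def a_def .
  qed
qed

end

lemma frequently_compose_sequentially:
  fixes f :: "nat \<Rightarrow> nat"
  assumes "frequently (\<lambda>k. Q (f k)) sequentially" "filterlim f sequentially sequentially"
  shows "frequently Q sequentially"
proof (rule ccontr)
  assume "\<not> frequently Q sequentially"
  then have "eventually (\<lambda>n. \<not> Q n) sequentially" by (simp add: frequently_def)
  then have "eventually (\<lambda>k. \<not> Q (f k)) sequentially" using assms(2) by (rule eventually_compose_filterlim)
  then show False using assms(1) by (simp add: frequently_def)
qed

section \<open>Almost sure upper and lower bounds\<close>

context gibbs_observable
begin

lemma det_ex_Sd: "det n (\<lambda>x. \<exists>k\<le>n. Sd k x \<ge> a)"
  unfolding det_def
proof (intro ballI impI)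
  fix x y assume xy: "x \<in> X" "y \<in> X" "agree n x y"
  have "Sd j x = Sd j y" if "j \<le> n" for j
    using xy that by (intro detD[OF det_Sd]) (auto intro: agree_mono)
  then show "(\<exists>k\<le>n. Sd k x \<ge> a) = (\<exists>k\<le>n. Sd k y \<ge> a)" by auto
qed

lemma lil_ratio_sequentially:
  assumes "q > 0" shows "(\<lambda>n. lil \<rho> (q * real n + r) / lil \<rho> (real n)) \<longlonglongrightarrow> sqrt q"
  using filterlim_compose[OF lil_ratio[OF assms rho] filterlim_real_sequentially] .

lemma const_over_lil: "((\<lambda>y. r / lil \<rho> y) \<longlongrightarrow> 0) at_top"
  by (rule tendsto_divide_0[OF tendsto_const filterlim_at_top_imp_at_infinity[OF lil_at_top[OF rho]]])

text \<open>The tail bound at geometric times, with Borel-Cantelli. Because it controls the running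
  maximum, times in between are covered by the next geometric time, at the cost of the factor
  \<open>sqrt q\<close> from \<open>lil_ratio\<close>.\<close>

lemma lil_upper:
  assumes "\<kappa> > 1"
  shows "AE x in \<mu>. eventually (\<lambda>n. birkhoff F n x \<le> \<kappa> * lil \<rho> (real n)) sequentially"
proof -
  define \<kappa>' where "\<kappa>' = (1 + \<kappa>) / 2"
  have k': "1 < \<kappa>'" "\<kappa>' < \<kappa>" using assms by (auto simp: \<kappa>'_def)
  define \<theta> where "\<theta> = (1 + \<kappa>'\<^sup>2) / 2"
  have "1 < \<kappa>'\<^sup>2" using k' by (simp add: power2_eq_square less_1_mult)
  then have th: "1 < \<theta>" "\<theta> < \<kappa>'\<^sup>2" by (auto simp: \<theta>_def)
  \<comment> \<open>Chosen so that
    \<open>\<kappa>' * sqrt q < \<kappa>' * q = \<kappa>\<close>.\<close>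
  define q where "q = \<kappa> / \<kappa>'"
  have q: "q > 1" using k' by (simp add: q_def)
  define N where "N k = nat \<lceil>q ^ k\<rceil>" for k
  have N_ge: "q ^ k \<le> real (N k)" for k unfolding N_def by (rule real_nat_ceiling_ge)
  have N_le: "real (N k) \<le> q ^ k + 1" for k
  proof -
    have "0 \<le> q ^ k" using q by simp
    then have "real (N k) = of_int \<lceil>q ^ k\<rceil>" unfolding N_def by (simp add: ceiling_le_zero not_less order_trans[OF _ le_of_int_ceiling] flip: of_int_0_le_iff)
    then show ?thesis by linarith
  qed
  have "filterlim (\<lambda>k. q ^ k) at_top sequentially" using q by real_asymp
  then have "filterlim (\<lambda>k. real (N k)) at_top sequentially"
    by (rule filterlim_at_top_mono) (intro always_eventually allI N_ge)
  then have N_top: "filterlim N sequentially sequentially" by (simp add: filterlim_sequentially_iff_filterlim_real)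
  define A where "A k = {x \<in> X. \<exists>j\<le>N k. Sd j x \<ge> \<kappa>' * lil \<rho> (real (N k))}" for k
  have A_sets: "A k \<in> sets \<mu>" for k unfolding A_def by (rule det_Collect_measurable[OF det_ex_Sd])
  have lq: "ln q > 0" using q by simp
  have "eventually (\<lambda>k. measure \<mu> (A k) \<le> exp (- \<theta> * ln (ln (real (N k))))) sequentially"
    unfolding A_def by (rule eventually_compose_filterlim[OF tail_upper N_top]) (use k' th in auto)
  \<comment> \<open>The iterated logarithm of \<open>q ^ k\<close> is about \<open>ln k\<close>, so
    the tail bound is of order \<open>k powr (- \<theta>)\<close> with
    \<open>\<theta> > 1\<close>.\<close>
  then have evA: "eventually (\<lambda>k. norm (measure \<mu> (A k)) \<le> ln q powr (- \<theta>) * real k powr (- \<theta>)) sequentially"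
    using eventually_gt_at_top[of 0]
  proof eventually_elim
    case (elim k)
    have pos: "real k * ln q > 0" using elim lq by simp
    have "real k * ln q = ln (q ^ k)" using q by (simp add: ln_realpow)
    also have "\<dots> \<le> ln (real (N k))" using N_ge[of k] less_le_trans[OF _ N_ge[of k], of 0] q by (subst ln_le_cancel_iff) auto
    finally have "ln (real k * ln q) \<le> ln (ln (real (N k)))" using pos by (subst ln_le_cancel_iff) auto
    then have "\<theta> * ln (real k * ln q) \<le> \<theta> * ln (ln (real (N k)))" using th by (intro mult_left_mono) auto
    then have "exp (- \<theta> * ln (ln (real (N k)))) \<le> exp (- \<theta> * ln (real k * ln q))" by simp
    also have "\<dots> = (real k * ln q) powr (- \<theta>)" by (simp only: powr_def pos[THEN less_imp_neq, symmetric] if_False)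
    also have "\<dots> = ln q powr (- \<theta>) * real k powr (- \<theta>)" using lq by (simp add: powr_mult mult.commute)
    finally show ?case using elim(1) by simp
  qed
  have "summable (\<lambda>k. ln q powr (- \<theta>) * real k powr (- \<theta>))"
    using th by (intro summable_mult) (simp add: summable_real_powr_iff)
  then have "summable (\<lambda>k. measure \<mu> (A k))" by (rule summable_comparison_test_ev[OF evA])
  then have bc: "AE x in \<mu>. eventually (\<lambda>k. x \<in> space \<mu> - A k) sequentially"
    by (intro borel_cantelli_AE1 A_sets) (auto simp: emeasure_eq_measure)
  \<comment> \<open>Index of a geometric time that is at least \<open>n\<close> and at most about
    \<open>q * n\<close>.\<close>
  define K where "K n = nat \<lceil>log q (real n)\<rceil>" for n
  have "filterlim (\<lambda>n. log q (real n)) at_top sequentially"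
    using q unfolding log_def by real_asymp
  then have "filterlim (\<lambda>n. real (K n)) at_top sequentially"
    by (rule filterlim_at_top_mono) (auto simp: K_def real_nat_ceiling_ge)
  then have K_top: "filterlim K sequentially sequentially" by (simp add: filterlim_sequentially_iff_filterlim_real)
  have NK: "real n \<le> real (N (K n)) \<and> real (N (K n)) \<le> q * real n + 1" if "n \<ge> 1" for n
  proof
    have n0: "real n > 0" "log q (real n) \<ge> 0" using that q by auto
    have "real n = q powr log q (real n)" using n0 q by simp
    also have "\<dots> \<le> q powr real (K n)" using q unfolding K_def by (intro powr_mono real_nat_ceiling_ge) auto
    also have "\<dots> = q ^ K n" using q by (simp add: powr_realpow)
    finally show "real n \<le> real (N (K n))" using N_ge[of "K n"] by linarith
    have "real (K n) = of_int \<lceil>log q (real n)\<rceil>"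
      unfolding K_def using n0 by (intro of_nat_nat) simp
    then have "real (K n) \<le> log q (real n) + 1" by linarith
    then have "q powr real (K n) \<le> q powr (log q (real n) + 1)" using q by (intro powr_mono) auto
    also have "\<dots> = q * real n" using n0 q by (simp add: powr_add)
    finally have "q ^ K n \<le> q * real n" using q by (simp add: powr_realpow)
    then show "real (N (K n)) \<le> q * real n + 1" using N_le[of "K n"] by linarith
  qed
  have "(\<lambda>n. \<kappa>' * (lil \<rho> (q * real n + 1) / lil \<rho> (real n)) + dF / lil \<rho> (real n)) \<longlonglongrightarrow> \<kappa>' * sqrt q + 0"
    using q by (intro tendsto_add tendsto_mult_left lil_ratio_sequentially filterlim_compose[OF const_over_lil filterlim_real_sequentially]) auto
  moreover have "\<kappa>' * sqrt q + 0 < \<kappa>"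
  proof -
    have "q < q\<^sup>2" using q by (simp add: power2_eq_square)
    then have "sqrt q < sqrt (q\<^sup>2)" by (rule real_sqrt_less_mono)
    then have "sqrt q < q" using q by simp
    then have "\<kappa>' * sqrt q < \<kappa>' * q" using k' by (intro mult_strict_left_mono) auto
    then show ?thesis using k' by (simp add: q_def)
  qed
  ultimately have "eventually (\<lambda>n. \<kappa>' * (lil \<rho> (q * real n + 1) / lil \<rho> (real n)) + dF / lil \<rho> (real n) < \<kappa>) sequentially"
    by (rule order_tendstoD)
  then have ev: "eventually (\<lambda>n. \<kappa>' * lil \<rho> (q * real n + 1) + dF \<le> \<kappa> * lil \<rho> (real n)) sequentially"
    using eventually_compose_filterlim[OF lil_eventually_pos[OF rho] filterlim_real_sequentially]
  proof eventually_elim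
    case (elim n)
    then have "(\<kappa>' * lil \<rho> (q * real n + 1) + dF) / lil \<rho> (real n) < \<kappa>" by (simp add: add_divide_distrib)
    then show ?case using elim(2) by (simp add: pos_divide_less_eq)
  qed
  show ?thesis
    using bc AE_space
  proof eventually_elim
    case (elim x)
    then have x: "x \<in> X" by (simp add: space_\<mu>)
    have "eventually (\<lambda>n. x \<in> space \<mu> - A (K n)) sequentially"
      using elim(1) K_top by (rule eventually_compose_filterlim)
    then show ?case
      using ev eventually_ge_at_top[of 3]
    proof eventually_elim
      case (elim n)
      have nk: "real n \<le> real (N (K n))" "real (N (K n)) \<le> q * real n + 1" using NK[of n] elim by auto
      have "Sd n x < \<kappa>' * lil \<rho> (real (N (K n)))"
        using elim(1) x nk(1) by (auto simp: A_def not_le dest!: spec[of _ n])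
      also have "\<dots> \<le> \<kappa>' * lil \<rho> (q * real n + 1)"
        using k' rho nk elim(3) exp_le by (intro mult_left_mono lil_mono) auto
      finally have "Sd n x < \<kappa>' * lil \<rho> (q * real n + 1)" .
      then show ?case using elim(2) Sd_close[OF x, of n] by (simp add: abs_le_iff)
    qed
  qed
qed

text \<open>Replacing \<open>t\<close> by \<open>- t\<close> exchanges \<open>F\<close> and
  \<open>- F\<close> in the moment bounds. The upper law for \<open>- F\<close> then bounds initial
  segments from below in \<open>lil_lower\<close>.\<close>

lemma gibbs_observable_minus: "gibbs_observable K A G \<mu> \<phi> \<alpha> \<Phi> b C (\<lambda>x. - F x) B\<^sub>F \<rho> t0 P c"
proof (unfold_locales)
  show "hol B\<^sub>F (\<lambda>x. - F x)"
    using holD[OF hol_F] by (intro holI) (fastforce simp: abs_minus_commute)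
  show "(\<integral>x. - F x \<partial>\<mu>) = 0" using mean_F by simp
  fix t n assume t: "\<bar>t\<bar> \<le> t0"
  show "(\<integral>x. exp (t * birkhoff (\<lambda>x. - F x) n x) \<partial>\<mu>) \<le> P * exp (real n * (\<rho> * t\<^sup>2 / 2 + c * \<bar>t\<bar> ^ 3))"
    using exp_moment_upper[of "- t" n] t by (simp add: birkhoff_minus)
  show "exp (real n * (\<rho> * t\<^sup>2 / 2 - c * \<bar>t\<bar> ^ 3)) / P \<le> (\<integral>x. exp (t * birkhoff (\<lambda>x. - F x) n x) \<partial>\<mu>)"
    using exp_moment_lower[of "- t" n] t by (simp add: birkhoff_minus)
qed (use rho t0 P c in auto)

lemma lil_upper_minus:
  "AE x in \<mu>. eventually (\<lambda>n. - birkhoff F n x \<le> 2 * lil \<rho> (real n)) sequentially"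
  using gibbs_observable.lil_upper[OF gibbs_observable_minus, of 2] by (simp add: birkhoff_minus)

text \<open>Along \<open>q ^ k\<close> with large \<open>q\<close>, the block increments are large infinitely often, because they are
  nearly independent after deleting a gap of length \<open>G\<close>.\<close>

lemma lil_lower:
  assumes "0 < \<kappa>" "\<kappa> < 1"
  shows "AE x in \<mu>. frequently (\<lambda>n. birkhoff F n x \<ge> \<kappa> * lil \<rho> (real n)) sequentially"
proof -
  define \<kappa>' where "\<kappa>' = (1 + \<kappa>) / 2"
  have k': "0 < \<kappa>'" "\<kappa>' < 1" "\<kappa> < \<kappa>'" using assms by (auto simp: \<kappa>'_def)
  define \<theta> where "\<theta> = (1 + \<kappa>'\<^sup>2) / 2"
  have "\<kappa>'\<^sup>2 < 1" using k' power_strict_mono[of \<kappa>' 1 2] by simp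
  then have th: "\<kappa>'\<^sup>2 < \<theta>" "\<theta> < 1" "\<theta> > 0" by (auto simp: \<theta>_def add_pos_nonneg)
  obtain R where R: "R > 0" "\<And>x n. x \<in> X \<Longrightarrow> \<bar>birkhoff F n x\<bar> \<le> real n * R" using F_bounded by blast
  define D where "D = real G * R + dF"
  \<comment> \<open>For large \<open>q\<close> the block from \<open>q ^ k\<close> to
    \<open>q ^ Suc k\<close> fills the proportion \<open>1 - 1 / q\<close> of the time, while the
    initial segment is at least \<open>- 2 * lil \<rho> (q ^ k)\<close>. As \<open>q\<close> grows
    the combined coefficient tends to \<open>\<kappa>'\<close>, which exceeds
    \<open>\<kappa>\<close>.\<close>
  have "(\<lambda>q. \<kappa>' * sqrt (1 - 1 / real q) - 2 * sqrt (1 / real q)) \<longlonglongrightarrow> \<kappa>' * sqrt (1 - 0) - 2 * sqrt 0"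
    by (intro tendsto_intros lim_1_over_n)
  then have "eventually (\<lambda>q. \<kappa>' * sqrt (1 - 1 / real q) - 2 * sqrt (1 / real q) > \<kappa>) sequentially"
    using k' by (intro order_tendstoD) auto
  then have "eventually (\<lambda>q. q \<ge> 2 \<and> \<kappa>' * sqrt (1 - 1 / real q) - 2 * sqrt (1 / real q) > \<kappa>) sequentially"
    by (intro eventually_conj eventually_ge_at_top)
  then obtain q :: nat where q: "q \<ge> 2" "\<kappa>' * sqrt (1 - 1 / real q) - 2 * sqrt (1 / real q) > \<kappa>"
    using eventually_happens trivial_limit_sequentially by blast
  \<comment> \<open>Block length after removal of the gap; the truncated subtraction is exact for
    \<open>k \<ge> G\<close> by \<open>d_eq\<close>.\<close>
  define d where "d k = q ^ Suc k - q ^ k - G" for k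
  define V where "V k x \<longleftrightarrow> Sd (d k) x \<ge> \<kappa>' * lil \<rho> (real (d k))" for k x
  have detV: "det (d k) (V k)" for k unfolding V_def by (rule det_comp[OF det_Sd])
  have qk: "k < q ^ k" for k using q by (simp add: less_exp power_gt_expt)
  have d_ge: "q ^ Suc k \<ge> q ^ k + q ^ k" for k
  proof -
    have "2 * q ^ k \<le> q * q ^ k" using q(1) by (rule mult_right_mono) simp
    then show ?thesis by (simp only: power_Suc mult_2)
  qed
  have d_eq: "q ^ k + G + d k = q ^ Suc k" "d k \<ge> k - G" if "k \<ge> G" for k
    using d_ge[of k] qk[of k] that by (auto simp: d_def)
  have "filterlim (\<lambda>k. k - G) sequentially sequentially" by (rule filterlim_minus_const_nat_at_top)
  moreover have "eventually (\<lambda>k. k - G \<le> d k) sequentially"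
    using eventually_ge_at_top[of G] by eventually_elim (rule d_eq)
  ultimately have d_top: "filterlim d sequentially sequentially" by (rule filterlim_at_top_mono)
  define g where "g k = gap * measure \<mu> {x \<in> X. V k x}" for k
  have g01: "0 \<le> g k" "g k \<le> 1" for k
    using gap_pos gap_le_1 prob_le_1[of "{x \<in> X. V k x}"] by (auto simp: g_def intro!: mult_le_one)
  have lq: "ln (real q) > 0" using q by simp
  \<comment> \<open>A block succeeds with probability at least a constant times
    \<open>k powr (- \<theta>)\<close>, now with \<open>\<theta> < 1\<close>.\<close>
  have not_summable: "\<not> summable g"
  proof
    assume sg: "summable g"
    have "eventually (\<lambda>k. exp (- \<theta> * ln (ln (real (d k)))) \<le> measure \<mu> {x \<in> X. V k x}) sequentially"
      unfolding V_def by (rule eventually_compose_filterlim[OF tail_lower d_top]) (use k' th in auto)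
    moreover have "eventually (\<lambda>k. d k \<ge> 2) sequentially"
      using d_top by (auto simp: filterlim_at_top)
    ultimately have "eventually (\<lambda>k. norm (real (Suc k) powr (- \<theta>)) \<le> g k / (gap * ln (real q) powr (- \<theta>))) sequentially"
    proof eventually_elim
      case (elim k)
      have ld: "ln (real (d k)) > 0" using elim by simp
      have "real (d k) \<le> real (q ^ Suc k)" unfolding of_nat_le_iff d_def by simp
      then have "ln (real (d k)) \<le> ln (real (q ^ Suc k))" using elim q by (subst ln_le_cancel_iff) auto
      also have "\<dots> = real (Suc k) * ln (real q)" using q unfolding of_nat_power by (subst ln_realpow) auto
      finally have le: "ln (real (d k)) \<le> real (Suc k) * ln (real q)" .
      have pos: "real (Suc k) * ln (real q) > 0" using lq by simp
      have "ln (ln (real (d k))) \<le> ln (real (Suc k) * ln (real q))" using le ld pos by (subst ln_le_cancel_iff) auto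
      then have "\<theta> * ln (ln (real (d k))) \<le> \<theta> * ln (real (Suc k) * ln (real q))" using th by (intro mult_left_mono) auto
      then have "exp (- \<theta> * ln (real (Suc k) * ln (real q))) \<le> exp (- \<theta> * ln (ln (real (d k))))" by simp
      moreover have "exp (- \<theta> * ln (real (Suc k) * ln (real q))) = (real (Suc k) * ln (real q)) powr (- \<theta>)"
        by (simp only: powr_def pos[THEN less_imp_neq, symmetric] if_False)
      moreover have "(real (Suc k) * ln (real q)) powr (- \<theta>) = real (Suc k) powr (- \<theta>) * ln (real q) powr (- \<theta>)"
        by (rule powr_mult)
      ultimately have "real (Suc k) powr (- \<theta>) * ln (real q) powr (- \<theta>) \<le> measure \<mu> {x \<in> X. V k x}"
        using elim(1) by linarith
      then have "gap * (real (Suc k) powr (- \<theta>) * ln (real q) powr (- \<theta>)) \<le> g k"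
        unfolding g_def using gap_pos by (intro mult_left_mono) auto
      then show ?case using gap_pos lq by (simp add: pos_le_divide_eq mult_ac)
    qed
    moreover have "summable (\<lambda>k. g k / (gap * ln (real q) powr (- \<theta>)))" by (rule summable_divide[OF sg])
    ultimately have "summable (\<lambda>k. real (Suc k) powr (- \<theta>))" by (rule summable_comparison_test_ev)
    then have "summable (\<lambda>k. real k powr (- \<theta>))" by (subst (asm) summable_Suc_iff)
    then show False using th by (simp add: summable_real_powr_iff)
  qed
  \<comment> \<open>The second Borel-Cantelli lemma in product form: by \<open>prob_avoid\<close>,
    failing at all blocks from \<open>k0\<close> on has probability at most the exponential of minus
    every partial sum of \<open>g\<close>.\<close>
  have inf_often: "AE x in \<mu>. \<exists>j. V (k0 + j) ((shift ^^ (q ^ (k0 + j) + G)) x)" if k0: "k0 \<ge> G" for k0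
  proof -
    let ?W = "\<lambda>j x. V (k0 + j) ((shift ^^ (q ^ (k0 + j) + G)) x)"
    let ?E = "\<lambda>J. {x \<in> X. \<forall>j<J. \<not> ?W j x}"
    define Z where "Z = {x \<in> X. \<forall>j. \<not> ?W j x}"
    have W_sets: "{x \<in> X. ?W j x} \<in> sets \<mu>" for j
      by (rule det_Collect_measurable[OF det_shift[OF detV]])
    have E_sets: "?E J \<in> sets \<mu>" for J
    proof -
      have "?E J = X - (\<Union>j<J. {x \<in> X. ?W j x})" by auto
      then show ?thesis using W_sets sets.top[of \<mu>] by (auto simp: space_\<mu>)
    qed
    have "Z = X - (\<Union>j. {x \<in> X. ?W j x})" by (auto simp: Z_def)
    then have Z_sets: "Z \<in> sets \<mu>" using W_sets sets.top[of \<mu>] by (auto simp: space_\<mu>)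
    have bound: "measure \<mu> Z \<le> exp (- (\<Sum>j<J. g (j + k0)))" for J
    proof -
      have "measure \<mu> Z \<le> measure \<mu> (?E J)"
        by (rule finite_measure_mono[OF _ E_sets]) (auto simp: Z_def)
      also have "\<dots> \<le> measure \<mu> {x \<in> X. True} * (\<Prod>j<J. 1 - gap * measure \<mu> {x \<in> X. V (k0 + j) x})"
      proof -
        have "measure \<mu> {x \<in> X. True \<and> (\<forall>j<J. \<not> ?W j x)} \<le> measure \<mu> {x \<in> X. True} * (\<Prod>j<J. 1 - gap * measure \<mu> {x \<in> X. V (k0 + j) x})"
        proof (rule prob_avoid[where ?n0.0 = 0 and l = "\<lambda>j. d (k0 + j)"])
          show "q ^ (k0 + j) + G + d (k0 + j) + G \<le> q ^ (k0 + Suc j) + G" for j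
            using d_eq(1)[of "k0 + j"] k0 by simp
          show "det 0 (\<lambda>x. True)" by (simp add: det_def)
          show "det (d (k0 + j)) (V (k0 + j))" for j by (rule detV)
        qed simp
        then show ?thesis by simp
      qed
      also have "\<dots> \<le> 1 * (\<Prod>j<J. exp (- g (j + k0)))"
      proof (intro mult_mono prod_mono conjI)
        fix j
        show "0 \<le> 1 - gap * measure \<mu> {x \<in> X. V (k0 + j) x}" using g01(2)[of "k0 + j"] by (simp add: g_def)
        show "1 - gap * measure \<mu> {x \<in> X. V (k0 + j) x} \<le> exp (- g (j + k0))"
          using exp_ge_add_one_self[of "- g (j + k0)"] by (simp add: g_def add.commute)
      qed (use g01(2) in \<open>auto intro!: prod_nonneg simp: g_def\<close>)
      also have "\<dots> = exp (- (\<Sum>j<J. g (j + k0)))" by (simp add: exp_sum flip: sum_negf)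
      finally show ?thesis .
    qed
    have "measure \<mu> Z = 0"
    proof (rule ccontr)
      assume "measure \<mu> Z \<noteq> 0"
      then have mz: "measure \<mu> Z > 0" by (simp add: zero_less_measure_iff)
      have le: "(\<Sum>j<J. g (j + k0)) \<le> - ln (measure \<mu> Z)" for J
      proof -
        have "ln (measure \<mu> Z) \<le> ln (exp (- (\<Sum>j<J. g (j + k0))))" using bound[of J] mz by (subst ln_le_cancel_iff) auto
        then show ?thesis by simp
      qed
      have "summable (\<lambda>j. g (j + k0))"
      proof (rule bounded_imp_summable[OF g01(1)])
        show "(\<Sum>j\<le>n. g (j + k0)) \<le> - ln (measure \<mu> Z)" for n
          using le[of "Suc n"] unfolding lessThan_Suc_atMost .
      qed
      then have "summable g" by (simp add: summable_iff_shift)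
      then show False using not_summable by simp
    qed
    then have "Z \<in> null_sets \<mu>" using Z_sets by (simp add: null_sets_def emeasure_eq_measure)
    then have "AE x in \<mu>. x \<notin> Z" by (rule AE_not_in)
    then show ?thesis using AE_space by eventually_elim (auto simp: Z_def space_\<mu>)
  qed
  have all: "AE x in \<mu>. \<forall>k0\<ge>G. \<exists>j. V (k0 + j) ((shift ^^ (q ^ (k0 + j) + G)) x)"
    using inf_often by (subst AE_all_countable) (auto simp: AE_all_countable)
  have y_top: "filterlim (\<lambda>k. real (q ^ Suc k)) at_top sequentially"
  proof (rule filterlim_at_top_mono[OF filterlim_real_sequentially])
    have "k \<le> q ^ Suc k" for k using qk[of "Suc k"] by linarith
    then show "eventually (\<lambda>k. real k \<le> real (q ^ Suc k)) sequentially"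
      unfolding of_nat_le_iff by (intro always_eventually allI)
  qed
  define r where "r = 1 - 1 / real q"
  have r0: "r > 0" using q by (simp add: r_def)
  have q0: "1 / real q > 0" using q by simp
  have lim: "((\<lambda>y. \<kappa>' * (lil \<rho> (r * y + (- real G)) / lil \<rho> y) - 2 * (lil \<rho> ((1 / real q) * y + 0) / lil \<rho> y) - D / lil \<rho> y)
       \<longlongrightarrow> \<kappa>' * sqrt r - 2 * sqrt (1 / real q) - 0) at_top"
    by (intro tendsto_diff tendsto_mult_left lil_ratio r0 q0 rho const_over_lil)
  have "eventually (\<lambda>y. \<kappa>' * (lil \<rho> (r * y + (- real G)) / lil \<rho> y) - 2 * (lil \<rho> ((1 / real q) * y + 0) / lil \<rho> y) - D / lil \<rho> y > \<kappa>) at_top"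
    using order_tendstoD(1)[OF lim, of \<kappa>] q(2) unfolding r_def by simp
  then have "eventually (\<lambda>y. \<kappa> * lil \<rho> y \<le> \<kappa>' * lil \<rho> (r * y + (- real G)) - 2 * lil \<rho> ((1 / real q) * y + 0) - D) at_top"
    using lil_eventually_pos[OF rho]
  proof eventually_elim
    case (elim y)
    then have "(\<kappa>' * lil \<rho> (r * y + (- real G)) - 2 * lil \<rho> ((1 / real q) * y + 0) - D) / lil \<rho> y > \<kappa>"
      by (simp add: diff_divide_distrib)
    then show ?case using elim(2) by (simp add: pos_less_divide_eq)
  qed
  then have evk: "eventually (\<lambda>k. \<kappa> * lil \<rho> (real (q ^ Suc k)) \<le> \<kappa>' * lil \<rho> (r * real (q ^ Suc k) + (- real G)) - 2 * lil \<rho> ((1 / real q) * real (q ^ Suc k) + 0) - D) sequentially"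
    using y_top by (rule eventually_compose_filterlim)
  have q_top: "filterlim (\<lambda>k. q ^ k) sequentially sequentially"
    by (rule filterlim_at_top_mono[OF filterlim_ident]) (intro always_eventually allI less_imp_le qk)
  have qS_top: "filterlim (\<lambda>k. q ^ Suc k) sequentially sequentially"
    using filterlim_compose[OF q_top filterlim_Suc] .
  show ?thesis
    using all lil_upper_minus AE_space
  proof eventually_elim
    case (elim x)
    then have x: "x \<in> X" by (simp add: space_\<mu>)
    have freq: "frequently (\<lambda>k. V k ((shift ^^ (q ^ k + G)) x)) sequentially"
      unfolding frequently_sequentially
    proof
      fix m
      obtain j where "V (max G m + j) ((shift ^^ (q ^ (max G m + j) + G)) x)"
        using elim(1)[rule_format, of "max G m"] by auto
      then show "\<exists>n\<ge>m. V n ((shift ^^ (q ^ n + G)) x)" by (intro exI[of _ "max G m + j"]) auto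
    qed
    have "eventually (\<lambda>k. - birkhoff F (q ^ k) x \<le> 2 * lil \<rho> (real (q ^ k))) sequentially"
      using elim(2) q_top by (rule eventually_compose_filterlim)
    then have "eventually (\<lambda>k. V k ((shift ^^ (q ^ k + G)) x) \<longrightarrow> birkhoff F (q ^ Suc k) x \<ge> \<kappa> * lil \<rho> (real (q ^ Suc k))) sequentially"
      using evk eventually_ge_at_top[of G]
    proof eventually_elim
      case (elim k)
      show ?case
      proof
        assume v: "V k ((shift ^^ (q ^ k + G)) x)"
        let ?y = "(shift ^^ (q ^ k + G)) x"
        have yX: "?y \<in> X" "(shift ^^ (q ^ k)) x \<in> X" by (rule shift_pow_in[OF x])+
        have "birkhoff F (q ^ Suc k) x = birkhoff F (q ^ k) x + birkhoff F G ((shift ^^ (q ^ k)) x) + birkhoff F (d k) ?y"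
          unfolding d_eq(1)[OF elim(3), symmetric] birkhoff_add by simp
        moreover have "birkhoff F G ((shift ^^ (q ^ k)) x) \<ge> - (real G * R)"
          using R(2)[OF yX(2), of G] by (simp add: abs_le_iff)
        moreover have "birkhoff F (d k) ?y \<ge> \<kappa>' * lil \<rho> (real (d k)) - dF"
          using v Sd_close[OF yX(1), of "d k"] by (simp add: V_def abs_le_iff)
        moreover have "real (d k) = r * real (q ^ Suc k) + (- real G)"
        proof -
          have "real (q ^ k) + real G + real (d k) = real (q ^ Suc k)"
            using d_eq(1)[OF elim(3)] by (metis of_nat_add)
          moreover have "real (q ^ Suc k) - real (q ^ k) = r * real (q ^ Suc k)"
            using q by (simp add: r_def field_simps)
          ultimately show ?thesis by linarith
        qed
        moreover have "(1 / real q) * real (q ^ Suc k) + 0 = real (q ^ k)" using q by simp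
        ultimately show "birkhoff F (q ^ Suc k) x \<ge> \<kappa> * lil \<rho> (real (q ^ Suc k))"
          using elim(1,2) unfolding D_def by simp
      qed
    qed
    then have "frequently (\<lambda>k. birkhoff F (q ^ Suc k) x \<ge> \<kappa> * lil \<rho> (real (q ^ Suc k))) sequentially"
      by (rule frequently_rev_mp[OF freq])
    then show ?case using qS_top by (rule frequently_compose_sequentially)
  qed
qed

end

section \<open>Recurrence\<close>

text \<open>The expression under the floor in \<open>psi_fun\<close>, as a function of
  \<open>L = ln n\<close>. To first order it is the solution \<open>m\<close> of
  \<open>h * m - a * lil \<rho> m = L\<close>.\<close>

definition rec_rate :: "real \<Rightarrow> real \<Rightarrow> real \<Rightarrow> real \<Rightarrow> real" where
  "rec_rate h \<rho> a L = L / h + a / h powr (3/2) * lil \<rho> L"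

lemma h_over_powr: "h > 0 \<Longrightarrow> h * (a / h powr (3/2)) = a / sqrt h"
proof -
  assume h: "h > 0"
  have "h powr (3/2) = h powr (1 + 1/2)" by simp
  also have "\<dots> = h * sqrt h" using h by (subst powr_add) (simp add: powr_half_sqrt)
  finally show ?thesis using h by (simp add: field_simps)
qed

section \<open>Growth-rate comparisons for the recurrence lengths\<close>

lemma lil_over_id: "\<rho> > 0 \<Longrightarrow> ((\<lambda>L. lil \<rho> L / L) \<longlongrightarrow> 0) at_top"
  unfolding lil_def by real_asymp

lemma ln_over_lil: "\<rho> > 0 \<Longrightarrow> ((\<lambda>L. (r + s * ln L) / lil \<rho> L) \<longlongrightarrow> 0) at_top"
proof -
  assume rho: "\<rho> > 0"
  have "((\<lambda>L. 1 / lil \<rho> L) \<longlongrightarrow> 0) at_top" using rho unfolding lil_def by real_asymp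
  moreover have "((\<lambda>L. ln L / lil \<rho> L) \<longlongrightarrow> 0) at_top" using rho unfolding lil_def by real_asymp
  ultimately have "((\<lambda>L. r * (1 / lil \<rho> L) + s * (ln L / lil \<rho> L)) \<longlongrightarrow> r * 0 + s * 0) at_top"
    by (intro tendsto_add tendsto_mult_left)
  then show ?thesis by (simp add: add_divide_distrib)
qed

lemma ln_le_lil_eventually:
  assumes "\<rho> > 0" "a > 0"
  shows "eventually (\<lambda>L. r + s * ln L \<le> a * lil \<rho> L) at_top"
proof -
  have "eventually (\<lambda>L. (r + s * ln L) / lil \<rho> L < a) at_top"
    using ln_over_lil[OF assms(1)] assms(2) by (rule order_tendstoD)
  then show ?thesis using lil_eventually_pos[OF assms(1)]
    by eventually_elim (simp add: pos_divide_less_eq)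
qed

lemma lil_le_id_eventually:
  assumes "\<rho> > 0" "a > 0"
  shows "eventually (\<lambda>L. s * lil \<rho> L \<le> a * L) at_top"
proof -
  have "((\<lambda>L. s * (lil \<rho> L / L)) \<longlongrightarrow> s * 0) at_top" by (intro tendsto_mult_left lil_over_id assms)
  then have "eventually (\<lambda>L. s * (lil \<rho> L / L) < a) at_top" using assms(2) by (intro order_tendstoD) auto
  then show ?thesis using eventually_gt_at_top[of 0]
    by eventually_elim (simp add: pos_divide_less_eq)
qed

lemma lil_dilate_eventually:
  assumes "\<rho> > 0" "q > 0" "k * sqrt q < s" "k > 0"
  shows "eventually (\<lambda>L. k * lil \<rho> (q * L) \<le> s * lil \<rho> L) at_top"
proof -
  have "((\<lambda>L. k * (lil \<rho> (q * L + 0) / lil \<rho> L)) \<longlongrightarrow> k * sqrt q) at_top"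
    by (intro tendsto_mult_left lil_ratio assms)
  then have "eventually (\<lambda>L. k * (lil \<rho> (q * L + 0) / lil \<rho> L) < s) at_top"
    using assms(3) by (rule order_tendstoD)
  then show ?thesis using lil_eventually_pos[OF assms(1)]
    by eventually_elim (simp add: pos_divide_less_eq)
qed

text \<open>Yields the summable bound \<open>1 / (n * (ln n)\<^sup>2)\<close> for cylinders whose
  Birkhoff sum is at most \<open>(1 + \<epsilon> / 2) * lil \<rho> m\<close>. The unit window for
  \<open>m\<close> allows for the floor; the difference between \<open>1 + \<epsilon>\<close> and
  \<open>1 + \<epsilon> / 2\<close> pays for \<open>2 * ln L\<close>.\<close>

lemma rec_rate_upper_asymp:
  assumes h: "h > 0" and rho: "\<rho> > 0" and eps: "\<epsilon> > 0"
  shows "eventually (\<lambda>L. \<forall>m. rec_rate h \<rho> (1 + \<epsilon>) L - 1 \<le> m \<longrightarrow> m \<le> rec_rate h \<rho> (1 + \<epsilon>) L \<longrightarrow>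
    - h * m + (1 + \<epsilon> / 2) * lil \<rho> m \<le> - L - 2 * ln L) at_top"
proof -
  \<comment> \<open>The crude bound \<open>m \<le> (r / h) * L\<close> is enough: under
    \<open>lil\<close> the factor \<open>r\<close> becomes \<open>sqrt r\<close>, which is below
    \<open>r\<close> and leaves room for the intermediate coefficient \<open>s\<close>.\<close>
  define r where "r = (1 + \<epsilon>) / (1 + \<epsilon> / 2)"
  have r: "r > 1" using eps by (simp add: r_def)
  have "r < r\<^sup>2" using r by (simp add: power2_eq_square)
  then have "sqrt r < sqrt (r\<^sup>2)" by (rule real_sqrt_less_mono)
  then have sr: "sqrt r < r" using r by simp
  have "(1 + \<epsilon> / 2) * sqrt r < (1 + \<epsilon> / 2) * r" using sr eps by (intro mult_strict_left_mono) auto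
  then have "(1 + \<epsilon> / 2) * sqrt r < 1 + \<epsilon>" using eps by (simp add: r_def)
  then have "(1 + \<epsilon> / 2) * sqrt r / sqrt h < (1 + \<epsilon>) / sqrt h" using h by (intro divide_strict_right_mono) auto
  then obtain s where s: "(1 + \<epsilon> / 2) * sqrt (r / h) < s" "s < (1 + \<epsilon>) / sqrt h"
    using dense by (auto simp: real_sqrt_divide)
  have ev1: "eventually (\<lambda>L. (1 + \<epsilon>) / h powr (3/2) * lil \<rho> L \<le> ((r - 1) / h) * L) at_top"
    using r h by (intro lil_le_id_eventually rho) auto
  have ev2: "eventually (\<lambda>L. (1 + \<epsilon> / 2) * lil \<rho> ((r / h) * L) \<le> s * lil \<rho> L) at_top"
    using r h s eps by (intro lil_dilate_eventually rho) auto
  have ev3: "eventually (\<lambda>L. h + 2 * ln L \<le> ((1 + \<epsilon>) / sqrt h - s) * lil \<rho> L) at_top"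
    using s by (intro ln_le_lil_eventually rho) auto
  show ?thesis
    using ev1 ev2 ev3 eventually_ge_at_top[of "h * (exp 1 + 1)"] lil_eventually_pos[OF rho]
  proof eventually_elim
    case (elim L)
    show ?case
    proof (intro allI impI)
      fix m assume m: "rec_rate h \<rho> (1 + \<epsilon>) L - 1 \<le> m" "m \<le> rec_rate h \<rho> (1 + \<epsilon>) L"
      have "L / h + ((r - 1) / h) * L = (r / h) * L" using h by (simp add: field_simps)
      then have m_le: "m \<le> (r / h) * L" using m(2) elim(1) unfolding rec_rate_def by linarith
      have "0 \<le> (1 + \<epsilon>) / h powr (3/2) * lil \<rho> L" using elim(5) eps by simp
      moreover have "exp 1 + 1 \<le> L / h" using elim(4) h by (simp add: pos_le_divide_eq mult.commute)
      ultimately have m_ge: "exp 1 \<le> m" using m(1) unfolding rec_rate_def by linarith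
      have "(1 + \<epsilon> / 2) * lil \<rho> m \<le> (1 + \<epsilon> / 2) * lil \<rho> ((r / h) * L)"
        using m_le m_ge rho eps by (intro mult_left_mono lil_mono) auto
      then have a: "(1 + \<epsilon> / 2) * lil \<rho> m \<le> s * lil \<rho> L" using elim(2) by linarith
      have "h * (rec_rate h \<rho> (1 + \<epsilon>) L - 1) \<le> h * m" using m(1) h by (intro mult_left_mono) auto
      moreover have "h * (rec_rate h \<rho> (1 + \<epsilon>) L - 1) = L + (1 + \<epsilon>) / sqrt h * lil \<rho> L - h"
        unfolding rec_rate_def right_diff_distrib distrib_left mult.assoc[symmetric] h_over_powr[OF h] using h by simp
      ultimately have b: "L + (1 + \<epsilon>) / sqrt h * lil \<rho> L - h \<le> h * m" by simp
      show "- h * m + (1 + \<epsilon> / 2) * lil \<rho> m \<le> - L - 2 * ln L"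
        using a b elim(3) unfolding left_diff_distrib by linarith
    qed
  qed
qed

text \<open>The inverse direction, with the time limited in terms of \<open>m\<close>. Dividing by
  \<open>h\<close> leaves the margin \<open>\<kappa> / h * lil \<rho> m\<close>, and the correction
  in the rate is asymptotically at most \<open>a / h * lil \<rho> m\<close>.\<close>

lemma rec_rate_lower_asymp:
  assumes h: "h > 0" and rho: "\<rho> > 0" and a: "0 < a" "a < \<kappa>"
  shows "eventually (\<lambda>m. \<forall>L. exp 1 \<le> L \<longrightarrow> L \<le> h * m - \<kappa> * lil \<rho> m \<longrightarrow> rec_rate h \<rho> a L \<le> m) at_top"
proof -
  have "a / h powr (3/2) * sqrt h < \<kappa> / h"
  proof -
    have "h * (a / h powr (3/2)) * sqrt h = a" unfolding h_over_powr[OF h] using h by simp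
    then have "h * (a / h powr (3/2) * sqrt h) < h * (\<kappa> / h)" using a h by (simp add: mult.assoc)
    then show ?thesis using h by (simp only: mult_less_cancel_left_pos)
  qed
  then have "eventually (\<lambda>m. a / h powr (3/2) * lil \<rho> (h * m) \<le> \<kappa> / h * lil \<rho> m) at_top"
    using h a by (intro lil_dilate_eventually rho) auto
  then show ?thesis using lil_eventually_pos[OF rho]
  proof eventually_elim
    case (elim m)
    show ?case
    proof (intro allI impI)
      fix L assume L: "exp 1 \<le> L" "L \<le> h * m - \<kappa> * lil \<rho> m"
      have "0 \<le> \<kappa> * lil \<rho> m" using elim a by simp
      then have "L \<le> h * m" using L by linarith
      then have "a / h powr (3/2) * lil \<rho> L \<le> a / h powr (3/2) * lil \<rho> (h * m)"
        using a rho L by (intro mult_left_mono lil_mono) auto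
      moreover have "L / h \<le> (h * m - \<kappa> * lil \<rho> m) / h" using L h by (intro divide_right_mono) auto
      moreover have "(h * m - \<kappa> * lil \<rho> m) / h = m - \<kappa> / h * lil \<rho> m" using h by (simp add: diff_divide_distrib)
      ultimately show "rec_rate h \<rho> a L \<le> m" using elim unfolding rec_rate_def by linarith
    qed
  qed
qed

text \<open>Measure of a cylinder times number of test times. The surplus
  \<open>exp ((\<kappa>3 - \<kappa>2) * lil \<rho> m)\<close> outgrows \<open>m ^ 4\<close>, which
  beats the spacing \<open>m + G\<close> and still leaves \<open>m / g\<close>.\<close>

lemma return_count_asymp:
  assumes h: "h > 0" and rho: "\<rho> > 0" and k: "\<kappa>2 < \<kappa>3" and g: "g > 0"
  shows "eventually (\<lambda>m. m / g \<le> exp (- h * m + \<kappa>3 * lil \<rho> m - d) * (exp (h * m - \<kappa>2 * lil \<rho> m) / (m + real G) - 1)) at_top"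
proof -
  have ev1: "eventually (\<lambda>m. 0 + 4 * ln m \<le> (\<kappa>3 - \<kappa>2) * lil \<rho> m) at_top"
    using k by (intro ln_le_lil_eventually rho) auto
  have ev2: "eventually (\<lambda>m. \<kappa>3 * lil \<rho> m \<le> (h / 2) * m) at_top" using h by (intro lil_le_id_eventually rho) auto
  have "((\<lambda>m. (m / g + 1) * (m + real G) / m ^ 4) \<longlongrightarrow> 0) at_top" using g by real_asymp
  then have ev3: "eventually (\<lambda>m. (m / g + 1) * (m + real G) / m ^ 4 < exp (- d)) at_top" by (rule order_tendstoD) simp
  have ev4: "eventually (\<lambda>m. m \<ge> 2 * \<bar>d\<bar> / h) at_top" by (rule eventually_ge_at_top)
  show ?thesis
    using ev1 ev2 ev3 ev4 eventually_gt_at_top[of 0]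
  proof eventually_elim
    case (elim m)
    have "exp (4 * ln m) \<le> exp ((\<kappa>3 - \<kappa>2) * lil \<rho> m)" using elim(1) by simp
    moreover have "exp (4 * ln m) = m ^ 4" using elim(5) exp_of_nat_mult[of 4 "ln m"] by simp
    ultimately have e: "m ^ 4 \<le> exp ((\<kappa>3 - \<kappa>2) * lil \<rho> m)" by simp
    have mG: "m + real G > 0" using elim(5) by simp
    have "(m / g + 1) * (m + real G) \<le> exp (- d) * m ^ 4" using elim(3,5) by (simp add: pos_divide_less_eq)
    also have "\<dots> \<le> exp (- d) * exp ((\<kappa>3 - \<kappa>2) * lil \<rho> m)" using e by (intro mult_left_mono) auto
    finally have f: "m / g + 1 \<le> exp (- d) * exp ((\<kappa>3 - \<kappa>2) * lil \<rho> m) / (m + real G)"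
      using mG by (simp add: pos_le_divide_eq)
    have "2 * \<bar>d\<bar> \<le> h * m" using elim(4) h by (simp add: pos_divide_le_eq mult.commute)
    then have "- h * m + \<kappa>3 * lil \<rho> m - d \<le> 0" using elim(2) by (simp add: abs_le_iff)
    then have l: "exp (- h * m + \<kappa>3 * lil \<rho> m - d) \<le> 1" by simp
    have "exp (- h * m + \<kappa>3 * lil \<rho> m - d) * exp (h * m - \<kappa>2 * lil \<rho> m) = exp (- d) * exp ((\<kappa>3 - \<kappa>2) * lil \<rho> m)"
      unfolding exp_add[symmetric] by (rule arg_cong[of _ _ exp]) (simp add: algebra_simps)
    then have "exp (- h * m + \<kappa>3 * lil \<rho> m - d) * (exp (h * m - \<kappa>2 * lil \<rho> m) / (m + real G) - 1)
       = exp (- d) * exp ((\<kappa>3 - \<kappa>2) * lil \<rho> m) / (m + real G) - exp (- h * m + \<kappa>3 * lil \<rho> m - d)"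
      by (simp add: right_diff_distrib)
    then show ?case using f l by linarith
  qed
qed

text \<open>The terms are comparable to the telescoping differences of
  \<open>1 / ln n\<close>.\<close>

lemma summable_inverse_n_ln_squared: "summable (\<lambda>n. exp (- ln (real n) - 2 * ln (ln (real n))))"
proof (rule summable_comparison_test_bigo)
  \<comment> \<open>Starting at 2 keeps the logarithms positive.\<close>
  have "(\<lambda>n. 1 / ln (real (n + 2))) \<longlonglongrightarrow> 0" by real_asymp
  then have "summable (\<lambda>n. 1 / ln (real (n + 2)) - 1 / ln (real (Suc n + 2)))" by (rule telescope_summable')
  moreover have "1 / ln (real (n + 2)) - 1 / ln (real (Suc n + 2)) \<ge> 0" for n
  proof -
    have "ln (real (n + 2)) \<le> ln (real (Suc n + 2))" "ln (real (n + 2)) > 0" by auto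
    then show ?thesis by (simp add: frac_le)
  qed
  ultimately have "summable (\<lambda>n. norm (1 / ln (real (n + 2)) - 1 / ln (real (Suc n + 2))))" by simp
  then show "summable (\<lambda>n. norm (1 / ln (real n) - 1 / ln (real (Suc n))))"
    using summable_iff_shift[of "\<lambda>n. norm (1 / ln (real n) - 1 / ln (real (Suc n)))" 2] by (simp add: add.commute)
  show "(\<lambda>n. exp (- ln (real n) - 2 * ln (ln (real n)))) \<in> O(\<lambda>n. 1 / ln (real n) - 1 / ln (real (Suc n)))"
    by real_asymp
qed

lemma (in gibbs_subshift) return_set_measurable: "{x \<in> X. agree m ((shift ^^ n) x) x} \<in> sets \<mu>"
proof (rule det_Collect_measurable[of "n + m"])
  show "det (n + m) (\<lambda>x. agree m ((shift ^^ n) x) x)"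
    unfolding det_def
  proof (intro ballI impI)
    fix x y assume xy: "agree (n + m) x y"
    have "x k = y k" "(shift ^^ n) x k = (shift ^^ n) y k" if "k < m" for k
      using xy that by (auto simp: agree_def shift_pow_apply)
    then show "agree m ((shift ^^ n) x) x = agree m ((shift ^^ n) y) y" by (simp add: agree_def)
  qed
qed

section \<open>Borel-Cantelli for returns of the initial word\<close>

context gibbs_observable
begin

lemma recurrence_null:
  assumes h: "h > 0" and d0: "\<And>x n. x \<in> X \<Longrightarrow> measure \<mu> (Cy n x) \<le> exp (d0 - h * real n + birkhoff F n x)"
    and eps: "\<epsilon> > 0"
    and psi: "eventually (\<lambda>n. \<psi> n = nat \<lfloor>rec_rate h \<rho> (1 + \<epsilon>) (ln (real n))\<rfloor>) sequentially"
  shows "AE x in \<mu>. finite {n. agree (\<psi> n) ((shift ^^ n) x) x}"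
proof -
  let ?r = "\<lambda>n. rec_rate h \<rho> (1 + \<epsilon>) (ln (real n))"
  have ln_top: "filterlim (\<lambda>n. ln (real n)) at_top sequentially" by real_asymp
  have r_top: "filterlim ?r at_top sequentially"
  proof -
    have "eventually (\<lambda>L. L / h \<le> rec_rate h \<rho> (1 + \<epsilon>) L) at_top"
      using lil_eventually_pos[OF rho] by eventually_elim (use eps in \<open>simp add: rec_rate_def\<close>)
    then have "eventually (\<lambda>n. ln (real n) / h \<le> ?r n) sequentially" using ln_top by (rule eventually_compose_filterlim)
    moreover have "filterlim (\<lambda>n. ln (real n) / h) at_top sequentially" using h by real_asymp
    ultimately show ?thesis by (rule filterlim_at_top_mono[rotated])
  qed
  have r_pos: "eventually (\<lambda>n. ?r n \<ge> 0) sequentially" using r_top by (auto simp: filterlim_at_top)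
  have psi_r: "eventually (\<lambda>n. ?r n - 1 \<le> real (\<psi> n) \<and> real (\<psi> n) \<le> ?r n) sequentially"
    using psi r_pos
  proof eventually_elim
    case (elim n)
    then have "real (\<psi> n) = of_int \<lfloor>?r n\<rfloor>" by simp
    then show ?case by linarith
  qed
  have psi_top: "filterlim \<psi> sequentially sequentially"
  proof -
    have "filterlim (\<lambda>n. ?r n - 1) at_top sequentially"
      using filterlim_tendsto_add_at_top[OF tendsto_const[of "-1"] r_top] by (simp add: add.commute)
    moreover have "eventually (\<lambda>n. ?r n - 1 \<le> real (\<psi> n)) sequentially" using psi_r by eventually_elim simp
    ultimately have "filterlim (\<lambda>n. real (\<psi> n)) at_top sequentially" by (rule filterlim_at_top_mono)
    then show ?thesis by (simp add: filterlim_sequentially_iff_filterlim_real)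
  qed
  \<comment> \<open>Quasi-independence applies only if the two occurrences of the word do not
    overlap; \<open>\<psi> n\<close> is of order \<open>ln n\<close>.\<close>
  have psi_le: "eventually (\<lambda>n. \<psi> n \<le> n) sequentially"
  proof -
    have "eventually (\<lambda>L. (1 + \<epsilon>) / h powr (3/2) * lil \<rho> L \<le> 1 * L) at_top" by (intro lil_le_id_eventually rho) simp
    then have "eventually (\<lambda>n. (1 + \<epsilon>) / h powr (3/2) * lil \<rho> (ln (real n)) \<le> 1 * ln (real n)) sequentially"
      using ln_top by (rule eventually_compose_filterlim)
    moreover have "eventually (\<lambda>n. ln (real n) / h + ln (real n) \<le> real n) sequentially" using h by real_asymp
    ultimately show ?thesis using psi_r
    proof eventually_elim
      case (elim n)
      then have "real (\<psi> n) \<le> real n" unfolding rec_rate_def by linarith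
      then show ?case by simp
    qed
  qed
  define T where "T m = (1 + \<epsilon> / 2) * lil \<rho> (real m) + dF" for m
  define E where "E n = {x \<in> X. Sd (\<psi> n) x \<le> T (\<psi> n) \<and> agree (\<psi> n) ((shift ^^ n) x) x}" for n
  have E_sets: "E n \<in> sets \<mu>" for n
  proof -
    have "E n = {x \<in> X. Sd (\<psi> n) x \<le> T (\<psi> n)} \<inter> {x \<in> X. agree (\<psi> n) ((shift ^^ n) x) x}" by (auto simp: E_def)
    moreover have "{x \<in> X. Sd (\<psi> n) x \<le> T (\<psi> n)} \<in> sets \<mu>"
      by (rule det_Collect_measurable[OF det_comp[OF det_Sd]])
    ultimately show ?thesis using return_set_measurable by auto
  qed
  define D where "D = C ^ 3 * exp (d0 + 2 * dF)"
  have bound: "measure \<mu> (E n) \<le> C ^ 3 * exp (d0 - h * real (\<psi> n) + T (\<psi> n) + dF)" if le: "\<psi> n \<le> n" for n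
  proof -
    let ?m = "\<psi> n"
    let ?good = "{U \<in> cyls ?m. Sd ?m (rep U) \<le> T ?m}"
    let ?e = "exp (d0 - h * real ?m + T ?m + dF)"
    have fin: "finite ?good" using finite_cyls by auto
    have sub: "E n \<subseteq> (\<Union>U\<in>?good. {x \<in> X. x \<in> U \<and> (shift ^^ n) x \<in> U})"
    proof
      fix x assume x: "x \<in> E n"
      then have xX: "x \<in> X" by (simp add: E_def)
      have "Cy ?m x \<in> ?good" using x det_rep[OF det_Sd xX] by (auto simp: E_def cyls_def)
      moreover have "x \<in> Cy ?m x" "(shift ^^ n) x \<in> Cy ?m x"
        using x xX shift_pow_in[OF xX] by (auto simp: E_def Cy_def)
      ultimately show "x \<in> (\<Union>U\<in>?good. {x \<in> X. x \<in> U \<and> (shift ^^ n) x \<in> U})" using xX by blast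
    qed
    have detU: "det ?m (\<lambda>x. x \<in> U)" if "U \<in> cyls ?m" for U
      using that det_mem_Cy by (auto simp: cyls_def)
    have meas: "{x \<in> X. x \<in> U \<and> (shift ^^ n) x \<in> U} \<in> sets \<mu>" if U: "U \<in> cyls ?m" for U
      using det_comp2[OF det_mono[OF detU[OF U], of "n + ?m"] det_shift[OF detU[OF U], of n], of "(\<and>)"]
      by (intro det_Collect_measurable[of "n + ?m"]) simp
    have UX: "{x \<in> X. x \<in> U} = U" if "U \<in> cyls ?m" for U using that Cy_subset by (auto simp: cyls_def)
    have "measure \<mu> (E n) \<le> measure \<mu> (\<Union>U\<in>?good. {x \<in> X. x \<in> U \<and> (shift ^^ n) x \<in> U})"
      using sub meas fin by (intro finite_measure_mono sets.finite_UN) auto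
    also have "\<dots> \<le> (\<Sum>U\<in>?good. measure \<mu> {x \<in> X. x \<in> U \<and> (shift ^^ n) x \<in> U})"
      using meas fin by (intro measure_subadditive_finite) (auto simp: emeasure_eq_measure)
    also have "\<dots> \<le> (\<Sum>U\<in>?good. C ^ 3 * measure \<mu> U * ?e)"
    proof (rule sum_mono)
      fix U assume "U \<in> ?good"
      then have U: "U \<in> cyls ?m" "Sd ?m (rep U) \<le> T ?m" by auto
      have u: "rep U \<in> X" by (rule rep_in_X[OF U(1)])
      have "measure \<mu> {x \<in> X. x \<in> U \<and> (shift ^^ n) x \<in> U} \<le> C ^ 3 * measure \<mu> U * measure \<mu> U"
        using prob_quasi_upper[OF det_mono[OF detU[OF U(1)] le] detU[OF U(1)]] unfolding UX[OF U(1)] .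
      also have "\<dots> \<le> C ^ 3 * measure \<mu> U * ?e"
      proof -
        have "measure \<mu> U \<le> exp (d0 - h * real ?m + birkhoff F ?m (rep U))"
          using d0[OF u, of ?m] cyls_rep[OF U(1)] by simp
        also have "\<dots> \<le> ?e" using U(2) Sd_close[OF u, of ?m] by (simp add: abs_le_iff)
        finally show ?thesis using C_pos by (intro mult_left_mono) auto
      qed
      finally show "measure \<mu> {x \<in> X. x \<in> U \<and> (shift ^^ n) x \<in> U} \<le> C ^ 3 * measure \<mu> U * ?e" .
    qed
    also have "\<dots> = C ^ 3 * ?e * (\<Sum>U\<in>?good. measure \<mu> U)" by (simp add: sum_distrib_left mult_ac)
    also have "\<dots> \<le> C ^ 3 * ?e * 1"
      unfolding sum_measure_cyls[of ?m, symmetric] using C_pos finite_cyls by (intro mult_left_mono sum_mono2) auto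
    finally show ?thesis by simp
  qed
  have "eventually (\<lambda>n. \<forall>m. ?r n - 1 \<le> m \<longrightarrow> m \<le> ?r n \<longrightarrow> - h * m + (1 + \<epsilon> / 2) * lil \<rho> m \<le> - ln (real n) - 2 * ln (ln (real n))) sequentially"
    using rec_rate_upper_asymp[OF h rho eps] ln_top by (rule eventually_compose_filterlim)
  then have "eventually (\<lambda>n. norm (measure \<mu> (E n)) \<le> D * exp (- ln (real n) - 2 * ln (ln (real n)))) sequentially"
    using psi_r psi_le
  proof eventually_elim
    case (elim n)
    have "- h * real (\<psi> n) + (1 + \<epsilon> / 2) * lil \<rho> (real (\<psi> n)) \<le> - ln (real n) - 2 * ln (ln (real n))"
      using elim(1,2) by blast
    then have "exp (d0 - h * real (\<psi> n) + T (\<psi> n) + dF) \<le> exp ((d0 + 2 * dF) + (- ln (real n) - 2 * ln (ln (real n))))"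
      unfolding T_def exp_le_cancel_iff by linarith
    then have "C ^ 3 * exp (d0 - h * real (\<psi> n) + T (\<psi> n) + dF) \<le> D * exp (- ln (real n) - 2 * ln (ln (real n)))"
      unfolding D_def exp_add[of "d0 + 2 * dF"] mult.assoc using C_pos by (intro mult_left_mono) auto
    then show ?case using bound[OF elim(3)] by simp
  qed
  then have "summable (\<lambda>n. measure \<mu> (E n))"
    by (rule summable_comparison_test_ev) (intro summable_mult summable_inverse_n_ln_squared)
  then have bc: "AE x in \<mu>. eventually (\<lambda>n. x \<in> space \<mu> - E n) sequentially"
    by (intro borel_cantelli_AE1 E_sets) (auto simp: emeasure_eq_measure)
  have "AE x in \<mu>. eventually (\<lambda>n. birkhoff F n x \<le> (1 + \<epsilon> / 2) * lil \<rho> (real n)) sequentially"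
    using eps by (intro lil_upper) simp
  then show ?thesis
    using bc AE_space
  proof eventually_elim
    case (elim x)
    then have x: "x \<in> X" by (simp add: space_\<mu>)
    have "eventually (\<lambda>n. birkhoff F (\<psi> n) x \<le> (1 + \<epsilon> / 2) * lil \<rho> (real (\<psi> n))) sequentially"
      using elim(1) psi_top by (rule eventually_compose_filterlim)
    then have "eventually (\<lambda>n. \<not> agree (\<psi> n) ((shift ^^ n) x) x) sequentially"
      using elim(2)
    proof eventually_elim
      case (elim n)
      have "Sd (\<psi> n) x \<le> T (\<psi> n)" using elim(1) Sd_close[OF x, of "\<psi> n"] by (simp add: T_def abs_le_iff)
      then show ?case using elim(2) x by (auto simp: E_def)
    qed
    then have "finite {n. \<not> \<not> agree (\<psi> n) ((shift ^^ n) x) x}"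
      unfolding cofinite_eq_sequentially[symmetric] eventually_cofinite .
    then show ?case by simp
  qed
qed

text \<open>At a length \<open>m\<close> with large \<open>birkhoff F m x\<close> the initial
  cylinder has large measure. It is tested at \<open>J m\<close> separated times up to
  \<open>N m\<close>, and failing at all of them has probability at most \<open>exp (- m)\<close>
  for large \<open>m\<close>. So almost surely a test succeeds at all large lengths \<open>m\<close>
  of this kind, and by \<open>rec_rate_lower_asymp\<close> the length demanded at that time is at
  most \<open>m\<close>.\<close>

lemma recurrence_full:
  assumes h: "h > 0" and d0: "\<And>x n. x \<in> X \<Longrightarrow> exp (- d0 - h * real n + birkhoff F n x) \<le> measure \<mu> (Cy n x)"
    and a: "0 < a" "a < 1"
    and psi: "eventually (\<lambda>n. real (\<psi> n) \<le> rec_rate h \<rho> a (ln (real n))) sequentially"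
  shows "AE x in \<mu>. infinite {n. agree (\<psi> n) ((shift ^^ n) x) x}"
proof -
  \<comment> \<open>In the chain \<open>a < \<kappa>2 < \<kappa>3 < 1\<close>,
    \<open>\<kappa>3\<close> measures the size of the Birkhoff sum and \<open>\<kappa>2\<close> sets
    the time horizon; the first difference pays for the rate, the second for the number of
    tests.\<close>
  define \<kappa>2 where "\<kappa>2 = (1 + a) / 2"
  define \<kappa>3 where "\<kappa>3 = (1 + \<kappa>2) / 2"
  have k: "a < \<kappa>2" "\<kappa>2 < \<kappa>3" "\<kappa>3 < 1" "0 < \<kappa>3" "0 < \<kappa>2"
    using a by (simp_all add: \<kappa>2_def \<kappa>3_def field_simps)
  define N where "N m = exp (h * real m - \<kappa>2 * lil \<rho> (real m))" for m
  define J where "J m = nat \<lfloor>N m / (real m + real G)\<rfloor>" for m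
  \<comment> \<open>The first test comes at \<open>m + G\<close>, and consecutive tests leave
    \<open>G\<close> free symbols, as \<open>prob_avoid\<close> demands.\<close>
  define p where "p m j = Suc j * (m + G)" for m j
  define T where "T m = \<kappa>3 * lil \<rho> (real m) - dF" for m
  let ?good = "\<lambda>m. {U \<in> cyls m. Sd m (rep U) \<ge> T m}"
  define BU where "BU m U = {x \<in> X. x \<in> U \<and> (\<forall>j<J m. \<not> (shift ^^ p m j) x \<in> U)}" for m U
  define B where "B m = (\<Union>U\<in>?good m. BU m U)" for m
  define D where "D = d0 + 2 * dF"
  have detU: "det m (\<lambda>x. x \<in> U)" if "U \<in> cyls m" for U m
    using that det_mem_Cy by (auto simp: cyls_def)
  have UX: "{x \<in> X. x \<in> U} = U" if "U \<in> cyls m" for U m using that Cy_subset by (auto simp: cyls_def)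
  have BU_sets: "BU m U \<in> sets \<mu>" if U: "U \<in> cyls m" for U m
  proof -
    have "BU m U = U - (\<Union>j<J m. {x \<in> X. (shift ^^ p m j) x \<in> U})"
      using UX[OF U] by (auto simp: BU_def)
    moreover have "{x \<in> X. (shift ^^ p m j) x \<in> U} \<in> sets \<mu>" for j
      by (rule det_Collect_measurable[OF det_shift[OF detU[OF U]]])
    ultimately show ?thesis using cyls_sets[OF U] by auto
  qed
  have fin: "finite (?good m)" for m using finite_cyls by auto
  have B_sets: "B m \<in> sets \<mu>" for m unfolding B_def using fin BU_sets by (intro sets.finite_UN) auto
  have "eventually (\<lambda>m. m / gap \<le> exp (- h * m + \<kappa>3 * lil \<rho> m - D) * (exp (h * m - \<kappa>2 * lil \<rho> m) / (m + real G) - 1)) at_top"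
    by (rule return_count_asymp[OF h rho k(2) gap_pos])
  then have ev: "eventually (\<lambda>m. real m / gap \<le> exp (- h * real m + \<kappa>3 * lil \<rho> (real m) - D) * (N m / (real m + real G) - 1)) sequentially"
    unfolding N_def using filterlim_real_sequentially by (rule eventually_compose_filterlim)
  have "eventually (\<lambda>m. norm (measure \<mu> (B m)) \<le> exp (- 1) ^ m) sequentially"
    using ev
  proof eventually_elim
    case (elim m)
    have each: "measure \<mu> (BU m U) \<le> measure \<mu> U * exp (- real m)" if "U \<in> ?good m" for U
    proof -
      have U: "U \<in> cyls m" "Sd m (rep U) \<ge> T m" using that by auto
      have u: "rep U \<in> X" by (rule rep_in_X[OF U(1)])
      define g where "g = gap * measure \<mu> U"
      have g01: "0 \<le> g" "g \<le> 1" using gap_pos gap_le_1 by (auto simp: g_def intro!: mult_le_one)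
      have "measure \<mu> (BU m U) \<le> measure \<mu> {x \<in> X. x \<in> U} * (\<Prod>j<J m. 1 - gap * measure \<mu> {x \<in> X. x \<in> U})"
        unfolding BU_def by (rule prob_avoid[where ?n0.0 = m and l = "\<lambda>_. m", OF detU[OF U(1)] detU[OF U(1)]]) (auto simp: p_def)
      also have "\<dots> = measure \<mu> U * (1 - g) ^ J m" by (simp add: UX[OF U(1)] g_def)
      also have "\<dots> \<le> measure \<mu> U * exp (- g) ^ J m"
        using g01 exp_ge_add_one_self[of "- g"] by (intro mult_left_mono power_mono) auto
      also have "\<dots> = measure \<mu> U * exp (- (real (J m) * g))" by (simp add: exp_of_nat_mult[symmetric])
      also have "\<dots> \<le> measure \<mu> U * exp (- real m)"
      proof -
        have "exp (- h * real m + \<kappa>3 * lil \<rho> (real m) - D) \<le> exp (- d0 - h * real m + birkhoff F m (rep U))"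
          using U(2) Sd_close[OF u, of m] unfolding exp_le_cancel_iff D_def T_def abs_le_iff by linarith
        also have "\<dots> \<le> measure \<mu> U" using d0[OF u, of m] cyls_rep[OF U(1)] by simp
        finally have mu: "exp (- h * real m + \<kappa>3 * lil \<rho> (real m) - D) \<le> measure \<mu> U" .
        have J: "N m / (real m + real G) - 1 \<le> real (J m)"
          unfolding J_def by linarith
        have "exp (- h * real m + \<kappa>3 * lil \<rho> (real m) - D) * (N m / (real m + real G) - 1)
            \<le> exp (- h * real m + \<kappa>3 * lil \<rho> (real m) - D) * real (J m)" using J by (intro mult_left_mono) auto
        also have "\<dots> \<le> measure \<mu> U * real (J m)" using mu by (intro mult_right_mono) auto
        finally have "real m / gap \<le> measure \<mu> U * real (J m)" using elim by linarith
        then have "real m \<le> real (J m) * g" using gap_pos by (simp add: g_def pos_divide_le_eq mult_ac)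
        then show ?thesis by (intro mult_left_mono) auto
      qed
      finally show ?thesis .
    qed
    have "measure \<mu> (B m) \<le> (\<Sum>U\<in>?good m. measure \<mu> (BU m U))"
      unfolding B_def using BU_sets fin by (intro measure_subadditive_finite) (auto simp: emeasure_eq_measure)
    also have "\<dots> \<le> (\<Sum>U\<in>?good m. measure \<mu> U * exp (- real m))" using each by (rule sum_mono)
    also have "\<dots> = (\<Sum>U\<in>?good m. measure \<mu> U) * exp (- real m)" by (simp add: sum_distrib_right)
    also have "\<dots> \<le> 1 * exp (- real m)"
      unfolding sum_measure_cyls[of m, symmetric] using finite_cyls by (intro mult_right_mono sum_mono2) auto
    finally show ?case by (simp add: exp_of_nat_mult[symmetric])
  qed
  then have "summable (\<lambda>m. measure \<mu> (B m))"
    by (rule summable_comparison_test_ev) (simp add: summable_geometric)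
  then have bc: "AE x in \<mu>. eventually (\<lambda>m. x \<in> space \<mu> - B m) sequentially"
    by (intro borel_cantelli_AE1 B_sets) (auto simp: emeasure_eq_measure)
  have "filterlim (\<lambda>n. ln (real n)) at_top sequentially" by real_asymp
  then have "eventually (\<lambda>n. exp 1 \<le> ln (real n)) sequentially" by (simp add: filterlim_at_top)
  with psi have "eventually (\<lambda>n. exp 1 \<le> ln (real n) \<and> real (\<psi> n) \<le> rec_rate h \<rho> a (ln (real n))) sequentially"
    by eventually_elim simp
  then obtain n0 where n0: "\<And>n. n \<ge> n0 \<Longrightarrow> exp 1 \<le> ln (real n) \<and> real (\<psi> n) \<le> rec_rate h \<rho> a (ln (real n))"
    by (auto simp: eventually_sequentially)
  have "eventually (\<lambda>m. \<forall>L. exp 1 \<le> L \<longrightarrow> L \<le> h * m - \<kappa>2 * lil \<rho> m \<longrightarrow> rec_rate h \<rho> a L \<le> m) at_top"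
    by (rule rec_rate_lower_asymp[OF h rho a(1) k(1)])
  then have rate: "eventually (\<lambda>m. \<forall>L. exp 1 \<le> L \<longrightarrow> L \<le> h * real m - \<kappa>2 * lil \<rho> (real m) \<longrightarrow> rec_rate h \<rho> a L \<le> real m) sequentially"
    using filterlim_real_sequentially by (rule eventually_compose_filterlim)
  show ?thesis
    using bc lil_lower[OF k(4,3)] AE_space
  proof eventually_elim
    case (elim x)
    then have x: "x \<in> X" by (simp add: space_\<mu>)
    \<comment> \<open>Different \<open>m\<close> may lead to the same \<open>n\<close>; recording
      \<open>n \<ge> m\<close> still gives infinitely many \<open>n\<close>.\<close>
    let ?ret = "\<lambda>m. \<exists>n\<ge>m. agree (\<psi> n) ((shift ^^ n) x) x"
    have "eventually (\<lambda>m. birkhoff F m x \<ge> \<kappa>3 * lil \<rho> (real m) \<longrightarrow> ?ret m) sequentially"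
      using elim(1) rate eventually_ge_at_top[of "max 1 n0"]
    proof eventually_elim
      case (elim m)
      show ?case
      proof
        assume good: "birkhoff F m x \<ge> \<kappa>3 * lil \<rho> (real m)"
        have "Sd m x \<ge> T m" using good Sd_close[OF x, of m] by (simp add: T_def abs_le_iff)
        then have "Cy m x \<in> ?good m" using det_rep[OF det_Sd x] x by (auto simp: cyls_def)
        then have "x \<notin> BU m (Cy m x)" using elim(1) by (auto simp: B_def)
        then obtain j where j: "j < J m" "(shift ^^ p m j) x \<in> Cy m x"
          using x Cy_self[OF x, of m] by (auto simp: BU_def)
        have m1: "m \<ge> 1" "m \<ge> n0" using elim(3) by auto
        have pm: "m \<le> p m j" by (simp add: p_def)
        have "real (p m j) \<le> N m"
        proof -
          have pos: "real m + real G > 0" using m1 by simp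
          have "real (Suc j) \<le> real (J m)" using j by simp
          also have "\<dots> \<le> N m / (real m + real G)"
            unfolding J_def using pos by (intro of_nat_floor) (simp add: N_def)
          finally have "real (Suc j) * (real m + real G) \<le> N m" using pos by (simp only: pos_le_divide_eq)
          then show ?thesis unfolding p_def by (simp only: of_nat_mult of_nat_add)
        qed
        then have "ln (real (p m j)) \<le> ln (N m)" using pm m1 by (subst ln_le_cancel_iff) (auto simp: N_def)
        then have "ln (real (p m j)) \<le> h * real m - \<kappa>2 * lil \<rho> (real m)" by (simp add: N_def)
        moreover have "exp 1 \<le> ln (real (p m j)) \<and> real (\<psi> (p m j)) \<le> rec_rate h \<rho> a (ln (real (p m j)))"
          using m1 pm by (intro n0) simp
        ultimately have "real (\<psi> (p m j)) \<le> real m" using elim(2) by force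
        then have "\<psi> (p m j) \<le> m" by simp
        moreover have "agree m ((shift ^^ p m j) x) x" using j(2) by (simp add: Cy_def)
        ultimately show "?ret m" using pm agree_mono by blast
      qed
    qed
    then have fr: "frequently ?ret sequentially" by (rule frequently_rev_mp[OF elim(2)])
    show ?case
      unfolding infinite_nat_iff_unbounded_le
    proof
      fix m
      have "\<exists>m'\<ge>m. ?ret m'" using fr unfolding frequently_sequentially by blast
      then show "\<exists>n\<ge>m. n \<in> {n. agree (\<psi> n) ((shift ^^ n) x) x}" using order_trans by blast
    qed
  qed
qed

end

section \<open>Subshifts of finite type\<close>

lemma matpow_path:
  assumes "matpow K A m a b > 0" "a \<in> {1..K}"
  shows "\<exists>w. w 0 = a \<and> w m = b \<and> (\<forall>k<m. w k \<in> {1..K} \<and> A (w k) (w (Suc k)) \<noteq> 0)"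
  using assms
proof (induction m arbitrary: b)
  case 0
  then show ?case by (intro exI[of _ "\<lambda>_. a"]) (auto split: if_splits)
next
  case (Suc m)
  have "\<exists>c\<in>{1..K}. matpow K A m a c * A c b \<noteq> 0"
  proof (rule ccontr)
    assume "\<not> ?thesis"
    then have "matpow K A (Suc m) a b = 0" unfolding matpow.simps by (intro sum.neutral) blast
    then show False using Suc.prems(1) by linarith
  qed
  then obtain c where c: "c \<in> {1..K}" "matpow K A m a c > 0" "A c b \<noteq> 0" by auto
  obtain w where w: "w 0 = a" "w m = c" "\<forall>k<m. w k \<in> {1..K} \<and> A (w k) (w (Suc k)) \<noteq> 0"
    using Suc.IH[OF c(2) Suc.prems(2)] by blast
  show ?case
    using w c by (intro exI[of _ "w(Suc m := b)"]) (auto simp: less_Suc_eq)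
qed

text \<open>A positive entry of the \<open>M\<close>-th power is a path with \<open>M - 1\<close>
  intermediate symbols, and this number serves as the gap.\<close>

lemma primitive_specification:
  assumes K: "K \<ge> 2" and A: "zero_one_matrix K A" "primitive_matrix K A"
  shows "\<exists>G. specification_subshift K A G"
proof -
  obtain M where M: "\<And>a b. a \<in> {1..K} \<Longrightarrow> b \<in> {1..K} \<Longrightarrow> matpow K A M a b > 0"
    using A(2) unfolding primitive_matrix_def by blast
  \<comment> \<open>At exponent 0 \<open>matpow\<close> is the identity matrix, which has a zero
    entry once there are two symbols.\<close>
  have "M \<noteq> 0"
  proof
    assume "M = 0"
    then show False using M[of 1 2] K by simp
  qed
  then obtain G where G: "M = Suc G" using not0_implies_Suc by blast
  have "specification_subshift K A G"
  proof
    fix z y n assume z: "z \<in> SigmaA K A" and y: "y \<in> SigmaA K A"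
    have zl: "z l \<in> {1..K}" "A (z l) (z (Suc l)) = 1" and yl: "y l \<in> {1..K}" "A (y l) (y (Suc l)) = 1" for l
      using z y by (auto simp: SigmaA_def)
    \<comment> \<open>An empty prefix has no last symbol; the connecting path may then start
      anywhere, for instance at \<open>y 0\<close>.\<close>
    define a where "a = (if n = 0 then y 0 else z (n - 1))"
    have a: "a \<in> {1..K}" using zl yl by (simp add: a_def)
    obtain w where w: "w 0 = a" "w (Suc G) = y 0" "\<And>k. k < Suc G \<Longrightarrow> w k \<in> {1..K} \<and> A (w k) (w (Suc k)) \<noteq> 0"
      using matpow_path[OF M[OF a yl(1)[of 0]] a] unfolding G by blast
    have wl: "w k \<in> {1..K}" if "k \<le> Suc G" for k
      using that w(2,3) yl(1)[of 0] by (cases "k = Suc G") auto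
    have wA: "A (w k) (w (Suc k)) = 1" if "k < Suc G" for k
      using w(3)[OF that] wl[of k] wl[of "Suc k"] that A(1) unfolding zero_one_matrix_def by (metis Suc_leI insertE less_imp_le singletonD)
    define v where "v k = (if k < n then z k else if k \<le> n + G then w (Suc (k - n)) else y (k - n - G))" for k
    have "v \<in> SigmaA K A"
      unfolding SigmaA_def
    proof (intro CollectI conjI allI)
      fix l
      show "v l \<in> {1..K}" unfolding v_def using zl yl wl by simp
      consider "Suc l < n" | "Suc l = n" | "n \<le> l" "l < n + G" | "l = n + G" | "n + G < l" by linarith
      then show "A (v l) (v (Suc l)) = 1"
      proof cases
        case 1 then show ?thesis using zl by (simp add: v_def)
      next
        case 2
        then have "v l = w 0" "v (Suc l) = w (Suc 0)" using w(1) by (auto simp: v_def a_def)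
        then show ?thesis using wA[of 0] by simp
      next
        case 3
        then have "v l = w (Suc (l - n))" "v (Suc l) = w (Suc (Suc (l - n)))" by (auto simp: v_def Suc_diff_le)
        then show ?thesis using wA[of "Suc (l - n)"] 3 by simp
      next
        case 4
        then have "v l = y 0" "v (Suc l) = y (Suc 0)" using w(2) by (auto simp: v_def)
        then show ?thesis using yl by simp
      next
        case 5
        then have "v l = y (l - n - G)" "v (Suc l) = y (Suc (l - n - G))" by (auto simp: v_def Suc_diff_le)
        then show ?thesis using yl by simp
      qed
    qed
    moreover have "agree n v z" by (simp add: agree_def v_def)
    moreover have "(shift ^^ (n + G)) v = y"
      using w(2) by (auto simp: fun_eq_iff shift_pow_apply v_def)
    ultimately show "\<exists>v\<in>SigmaA K A. agree n v z \<and> (shift ^^ (n + G)) v = y" by blast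
  qed
  then show ?thesis by blast
qed

text \<open>For equal points the \<open>LEAST\<close> in \<open>agree_len\<close> ranges over an
  empty set and carries no information, hence the premise.\<close>

lemma agree_len_ge_iff: "x \<noteq> y \<Longrightarrow> n \<le> agree_len x y \<longleftrightarrow> agree n x y"
proof
  assume "x \<noteq> y"
  then obtain k where k: "x k \<noteq> y k" by auto
  show "agree n x y" if "n \<le> agree_len x y"
    unfolding agree_def
  proof (intro allI impI)
    fix j assume "j < n"
    then have "j < agree_len x y" using that by simp
    then show "x j = y j" using not_less_Least unfolding agree_len_def by blast
  qed
  show "n \<le> agree_len x y" if "agree n x y"
  proof (rule ccontr)
    assume "\<not> n \<le> agree_len x y"
    then have "x (agree_len x y) = y (agree_len x y)" using that by (simp add: agree_def)
    then show False using LeastI[of "\<lambda>k. x k \<noteq> y k", OF k] unfolding agree_len_def by simp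
  qed
qed

lemma dist_sym_le_iff:
  assumes "K \<ge> 2"
  shows "dist_sym K x y \<le> real K powr (- real n) \<longleftrightarrow> agree n x y"
proof (cases "x = y")
  case False
  have "real K powr (- real (agree_len x y)) \<le> real K powr (- real n) \<longleftrightarrow> n \<le> agree_len x y"
    using assms by (subst powr_le_cancel_iff) auto
  then show ?thesis using False agree_len_ge_iff[OF False] by (simp add: dist_sym_def)
qed (simp add: dist_sym_def)

lemma recurrence_set_eq:
  "K \<ge> 2 \<Longrightarrow> recurrence_set K A \<psi> = {x \<in> SigmaA K A. infinite {n. agree (\<psi> n) ((shift ^^ n) x) x}}"
  by (simp add: recurrence_set_def dist_sym_le_iff)

text \<open>The convention for logarithms of small arguments affects only finitely many
  \<open>n\<close>.\<close>

lemma psi_fun_eventually: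
  "eventually (\<lambda>n. psi_fun K A f M a n = nat \<lfloor>rec_rate (entropy_sym K A M) (asymp_var f M) a (ln (real n))\<rfloor>) sequentially"
proof -
  have "eventually (\<lambda>n. real n > 1 \<and> ln (real n) > 1 \<and> ln (ln (real n)) > 1) sequentially"
    by (intro eventually_conj; real_asymp)
  then show ?thesis
    by eventually_elim (simp add: psi_fun_def Let_def logc_def rec_rate_def lil_def)
qed

section \<open>Continuity, positivity of the variance, and entropy\<close>

context gibbs_subshift
begin

lemma return_infinite_measurable: "{x \<in> X. infinite {n. agree (\<psi> n) ((shift ^^ n) x) x}} \<in> sets \<mu>"
proof -
  have "{x \<in> X. infinite {n. agree (\<psi> n) ((shift ^^ n) x) x}}
      = (\<Inter>m. \<Union>n\<in>{m..}. {x \<in> X. agree (\<psi> n) ((shift ^^ n) x) x})"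
    by (auto simp: infinite_nat_iff_unbounded_le)
  also have "\<dots> \<in> sets \<mu>"
    using return_set_measurable by (intro sets.countable_INT sets.countable_UN') auto
  finally show ?thesis .
qed

text \<open>\<open>cohom_const\<close> speaks of continuous transfer functions, while the Poisson
  equation produces Hoelder ones; this connects the two.\<close>

lemma Hol_sym_continuous:
  assumes K: "K \<ge> 2" and g: "Hol g" shows "sym_continuous K A g"
  unfolding sym_continuous_def
proof (intro ballI allI impI)
  fix x and e :: real assume x: "x \<in> X" and e: "e > 0"
  obtain B where B: "hol B g" using g by (auto simp: Hol_def)
  have "(\<lambda>n. B * \<alpha> ^ n) \<longlonglongrightarrow> B * 0" using alpha by (intro tendsto_mult_left LIMSEQ_power_zero) auto
  then have "eventually (\<lambda>n. B * \<alpha> ^ n < e) sequentially" using e by (intro order_tendstoD) auto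
  then obtain n where n: "B * \<alpha> ^ n < e" using eventually_happens trivial_limit_sequentially by blast
  show "\<exists>\<delta>>0. \<forall>y\<in>X. dist_sym K x y < \<delta> \<longrightarrow> \<bar>g y - g x\<bar> < e"
  proof (intro exI conjI ballI impI)
    show "real K powr (- real n) > 0" using K by simp
    fix y assume y: "y \<in> X" "dist_sym K x y < real K powr (- real n)"
    then have "agree n x y" using dist_sym_le_iff[OF K, of x y n] by simp
    then have "\<bar>g x - g y\<bar> \<le> B * \<alpha> ^ n" using holD[OF B x y(1)] by blast
    then show "\<bar>g y - g x\<bar> < e" using n by (simp add: abs_minus_commute)
  qed
qed

text \<open>The moments are computed with the normalised potential, but the resulting bounds mention
  only \<open>\<mu>\<close> and \<open>F\<close>, so they can be combined with the original
  \<open>\<phi>\<close>.\<close>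

lemma gibbs_observable_exists:
  assumes F: "Hol F" "(\<integral>x. F x \<partial>\<mu>) = 0"
    and no: "\<And>v. Hol v \<Longrightarrow> \<exists>x\<in>X. F x \<noteq> v (shift x) - v x"
  obtains B\<^sub>F \<rho> t0 P c where "gibbs_observable K A G \<mu> \<phi> \<alpha> \<Phi> b C F B\<^sub>F \<rho> t0 P c"
    "(\<lambda>n. (1 / real n) * (\<integral>x. (birkhoff F n x)\<^sup>2 \<partial>\<mu>)) \<longlonglongrightarrow> \<rho>"
proof -
  obtain \<psi> \<Phi>' b' C' where N: "gibbs_subshift K A G \<mu> \<psi> \<alpha> \<Phi>' b' C'" "\<And>x. x \<in> X \<Longrightarrow> tr \<psi> (\<lambda>_. 1) x = 1"
    using normalized_potential_exists by blast
  interpret N: normalized_gibbs K A G \<mu> \<psi> \<alpha> \<Phi>' b' C'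
    by (intro normalized_gibbs.intro normalized_gibbs_axioms.intro N)
  obtain \<rho> v t0 P c where *: "\<rho> \<ge> 0" "Hol v"
    "\<rho> = 0 \<Longrightarrow> (\<forall>x\<in>X. F x = v (shift x) - v x)"
    "(\<lambda>n. (1 / real n) * (\<integral>x. (birkhoff F n x)\<^sup>2 \<partial>\<mu>)) \<longlonglongrightarrow> \<rho>"
    "t0 > 0" "t0 \<le> 1" "P \<ge> 1" "c \<ge> 0"
    "\<And>t n. \<bar>t\<bar> \<le> t0 \<Longrightarrow> (\<integral>x. exp (t * birkhoff F n x) \<partial>\<mu>) \<le> P * exp (real n * (\<rho> * t\<^sup>2 / 2 + c * \<bar>t\<bar> ^ 3))"
    "\<And>t n. \<bar>t\<bar> \<le> t0 \<Longrightarrow> exp (real n * (\<rho> * t\<^sup>2 / 2 - c * \<bar>t\<bar> ^ 3)) / P \<le> (\<integral>x. exp (t * birkhoff F n x) \<partial>\<mu>)"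
    using N.observable_asymptotics[OF F] by blast
  have rho: "\<rho> > 0" using *(1,3) no[OF *(2)] by fastforce
  obtain B\<^sub>F where B: "hol B\<^sub>F F" using F(1) by (auto simp: Hol_def)
  have "gibbs_observable K A G \<mu> \<phi> \<alpha> \<Phi> b C F B\<^sub>F \<rho> t0 P c"
    by unfold_locales (use B F(2) rho * in auto)
  then show ?thesis using that *(4) by blast
qed

lemma ln_measure_Cy:
  assumes "x \<in> X" shows "\<bar>ln (measure \<mu> (Cy n x)) - birkhoff \<phi> n x\<bar> \<le> ln C"
proof -
  have pos: "measure \<mu> (Cy n x) > 0" by (rule measure_Cy_pos[OF assms])
  have "ln (measure \<mu> (Cy n x)) \<le> ln (C * exp (birkhoff \<phi> n x))"
    using gibbs_upper[OF assms, of n] pos C_pos by (subst ln_le_cancel_iff) auto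
  moreover have "ln (exp (birkhoff \<phi> n x) / C) \<le> ln (measure \<mu> (Cy n x))"
    using gibbs_lower[OF assms, of n] pos C_pos by (subst ln_le_cancel_iff) auto
  ultimately show ?thesis using C_pos by (simp add: ln_mult ln_div abs_le_iff)
qed

text \<open>The sum is the integral of \<open>ln (measure \<mu> (Cy n x))\<close>, whose integrand
  is within \<open>ln C\<close> of the Birkhoff sum.\<close>

lemma entropy_sum_bound:
  "\<bar>(\<Sum>U\<in>cyls n. measure \<mu> U * ln (measure \<mu> U)) - real n * (\<integral>x. \<phi> x \<partial>\<mu>)\<bar> \<le> ln C"
proof -
  have dt: "det n (\<lambda>x. ln (measure \<mu> (Cy n x)))" by (rule det_Cy_fun)
  have "(\<integral>x. ln (measure \<mu> (Cy n x)) \<partial>\<mu>) = (\<Sum>U\<in>cyls n. measure \<mu> U * ln (measure \<mu> U))"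
    unfolding integral_det[OF dt] by (intro sum.cong refl) (metis cyls_rep)
  then have "(\<Sum>U\<in>cyls n. measure \<mu> U * ln (measure \<mu> U)) - real n * (\<integral>x. \<phi> x \<partial>\<mu>)
     = (\<integral>x. ln (measure \<mu> (Cy n x)) - birkhoff \<phi> n x \<partial>\<mu>)"
    using integral_birkhoff[OF Hol_phi, of n] det_integrable[OF dt] Hol_integrable[OF Hol_birkhoff[OF Hol_phi]] by simp
  also have "\<bar>\<dots>\<bar> \<le> (\<integral>x. \<bar>ln (measure \<mu> (Cy n x)) - birkhoff \<phi> n x\<bar> \<partial>\<mu>)" by (rule integral_abs_bound)
  also have "\<dots> \<le> (\<integral>x. ln C \<partial>\<mu>)"
    using ln_measure_Cy det_integrable[OF dt] Hol_integrable[OF Hol_birkhoff[OF Hol_phi]] by (intro integral_mono_X) auto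
  finally show ?thesis using prob_space by simp
qed

text \<open>A word without infinite continuation has an empty cylinder and contributes 0; the other
  words correspond bijectively to \<open>cyls n\<close>.\<close>

lemma sum_admissible_words:
  "(\<Sum>w\<in>admissible_words K A n. measure \<mu> (cyl K A w) * ln (measure \<mu> (cyl K A w)))
    = (\<Sum>U\<in>cyls n. measure \<mu> U * ln (measure \<mu> U))"
proof -
  let ?W = "(\<lambda>x. map x [0..<n]) ` X"
  have sub: "?W \<subseteq> admissible_words K A n"
    by (auto simp: admissible_words_def SigmaA_def)
  have fin: "finite (admissible_words K A n)"
    by (rule finite_subset[OF _ finite_lists_length_eq[of "{1..K}" n]]) (auto simp: admissible_words_def)
  have zero: "cyl K A w = {}" if "w \<in> admissible_words K A n - ?W" for w
  proof (rule ccontr)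
    assume "cyl K A w \<noteq> {}"
    then obtain x where x: "x \<in> X" "\<forall>k<length w. x k = w ! k" by (auto simp: cyl_def)
    have "length w = n" using that by (auto simp: admissible_words_def)
    then have "w = map x [0..<n]" using x(2) by (intro nth_equalityI) auto
    then show False using that x(1) by auto
  qed
  have inj: "inj_on (cyl K A) ?W"
  proof (rule inj_onI)
    fix w w' assume "w \<in> ?W" "w' \<in> ?W" and eq: "cyl K A w = cyl K A w'"
    then obtain x y where xy: "x \<in> X" "w = map x [0..<n]" "w' = map y [0..<n]" by auto
    have "x \<in> cyl K A w'" using xy eq by (auto simp: cyl_def)
    then show "w = w'" using xy by (auto simp: cyl_def)
  qed
  have img: "cyl K A ` ?W = cyls n" by (auto simp: cyls_def Cy_eq_cyl)
  have "(\<Sum>w\<in>admissible_words K A n. measure \<mu> (cyl K A w) * ln (measure \<mu> (cyl K A w)))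
     = (\<Sum>w\<in>?W. measure \<mu> (cyl K A w) * ln (measure \<mu> (cyl K A w)))"
    using zero by (intro sum.mono_neutral_right fin sub) auto
  also have "\<dots> = (\<Sum>U\<in>cyl K A ` ?W. measure \<mu> U * ln (measure \<mu> U))" by (simp add: sum.reindex[OF inj])
  finally show ?thesis unfolding img .
qed

text \<open>The variational identity for the Gibbs measure, entropy equals pressure minus the mean
  of \<open>f\<close>, because \<open>\<phi>\<close> is \<open>f\<close> minus the pressure.\<close>

lemma entropy_sym_eq: "entropy_sym K A \<mu> = - (\<integral>x. \<phi> x \<partial>\<mu>)"
proof -
  let ?s = "\<lambda>n. (\<Sum>U\<in>cyls n. measure \<mu> U * ln (measure \<mu> U))"
  have "(\<lambda>n. - (1 / real n) * ?s n - - (\<integral>x. \<phi> x \<partial>\<mu>)) \<longlonglongrightarrow> 0"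
  proof (rule Lim_null_comparison)
    show "eventually (\<lambda>n. norm (- (1 / real n) * ?s n - - (\<integral>x. \<phi> x \<partial>\<mu>)) \<le> ln C / real n) sequentially"
      using eventually_gt_at_top[of 0]
    proof eventually_elim
      case (elim n)
      have "- (1 / real n) * ?s n - - (\<integral>x. \<phi> x \<partial>\<mu>) = - ((?s n - real n * (\<integral>x. \<phi> x \<partial>\<mu>)) / real n)"
        using elim by (simp add: field_simps)
      then have "norm (- (1 / real n) * ?s n - - (\<integral>x. \<phi> x \<partial>\<mu>)) = \<bar>?s n - real n * (\<integral>x. \<phi> x \<partial>\<mu>)\<bar> / real n" by simp
      also have "\<dots> \<le> ln C / real n" by (intro divide_right_mono entropy_sum_bound) auto
      finally show ?case .
    qed
    show "(\<lambda>n. ln C / real n) \<longlonglongrightarrow> 0" by (rule lim_const_over_n)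
  qed
  then have "(\<lambda>n. - (1 / real n) * ?s n) \<longlonglongrightarrow> - (\<integral>x. \<phi> x \<partial>\<mu>)" by (rule LIM_zero_cancel)
  then show ?thesis unfolding entropy_sym_def sum_admissible_words by (rule limI)
qed

text \<open>A cylinder of length \<open>J (G + 1)\<close> avoids, at each of \<open>J\<close> sites separated by gaps of length \<open>G\<close>, one of two
  fixed disjoint 1-cylinders; hence its measure is exponentially small and the entropy is positive.\<close>

lemma mean_phi_neg:
  assumes xy: "x \<in> X" "y \<in> X" "x 0 \<noteq> y 0"
  shows "(\<integral>z. \<phi> z \<partial>\<mu>) < 0"
proof -
  define \<delta> where "\<delta> = gap * min (measure \<mu> (Cy 1 x)) (measure \<mu> (Cy 1 y))"
  have d0: "\<delta> > 0" using gap_pos measure_Cy_pos xy by (simp add: \<delta>_def)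
  have mx: "\<delta> \<le> gap * measure \<mu> (Cy 1 x)" "\<delta> \<le> gap * measure \<mu> (Cy 1 y)"
    using gap_pos by (auto simp: \<delta>_def)
  have small: "ln (measure \<mu> (Cy (J * (G + 1)) z)) \<le> - (real J * \<delta>)" if z: "z \<in> X" for J z
  proof -
    define p where "p j = j * (G + 1) + G" for j
    \<comment> \<open>Of the two cylinders the one that \<open>z\<close> misses at this site; every
      point of the long cylinder of \<open>z\<close> then misses it too.\<close>
    define U where "U j = (if z (p j) = x 0 then Cy 1 y else Cy 1 x)" for j
    have U1: "{v \<in> X. v \<in> U j} = U j" for j using Cy_subset by (auto simp: U_def)
    have "Cy (J * (G + 1)) z \<subseteq> {v \<in> X. True \<and> (\<forall>j<J. \<not> (shift ^^ p j) v \<in> U j)}"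
    proof (intro subsetI CollectI conjI allI impI)
      fix v assume v: "v \<in> Cy (J * (G + 1)) z"
      then show "v \<in> X" using Cy_subset by blast
      fix j assume j: "j < J"
      have "Suc j * (G + 1) \<le> J * (G + 1)" using j by (intro mult_right_mono) auto
      then have "p j < J * (G + 1)" by (simp add: p_def)
      then have "v (p j) = z (p j)" using v by (simp add: Cy_def agree_def)
      then show "\<not> (shift ^^ p j) v \<in> U j"
        using xy(3) by (auto simp: U_def Cy_def agree_def shift_pow_apply split: if_splits)
    qed simp
    then have "measure \<mu> (Cy (J * (G + 1)) z) \<le> measure \<mu> {v \<in> X. True \<and> (\<forall>j<J. \<not> (shift ^^ p j) v \<in> U j)}"
    proof (rule finite_measure_mono)
      have "{v \<in> X. True \<and> (\<forall>j<J. \<not> (shift ^^ p j) v \<in> U j)} = space \<mu> - (\<Union>j<J. {v \<in> X. (shift ^^ p j) v \<in> U j})"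
        by (auto simp: space_\<mu>)
      moreover have "{v \<in> X. (shift ^^ p j) v \<in> U j} \<in> sets \<mu>" for j
        using det_Collect_measurable[OF det_shift[OF det_mem_Cy]] by (simp add: U_def)
      ultimately show "{v \<in> X. True \<and> (\<forall>j<J. \<not> (shift ^^ p j) v \<in> U j)} \<in> sets \<mu>" by auto
    qed
    also have "\<dots> \<le> measure \<mu> {v \<in> X. True} * (\<Prod>j<J. 1 - gap * measure \<mu> {v \<in> X. v \<in> U j})"
    proof (rule prob_avoid[where ?n0.0 = 0 and l = "\<lambda>_. 1"])
      show "det 0 (\<lambda>v. True)" by (simp add: det_def)
      show "det 1 (\<lambda>v. v \<in> U j)" for j unfolding U_def using det_mem_Cy by simp
    qed (auto simp: p_def)
    also have "\<dots> \<le> 1 * (\<Prod>j<J. exp (- \<delta>))"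
    proof (intro mult_mono prod_mono conjI)
      fix j
      show "0 \<le> 1 - gap * measure \<mu> {v \<in> X. v \<in> U j}"
        using gap_le_1 gap_pos mult_le_one[of gap "measure \<mu> {v \<in> X. v \<in> U j}"] by simp
      have "\<delta> \<le> gap * measure \<mu> (U j)" using mx by (simp add: U_def)
      then show "1 - gap * measure \<mu> {v \<in> X. v \<in> U j} \<le> exp (- \<delta>)"
        unfolding U1 using exp_ge_add_one_self[of "- \<delta>"] by linarith
    qed (use gap_le_1 gap_pos in \<open>auto intro!: prod_nonneg mult_le_one\<close>)
    also have "\<dots> = exp (- (real J * \<delta>))" by (simp add: exp_of_nat_mult[symmetric])
    finally have "ln (measure \<mu> (Cy (J * (G + 1)) z)) \<le> ln (exp (- (real J * \<delta>)))"
      using measure_Cy_pos[OF z] by (subst ln_le_cancel_iff) auto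
    then show ?thesis by simp
  qed
  have "real J * (real (G + 1) * (\<integral>z. \<phi> z \<partial>\<mu>)) \<le> ln C + real J * (- \<delta>)" for J
  proof -
    let ?n = "J * (G + 1)"
    have "(\<Sum>U\<in>cyls ?n. measure \<mu> U * ln (measure \<mu> U)) \<le> (\<Sum>U\<in>cyls ?n. measure \<mu> U * (- (real J * \<delta>)))"
      using small by (intro sum_mono mult_left_mono) (auto simp: cyls_def)
    also have "\<dots> = - (real J * \<delta>)" unfolding sum_distrib_right[symmetric] sum_measure_cyls by simp
    finally have "(\<Sum>U\<in>cyls ?n. measure \<mu> U * ln (measure \<mu> U)) \<le> - (real J * \<delta>)" .
    moreover have "real ?n * (\<integral>z. \<phi> z \<partial>\<mu>) = real J * (real (G + 1) * (\<integral>z. \<phi> z \<partial>\<mu>))"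
      by (simp only: of_nat_mult mult.assoc)
    ultimately show ?thesis using entropy_sum_bound[of ?n] unfolding abs_le_iff by linarith
  qed
  then have "real (G + 1) * (\<integral>z. \<phi> z \<partial>\<mu>) \<le> - \<delta>" by (rule linear_bound_imp_le)
  then have "real (G + 1) * (\<integral>z. \<phi> z \<partial>\<mu>) < 0" using d0 by linarith
  then show ?thesis by (simp add: mult_less_0_iff)
qed

end

theorem theorem2p4:
  fixes K :: nat and A :: "nat \<Rightarrow> nat \<Rightarrow> nat" and f :: "(nat \<Rightarrow> nat) \<Rightarrow> real"
    and \<mu> :: "(nat \<Rightarrow> nat) measure" and \<epsilon> :: real
  assumes "K \<ge> 2"
    and "zero_one_matrix K A"
    and "primitive_matrix K A"
    and "holder K A f"
    and "gibbs_measure K A f \<mu>"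
    and "\<not> cohom_const K A f"
    and "\<epsilon> > 0"
  shows "recurrence_set K A (psi_fun K A f \<mu> (1 + \<epsilon>)) \<in> sets \<mu>
    \<and> measure \<mu> (recurrence_set K A (psi_fun K A f \<mu> (1 + \<epsilon>))) = 0
    \<and> recurrence_set K A (psi_fun K A f \<mu> (1 - \<epsilon>)) \<in> sets \<mu>
    \<and> measure \<mu> (recurrence_set K A (psi_fun K A f \<mu> (1 - \<epsilon>))) = 1"
proof -
  obtain G where spec: "specification_subshift K A G" using primitive_specification assms(1-3) by blast
  obtain b \<alpha> where b: "b > 0" and \<alpha>: "0 < \<alpha>" "\<alpha> < 1"
    and f_hol: "\<And>x y. x \<in> SigmaA K A \<Longrightarrow> y \<in> SigmaA K A \<Longrightarrow> x \<noteq> y \<Longrightarrow> \<bar>f x - f y\<bar> \<le> b * \<alpha> ^ agree_len x y"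
    using assms(4) unfolding holder_def by blast
  have f_var: "\<bar>f x - f y\<bar> \<le> b * \<alpha> ^ n" if "x \<in> SigmaA K A" "y \<in> SigmaA K A" "agree n x y" for x y n
  proof (cases "x = y")
    case False
    have "\<bar>f x - f y\<bar> \<le> b * \<alpha> ^ agree_len x y" by (rule f_hol[OF that(1,2) False])
    also have "\<dots> \<le> b * \<alpha> ^ n"
      using \<alpha> b agree_len_ge_iff[OF False] that(3) by (intro mult_left_mono power_decreasing) auto
    finally show ?thesis .
  qed (use b \<alpha> in simp)
  obtain C where C: "C > 1" and gib: "\<And>x n. x \<in> SigmaA K A \<Longrightarrow>
        1 / C \<le> measure \<mu> (cyl K A (map x [0..<n])) / exp (- real n * pressure K A f + birkhoff f n x) \<and>
        measure \<mu> (cyl K A (map x [0..<n])) / exp (- real n * pressure K A f + birkhoff f n x) \<le> C"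
    and pr: "prob_space \<mu>" and st: "sets \<mu> = sets (shift_space K A)" and inv: "shift_invariant \<mu>"
    using assms(5) unfolding gibbs_measure_def by blast
  define \<phi> where "\<phi> x = f x + (- pressure K A f)" for x
  have Sphi: "birkhoff \<phi> n x = - real n * pressure K A f + birkhoff f n x" for n x
    unfolding \<phi>_def birkhoff_plus birkhoff_const by simp
  have "\<exists>\<Phi>. \<forall>x\<in>SigmaA K A. \<bar>\<phi> x\<bar> \<le> \<Phi>"
  proof (cases "SigmaA K A = {}")
    case False
    then obtain x0 where x0: "x0 \<in> SigmaA K A" by auto
    have "\<bar>\<phi> x\<bar> \<le> \<bar>\<phi> x0\<bar> + b" if "x \<in> SigmaA K A" for x
      using f_var[OF that x0, of 0] by (simp add: \<phi>_def)
    then show ?thesis by blast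
  qed simp
  then obtain \<Phi> where \<Phi>: "\<And>x. x \<in> SigmaA K A \<Longrightarrow> \<bar>\<phi> x\<bar> \<le> \<Phi>" by blast
  have "gibbs_subshift K A G \<mu> \<phi> \<alpha> \<Phi> b C"
  proof (intro gibbs_subshift.intro gibbs_subshift_axioms.intro pr spec)
    show "\<bar>\<phi> x - \<phi> y\<bar> \<le> b * \<alpha> ^ n" if "x \<in> SigmaA K A" "y \<in> SigmaA K A" "agree n x y" for x y n
      using f_var[OF that] by (simp add: \<phi>_def)
    fix x n assume x: "x \<in> SigmaA K A"
    show "exp (birkhoff \<phi> n x) / C \<le> measure \<mu> (specification_subshift.Cy K A n x)"
      using gib[OF x, of n] C unfolding Sphi specification_subshift.Cy_eq_cyl[OF spec] by (simp add: field_simps)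
    show "measure \<mu> (specification_subshift.Cy K A n x) \<le> C * exp (birkhoff \<phi> n x)"
      using gib[OF x, of n] C unfolding Sphi specification_subshift.Cy_eq_cyl[OF spec] by (simp add: field_simps)
  qed (use st inv \<alpha> \<Phi> C in auto)
  then interpret gibbs_subshift K A G \<mu> \<phi> \<alpha> \<Phi> b C .
  have Hf: "Hol f" by (rule HolI[OF holI]) (rule f_var)
  define I where "I = (\<integral>x. f x \<partial>\<mu>)"
  \<comment> \<open>\<open>\<phi>\<close> equals \<open>F\<close> minus the entropy, which splits
    the logarithm of a cylinder measure into the drift \<open>- h * n\<close> and the fluctuation
    \<open>birkhoff F n x\<close>.\<close>
  define F where "F x = f x + (- I)" for x
  have HF: "Hol F" unfolding F_def by (intro Hol_add Hf Hol_const)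
  have F0: "(\<integral>x. F x \<partial>\<mu>) = 0"
    unfolding F_def using Hol_integrable[OF Hf] prob_space by (simp add: I_def)
  have SF: "birkhoff F n x = birkhoff f n x - real n * I" for n x
    unfolding F_def birkhoff_plus birkhoff_const by simp
  define h where "h = entropy_sym K A \<mu>"
  have h_phi: "h = - (\<integral>x. \<phi> x \<partial>\<mu>)" unfolding h_def by (rule entropy_sym_eq)
  have h_eq: "h = pressure K A f - I"
    unfolding h_phi \<phi>_def using Hol_integrable[OF Hf] prob_space by (simp add: I_def)
  \<comment> \<open>If all points had the same first symbol, applying this to shifted points would
    make \<open>X\<close> a single point, on which every function is constant.\<close>
  have "\<exists>x\<in>X. \<exists>y\<in>X. x 0 \<noteq> y 0"
  proof (rule ccontr)
    assume "\<not> ?thesis"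
    then have same: "x 0 = y 0" if "x \<in> X" "y \<in> X" for x y using that by blast
    have "x = y" if "x \<in> X" "y \<in> X" for x y
      using same[OF shift_pow_in[OF that(1)] shift_pow_in[OF that(2)]] by (auto simp: shift_pow_apply fun_eq_iff)
    moreover obtain x0 where "x0 \<in> X" using X_nonempty by auto
    ultimately have "\<forall>x\<in>X. f x = 0 - 0 + f x0" by auto
    moreover have "sym_continuous K A (\<lambda>_. 0)" by (rule Hol_sym_continuous[OF assms(1) Hol_const])
    ultimately have "cohom_const K A f" unfolding cohom_const_def by blast
    then show False using assms(6) by simp
  qed
  then have h0: "h > 0" using mean_phi_neg h_phi by fastforce
  have "\<exists>x\<in>X. F x \<noteq> v (shift x) - v x" if v: "Hol v" for v
  proof (rule ccontr)
    assume "\<not> ?thesis"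
    then have "\<forall>x\<in>X. f x = v (shift x) - v x + I" by (auto simp: F_def)
    then have "cohom_const K A f" unfolding cohom_const_def using Hol_sym_continuous[OF assms(1) v] by blast
    then show False using assms(6) by simp
  qed
  then obtain B\<^sub>F \<rho> t0 P c where obs: "gibbs_observable K A G \<mu> \<phi> \<alpha> \<Phi> b C F B\<^sub>F \<rho> t0 P c"
    and var: "(\<lambda>n. (1 / real n) * (\<integral>x. (birkhoff F n x)\<^sup>2 \<partial>\<mu>)) \<longlonglongrightarrow> \<rho>"
    using gibbs_observable_exists[OF HF F0] by blast
  interpret O: gibbs_observable K A G \<mu> \<phi> \<alpha> \<Phi> b C F B\<^sub>F \<rho> t0 P c by (rule obs)
  have rho: "asymp_var f \<mu> = \<rho>"
    unfolding asymp_var_def using var unfolding SF I_def by (rule limI)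
  have phiF: "birkhoff \<phi> n x = - h * real n + birkhoff F n x" for n x
    unfolding Sphi SF h_eq by (simp add: algebra_simps)
  have up: "measure \<mu> (Cy n x) \<le> exp (ln C - h * real n + birkhoff F n x)" if "x \<in> X" for x n
  proof -
    have "exp (ln C - h * real n + birkhoff F n x) = C * exp (birkhoff \<phi> n x)"
      unfolding phiF using C by (simp add: exp_add exp_diff exp_minus field_simps)
    then show ?thesis using gibbs_upper[OF that, of n] by simp
  qed
  have low: "exp (- ln C - h * real n + birkhoff F n x) \<le> measure \<mu> (Cy n x)" if "x \<in> X" for x n
  proof -
    have "exp (- ln C - h * real n + birkhoff F n x) = exp (birkhoff \<phi> n x) / C"
      unfolding phiF using C by (simp add: exp_add exp_diff exp_minus field_simps)
    then show ?thesis using gibbs_lower[OF that, of n] by simp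
  qed
  have psi: "eventually (\<lambda>n. psi_fun K A f \<mu> a n = nat \<lfloor>rec_rate h \<rho> a (ln (real n))\<rfloor>) sequentially" for a
    using psi_fun_eventually[of K A f \<mu> a] unfolding rho h_def .
  \<comment> \<open>\<open>recurrence_full\<close> asks for a coefficient strictly between 0 and 1.
    For \<open>\<epsilon> > 1 / 2\<close> the coefficient \<open>1 - \<epsilon>\<close> is raised to
    \<open>1 / 2\<close>, which only demands longer matches.\<close>
  define a where "a = max (1 - \<epsilon>) (1 / 2)"
  have a: "0 < a" "a < 1" "1 - \<epsilon> \<le> a" using assms(7) by (auto simp: a_def)
  have "eventually (\<lambda>n. lil \<rho> (ln (real n)) > 0) sequentially"
    by (rule eventually_compose_filterlim[OF lil_eventually_pos[OF O.rho]]) real_asymp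
  then have psi_low: "eventually (\<lambda>n. real (psi_fun K A f \<mu> (1 - \<epsilon>) n) \<le> rec_rate h \<rho> a (ln (real n))) sequentially"
    using psi[of "1 - \<epsilon>"] eventually_ge_at_top[of 1]
  proof eventually_elim
    case (elim n)
    let ?r = "\<lambda>a. rec_rate h \<rho> a (ln (real n))"
    have "(1 - \<epsilon>) / h powr (3/2) * lil \<rho> (ln (real n)) \<le> a / h powr (3/2) * lil \<rho> (ln (real n))"
      using a elim(1) by (intro mult_right_mono divide_right_mono) auto
    then have "?r (1 - \<epsilon>) \<le> ?r a" by (simp add: rec_rate_def)
    moreover have "0 \<le> ?r a" using a elim h0 by (simp add: rec_rate_def)
    ultimately show ?case unfolding elim(2) by linarith
  qed
  let ?R = "\<lambda>a. recurrence_set K A (psi_fun K A f \<mu> a)"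
  have R_sets: "?R a \<in> sets \<mu>" for a
    unfolding recurrence_set_eq[OF assms(1)] by (rule return_infinite_measurable)
  have "AE x in \<mu>. finite {n. agree (psi_fun K A f \<mu> (1 + \<epsilon>) n) ((shift ^^ n) x) x}"
    by (rule O.recurrence_null[OF h0 _ assms(7) psi]) (rule up)
  then have "AE x in \<mu>. x \<notin> ?R (1 + \<epsilon>)"
    by eventually_elim (simp add: recurrence_set_eq[OF assms(1)])
  then have 0: "measure \<mu> (?R (1 + \<epsilon>)) = 0" using R_sets by (subst prob_eq_0) auto
  have "AE x in \<mu>. infinite {n. agree (psi_fun K A f \<mu> (1 - \<epsilon>) n) ((shift ^^ n) x) x}"
    by (rule O.recurrence_full[OF h0 _ a(1,2) psi_low]) (rule low)
  then have "AE x in \<mu>. x \<in> ?R (1 - \<epsilon>)"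
    using AE_space
    by eventually_elim (simp add: recurrence_set_eq[OF assms(1)] space_\<mu>)
  then have 1: "measure \<mu> (?R (1 - \<epsilon>)) = 1" using R_sets by (subst prob_eq_1) auto
  show ?thesis using R_sets 0 1 by blast
qed

end
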